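(* Fix $d \geq 2$ and $\epsilon > 0$. For $P \sim P_1(d,m)$, the probability that $|f_{d-1}(P) - F(d)m| \geq \epsilon F(d) m$ is $O(1/m)$ as $m \to \infty$.
   Context: $P \sim P_1(d,m)$ means $P$ is the convex hull of $m$ independent uniformly random points on the unit sphere $S^{d-1} \subset \mathbb{R}^d$; $f_{d-1}(P)$ is its number of facets. $F(d) = \lim_{m\to\infty}\mathbb{E}(f_{d-1}(P))/m$ (this limit exists and equals $\frac{2}{d}\gamma_{(d-1)^2}\gamma_{d-1}^{-(d-1)}$ with $\gamma_0 = 1/2$, $\gamma_{k+1} = \frac{1}{2\pi(k+1)\gamma_k}$). *)

theory Defs
  imports "HOL-Probability.Probability" "HOL-Library.Landau_Symbols"
begin

text \<open>
  The uniform distribution on the unit sphere, as a measure on the ambient Euclidean space that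
  is concentrated on the sphere.  It is the normalised cone measure: the radial
  projection of the uniform distribution on the unit ball, which is the same as normalised
  surface measure.  (\<open>sgn x = x /\<^sub>R norm x\<close>, and the exceptional point
  \<open>0\<close> is a null set.)
\<close>

definition uniform_sphere :: "'a::euclidean_space measure" where
  "uniform_sphere = distr (uniform_measure lborel (ball 0 1)) borel sgn"

lemma borel_measurable_sgn_euclidean [measurable]:
  "(sgn :: 'a::euclidean_space \<Rightarrow> 'a) \<in> borel_measurable borel"
  unfolding sgn_div_norm [abs_def] by measurable

lemma emeasure_unit_ball:
  "emeasure lborel (ball (0::'a::euclidean_space) 1) \<noteq> 0"
  "emeasure lborel (ball (0::'a::euclidean_space) 1) < \<infinity>"
  using content_ball_pos[of 1 "0::'a"] emeasure_lborel_ball_finite[of "0::'a" 1]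
  by (auto simp: measure_def infinity_ennreal_def)

lemma sets_uniform_sphere [measurable_cong, simp]: "sets uniform_sphere = sets borel"
  by (simp add: uniform_sphere_def)

lemma space_uniform_sphere [simp]: "space uniform_sphere = UNIV"
  by (simp add: uniform_sphere_def)

lemma prob_space_uniform_sphere: "prob_space (uniform_sphere :: 'a::euclidean_space measure)"
proof -
  interpret prob_space "uniform_measure lborel (ball (0::'a) 1)"
    using emeasure_unit_ball by (intro prob_space_uniform_measure) (auto simp: less_top)
  show ?thesis
    unfolding uniform_sphere_def by (rule prob_space_distr) simp
qed

lemma AE_uniform_sphere: "AE x in (uniform_sphere :: 'a::euclidean_space measure). x \<in> sphere 0 1"
proof -
  have "AE x in uniform_measure lborel (ball (0::'a) 1). sgn x \<in> sphere 0 1"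
    using AE_lborel_singleton[of "0::'a"]
    by (subst AE_uniform_measure[OF emeasure_unit_ball]) (auto simp: norm_sgn)
  then show ?thesis
    unfolding uniform_sphere_def by (subst AE_distr_iff) simp_all
qed

definition random_points :: "nat \<Rightarrow> (nat \<Rightarrow> 'a::euclidean_space) measure" where
  "random_points m = PiM {..<m} (\<lambda>_. uniform_sphere)"

definition hull_of :: "nat \<Rightarrow> (nat \<Rightarrow> 'a::euclidean_space) \<Rightarrow> 'a set" where
  "hull_of m x = convex hull (x ` {..<m})"

definition num_facets :: "'a::euclidean_space set \<Rightarrow> nat" where
  "num_facets P = card {F. F facet_of P}"

text \<open>
  \<open>num_facets (hull_of m x)\<close> is a Borel function of \<open>x\<close>, bounded for each fixed \<open>m\<close>, so the
  integral below is the expectation rather than a default value.  In the definition of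
  \<open>facet_rate\<close>, \<open>lim\<close> is meaningful because the sequence converges (in dimension at least 2).
\<close>

definition expected_facets :: "'a::euclidean_space itself \<Rightarrow> nat \<Rightarrow> real" where
  "expected_facets _ m = (\<integral>x. real (num_facets (hull_of m x)) \<partial>(random_points m :: (nat \<Rightarrow> 'a) measure))"

definition facet_rate :: "'a::euclidean_space itself \<Rightarrow> real" where
  "facet_rate T = lim (\<lambda>m. expected_facets T m / real m)"

end

theory Submission
  imports Defs
begin

text \<open>
  Put \<open>n = d - 1\<close>.  Almost surely the facets correspond to the \<open>d\<close>-subsets of the points whose
  hyperplane has all other points on one side, so the expected number of facets is
  \<open>m choose d\<close> times the sum, over the two sides of a random hyperplane, of \<open>E (1 - p) ^ (m - d)\<close>,
  where \<open>p\<close> is the mass of the empty side.  The limit of \<open>E f / m\<close> exists once the probability that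
  \<open>p \<le> t\<close> is asymptotic to a multiple of \<open>t ^ n\<close>.  For this one of the points is rotated to a
  pole and the others are projected stereographically from it: hyperplanes through the pole become
  hyperplanes of dimension one less, being far from the origin is a scale invariant event, and the
  rescaled density is monotone in the scale, so that the scaled probabilities converge because
  they are monotone and bounded.

  The variance is \<open>O(m)\<close>: two facets with disjoint empty caps contribute at most the product of
  their probabilities, as \<open>1 - p - q \<le> (1 - p) (1 - q)\<close>, and if the caps meet then all the vertices
  involved lie within distance \<open>O(max(p, q) powr (1 / n))\<close> of each other, which makes the pairs
  with \<open>l\<close> vertices in total contribute \<open>O(m ^ l / m ^ (l - 1))\<close>.  Chebyshev's inequality finishes
  the proof.
\<close>

section \<open>The uniform distribution on the sphere\<close>

text \<open>What Chebyshev's inequality asks of the limit \<open>F\<close> of \<open>E f / m\<close>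
  is that it exists and is positive, since the bound divides by
  \<open>(\<epsilon> * F / 2)\<^sup>2\<close>; so the constants may come from suprema of monotone
  functions instead of explicit integrals. The parameter tying everything together is the tangent
  \<open>\<rho>\<close> of the angular radius of a cap: the cap has mass of order
  \<open>\<rho> ^ n\<close>, and for a hyperplane through the pole to cut off a cap that small each
  of the other \<open>n\<close> points must come within order \<open>\<rho>\<close> of the pole,
  which has probability of order \<open>\<rho> ^ (n * n)\<close>. Eliminating \<open>\<rho>\<close>
  leaves \<open>t ^ n\<close>.

  The obstacle in the variance is a mismatch of exponents. The product bound for disjoint caps
  involves \<open>m - 2 * d\<close> remaining points, the squared expectation \<open>m - d\<close>,
  and both squares are of order \<open>m\<^sup>2\<close>. Closing the gap needs the decrease of the
  moments of the side masses to be one order smaller than the moments; this comes from convexity in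
  the exponent, not from the asymptotics alone.\<close>

lemma nn_integral_lborel_translate:
  fixes f :: "'a::euclidean_space \<Rightarrow> ennreal"
  assumes [measurable]: "f \<in> borel_measurable borel"
  shows "(\<integral>\<^sup>+y. f (c + y) \<partial>lborel) = (\<integral>\<^sup>+y. f y \<partial>lborel)"
proof -
  have "(\<integral>\<^sup>+y. f y \<partial>lborel) = (\<integral>\<^sup>+y. f y \<partial>(distr lborel borel ((+) c)))"
    by (simp add: lborel_distr_plus)
  also have "\<dots> = (\<integral>\<^sup>+y. f (c + y) \<partial>lborel)"
    by (subst nn_integral_distr) auto
  finally show ?thesis by simp
qed

lemma orthogonal_transformation_borel_measurable:
  fixes T :: "'a::euclidean_space \<Rightarrow> 'a"
  assumes "orthogonal_transformation T"
  shows "T \<in> borel_measurable borel"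
  using assms by (intro borel_measurable_continuous_onI linear_continuous_on)
    (simp add: linear_conv_bounded_linear[symmetric] orthogonal_transformation_linear)

text \<open>Haar's uniqueness argument: integrating \<open>1\<^sub>A(x) 1\<^sub>B(x + T y)\<close> for a ball \<open>A\<close> in both orders.\<close>

lemma distr_lborel_orthogonal:
  fixes T :: "'a::euclidean_space \<Rightarrow> 'a"
  assumes T: "orthogonal_transformation T"
  shows "distr lborel borel T = lborel"
proof (rule measure_eqI)
  note [measurable] = orthogonal_transformation_borel_measurable[OF T]
  define A where "A = ball (0::'a) 1"
  have [measurable]: "A \<in> sets borel" by (simp add: A_def)
  from orthogonal_transformation_surj[OF T] have surj: "\<exists>z. T z = x" for x
    by (metis surj_def)
  have lin: "linear T" by (rule orthogonal_transformation_linear[OF T])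
  fix B assume "B \<in> sets (distr lborel borel T)"
  then have [measurable]: "B \<in> sets borel" by simp
  have "emeasure (distr lborel borel T) B * emeasure lborel A
      = (\<integral>\<^sup>+x. indicator A x * (\<integral>\<^sup>+y. indicator B (T y) \<partial>lborel) \<partial>lborel)"
  proof -
    have "emeasure (distr lborel borel T) B = (\<integral>\<^sup>+y. indicator B y \<partial>(distr lborel borel T))" by simp
    also have "\<dots> = (\<integral>\<^sup>+y. indicator B (T y) \<partial>lborel)" by (subst nn_integral_distr) auto
    finally show ?thesis by (subst nn_integral_multc) (auto simp: mult.commute)
  qed
  \<comment> \<open>Since \<open>T\<close> is onto, \<open>x = T z\<close> for some
    \<open>z\<close>; translating \<open>y\<close> by \<open>z\<close> replaces \<open>T y\<close>
    by \<open>x + T y\<close> at no cost.\<close>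
  also have "\<dots> = (\<integral>\<^sup>+x. indicator A x * (\<integral>\<^sup>+y. indicator B (x + T y) \<partial>lborel) \<partial>lborel)"
  proof (rule nn_integral_cong)
    fix x
    obtain z where z: "T z = x" using surj by blast
    have "(\<integral>\<^sup>+y. indicator B (T y) \<partial>lborel) = (\<integral>\<^sup>+y. indicator B (T (z + y)) \<partial>lborel)"
      by (subst nn_integral_lborel_translate[where f="\<lambda>y. indicator B (T y)"]) auto
    then show "indicator A x * (\<integral>\<^sup>+y. indicator B (T y) \<partial>lborel) = indicator A x * (\<integral>\<^sup>+y. indicator B (x + T y) \<partial>lborel)"
      by (simp add: linear_add[OF lin] z)
  qed
  also have "\<dots> = (\<integral>\<^sup>+x. (\<integral>\<^sup>+y. indicator A x * indicator B (x + T y) \<partial>lborel) \<partial>lborel)"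
    by (intro nn_integral_cong nn_integral_cmult[symmetric]) auto
  also have "\<dots> = (\<integral>\<^sup>+y. (\<integral>\<^sup>+x. indicator A x * indicator B (x + T y) \<partial>lborel) \<partial>lborel)"
    by (rule lborel_pair.Fubini'[symmetric]) measurable
  also have "\<dots> = (\<integral>\<^sup>+y. (\<integral>\<^sup>+x. indicator A (- T y + x) * indicator B x \<partial>lborel) \<partial>lborel)"
  proof (rule nn_integral_cong)
    fix y
    show "(\<integral>\<^sup>+x. indicator A x * indicator B (x + T y) \<partial>lborel) = (\<integral>\<^sup>+x. indicator A (- T y + x) * indicator B x \<partial>lborel)"
      using nn_integral_lborel_translate[of "\<lambda>x. indicator A x * indicator B (x + T y)" "- T y"]
      by simp
  qed
  also have "\<dots> = (\<integral>\<^sup>+x. (\<integral>\<^sup>+y. indicator A (- T y + x) * indicator B x \<partial>lborel) \<partial>lborel)"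
    by (rule lborel_pair.Fubini') measurable
  also have "\<dots> = (\<integral>\<^sup>+x. emeasure lborel A * indicator B x \<partial>lborel)"
  proof (rule nn_integral_cong)
    fix x
    obtain z where z: "T z = x" using surj by blast
    \<comment> \<open>Here \<open>A\<close> has to be a ball about 0:
      \<open>norm (T (z - y)) = norm (z - y)\<close> removes \<open>T\<close> from its indicator,
      and a translate of \<open>A\<close> remains.\<close>
    have "(\<integral>\<^sup>+y. indicator A (- T y + x) \<partial>lborel) = (\<integral>\<^sup>+y. indicator A (- z + y) \<partial>lborel)"
    proof (rule nn_integral_cong)
      fix y
      have "norm (- T y + x) = norm (T (z - y))"
        using z by (simp add: linear_diff[OF lin])
      also have "\<dots> = norm (- z + y)"
        by (simp add: orthogonal_transformation_norm[OF T] norm_minus_commute)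
      finally show "indicator A (- T y + x) = (indicator A (- z + y) :: ennreal)"
        by (simp add: indicator_def A_def)
    qed
    also have "\<dots> = (\<integral>\<^sup>+y. indicator A y \<partial>lborel)"
      by (rule nn_integral_lborel_translate) auto
    finally have *: "(\<integral>\<^sup>+y. indicator A (- T y + x) \<partial>lborel) = emeasure lborel A" by simp
    then show "(\<integral>\<^sup>+y. indicator A (- T y + x) * indicator B x \<partial>lborel) = emeasure lborel A * indicator B x"
      by (subst nn_integral_multc) auto
  qed
  also have "\<dots> = emeasure lborel B * emeasure lborel A"
    by (subst nn_integral_cmult) (auto simp: mult.commute)
  finally show "emeasure (distr lborel borel T) B = emeasure lborel B"
    using emeasure_unit_ball[where 'a='a]
    by (metis A_def ennreal_mult_cancel_left infinity_ennreal_def less_irrefl mult.commute)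
qed simp

lemma nn_integral_uniform_sphere:
  fixes f :: "'a::euclidean_space \<Rightarrow> ennreal"
  assumes [measurable]: "f \<in> borel_measurable borel"
  shows "(\<integral>\<^sup>+x. f x \<partial>uniform_sphere)
       = (\<integral>\<^sup>+y. f (sgn y) * indicator (ball 0 1) y \<partial>lborel) / emeasure lborel (ball (0::'a) 1)"
  unfolding uniform_sphere_def
  by (subst nn_integral_distr) (auto simp: nn_integral_uniform_measure)

lemma emeasure_uniform_sphere:
  fixes A :: "'a::euclidean_space set"
  assumes [measurable]: "A \<in> sets borel"
  shows "emeasure uniform_sphere A
       = emeasure lborel (sgn -` A \<inter> ball 0 1) / emeasure lborel (ball (0::'a) 1)"
proof -
  have [measurable]: "sgn -` A \<in> sets (borel :: 'a measure)"
    using measurable_sets[OF borel_measurable_sgn_euclidean assms] by simp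
  have "emeasure uniform_sphere A = (\<integral>\<^sup>+x. indicator A x \<partial>uniform_sphere)" by simp
  also have "\<dots> = (\<integral>\<^sup>+y. indicator (sgn -` A \<inter> ball 0 1) y \<partial>lborel) / emeasure lborel (ball (0::'a) 1)"
  proof -
    have "(\<integral>\<^sup>+y. indicator A (sgn y) * indicator (ball 0 1) y \<partial>lborel)
        = (\<integral>\<^sup>+y. indicator (sgn -` A \<inter> ball 0 1) y \<partial>lborel)"
      by (intro nn_integral_cong) (auto split: split_indicator)
    then show ?thesis by (subst nn_integral_uniform_sphere) auto
  qed
  finally show ?thesis by simp
qed

lemma measure_uniform_sphere:
  fixes A :: "'a::euclidean_space set"
  assumes "A \<in> sets borel"
  shows "measure uniform_sphere A
       = measure lborel (sgn -` A \<inter> ball 0 1) / measure lborel (ball (0::'a) 1)"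
proof -
  have "emeasure lborel (sgn -` A \<inter> ball 0 1) \<le> emeasure lborel (ball (0::'a) 1)"
    by (intro emeasure_mono) auto
  then show ?thesis
    unfolding measure_def emeasure_uniform_sphere[OF assms]
    using emeasure_unit_ball[where 'a='a] divide_ennreal
    by (cases "emeasure lborel (ball (0::'a) 1)"; cases "emeasure lborel (sgn -` A \<inter> ball (0::'a) 1)")
       (auto simp: divide_ennreal top_unique)
qed

text \<open>\<open>T\<close> commutes with \<open>sgn\<close> and preserves the unit ball, so the
  invariance is inherited from Lebesgue measure.\<close>

lemma distr_uniform_sphere_orthogonal:
  fixes T :: "'a::euclidean_space \<Rightarrow> 'a"
  assumes T: "orthogonal_transformation T"
  shows "distr uniform_sphere borel T = uniform_sphere"
proof (rule measure_eqI)
  note Tm [measurable] = orthogonal_transformation_borel_measurable[OF T]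
  fix A assume "A \<in> sets (distr uniform_sphere borel T)"
  then have A [measurable]: "A \<in> sets borel" by simp
  have [measurable]: "T -` A \<in> sets borel" "sgn -` A \<in> sets (borel :: 'a measure)"
    using measurable_sets[OF Tm A] measurable_sets[OF borel_measurable_sgn_euclidean A] by auto
  have sgnT: "sgn (T y) = T (sgn y)" for y
    by (simp add: sgn_div_norm orthogonal_transformation_norm[OF T]
        linear_scale[OF orthogonal_transformation_linear[OF T]])
  have "emeasure (distr uniform_sphere borel T) A = emeasure uniform_sphere (T -` A)"
    by (subst emeasure_distr) auto
  also have "\<dots> = emeasure lborel (T -` (sgn -` A \<inter> ball 0 1)) / emeasure lborel (ball (0::'a) 1)"
    by (subst emeasure_uniform_sphere)
       (auto intro!: arg_cong2[where f="(/)"] arg_cong2[where f=emeasure]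
          simp: sgnT orthogonal_transformation_norm[OF T])
  also have "emeasure lborel (T -` (sgn -` A \<inter> ball 0 1)) = emeasure (distr lborel borel T) (sgn -` A \<inter> ball 0 1)"
    by (subst emeasure_distr) auto
  also have "\<dots> / emeasure lborel (ball (0::'a) 1) = emeasure uniform_sphere A"
    by (subst emeasure_uniform_sphere) (auto simp: distr_lborel_orthogonal[OF T])
  finally show "emeasure (distr uniform_sphere borel T) A = emeasure uniform_sphere A" .
qed simp

lemma measure_uniform_sphere_orthogonal:
  fixes T :: "'a::euclidean_space \<Rightarrow> 'a"
  assumes T: "orthogonal_transformation T" and A: "A \<in> sets borel"
  shows "measure uniform_sphere (T -` A) = measure uniform_sphere A"
  using measure_distr[OF _ A, of T uniform_sphere] orthogonal_transformation_borel_measurable[OF T]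
  by (simp add: distr_uniform_sphere_orthogonal[OF T])

text \<open>Both the upper and the lower bound for small sets on the sphere compare the cone over
  the set with such a box: one side of fixed length along the axis and \<open>CARD('d) - 1\<close>
  short sides, which is the origin of that exponent.\<close>

lemma measure_lborel_box_one_side:
  fixes i :: "'d::finite" and l u \<theta> :: real
  assumes "l \<le> u" "0 \<le> \<theta>"
  shows "measure lborel (cbox (\<chi> k. if k = i then l else - \<theta>) (\<chi> k. if k = i then u else \<theta>))
    = (u - l) * (2 * \<theta>) ^ (CARD('d) - 1)"
proof -
  have "cbox (\<chi> k. if k = i then l else - \<theta>) (\<chi> k. if k = i then u else \<theta>) \<noteq> {}"
    using assms by (auto simp: interval_ne_empty_cart)
  then have "measure lborel (cbox (\<chi> k. if k = i then l else - \<theta>) (\<chi> k. if k = i then u else \<theta>))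
     = (\<Prod>k\<in>UNIV. (\<chi> k. if k = i then u else \<theta>) $ k - (\<chi> k. if k = i then l else - \<theta>) $ k)"
    by (rule content_cbox_cart)
  also have "\<dots> = (\<Prod>k\<in>UNIV. if k = i then u - l else 2 * \<theta>)"
    by (rule prod.cong) auto
  also have "\<dots> = (u - l) * (\<Prod>k\<in>UNIV - {i}. 2 * \<theta>)"
    by (subst prod.remove[of _ i]) auto
  finally show ?thesis by (simp add: card_Diff_singleton)
qed

lemma uniform_sphere_rotate_to_axis:
  fixes a :: "real ^ 'd::finite" and i :: 'd
  assumes "norm a = 1"
  obtains T :: "real ^ 'd \<Rightarrow> real ^ 'd" where "orthogonal_transformation T" "T (axis i 1) = a"
proof (rule orthogonal_transformation_exists_1[OF norm_axis_1[of i] assms])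
  fix f :: "real ^ 'd \<Rightarrow> real ^ 'd"
  assume "orthogonal_transformation f" "f (axis i 1) = a"
  then show thesis by (rule that)
qed

lemma orthogonal_transformation_inner:
  "orthogonal_transformation T \<Longrightarrow> T x \<bullet> T y = x \<bullet> y"
  by (simp add: orthogonal_transformation_def)

lemma norm_vec_nth_split:
  fixes y :: "real ^ 'd::finite"
  shows "(norm y)\<^sup>2 = (y $ i)\<^sup>2 + (\<Sum>k\<in>UNIV - {i}. (y $ k)\<^sup>2)"
proof -
  have "(norm y)\<^sup>2 = (\<Sum>k\<in>UNIV. (y $ k)\<^sup>2)"
    by (simp add: norm_vec_def L2_set_def sum_nonneg)
  then show ?thesis by (simp add: sum.remove[of UNIV i])
qed

text \<open>The cone over a ball about the axis vector, cut off at radius 1, fits into a box of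
  length 2 along the axis and width \<open>2 * r\<close> across it. A rotation takes the axis vector
  to any centre \<open>x\<close>.\<close>

lemma uniform_sphere_cball_upper:
  "\<exists>C>0. \<forall>x r. norm x = 1 \<longrightarrow> 0 \<le> r \<longrightarrow>
     measure uniform_sphere (cball (x :: real ^ 'd::finite) r) \<le> C * r ^ (CARD('d) - 1)"
proof -
  define \<omega> where "\<omega> = measure lborel (ball (0::real^'d) 1)"
  have \<omega>: "\<omega> > 0" unfolding \<omega>_def by (rule content_ball_pos) simp
  define i :: 'd where "i = undefined"
  let ?e = "axis i 1 :: real ^ 'd"
  let ?n = "CARD('d) - 1"
  have e: "measure uniform_sphere (cball ?e r) \<le> 2 * 2 ^ ?n / \<omega> * r ^ ?n" if r: "0 \<le> r" for r
  proof -
    let ?box = "cbox (\<chi> k. if k = i then - 1 else - r) (\<chi> k. if k = i then 1 else r) :: (real^'d) set"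
    have "sgn -` cball ?e r \<inter> ball 0 1 \<subseteq> ?box"
    proof
      fix y assume y: "y \<in> sgn -` cball ?e r \<inter> ball 0 1"
      then have y1: "norm y < 1" and yr: "norm (sgn y - ?e) \<le> r"
        by (auto simp: dist_norm norm_minus_commute)
      have "\<bar>y $ i\<bar> \<le> 1" using component_le_norm_cart[of y i] y1 by linarith
      moreover have "\<bar>y $ k\<bar> \<le> r" if k: "k \<noteq> i" for k
      proof -
        have "(sgn y - ?e) $ k = y $ k / norm y"
          using k by (simp add: axis_def sgn_div_norm divide_inverse)
        then have "y $ k = norm y * ((sgn y - ?e) $ k)"
          by (cases "y = 0") auto
        then have "\<bar>y $ k\<bar> = norm y * \<bar>(sgn y - ?e) $ k\<bar>" by (simp add: abs_mult)
        also have "\<dots> \<le> 1 * r"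
          using y1 yr component_le_norm_cart[of "sgn y - ?e" k] by (intro mult_mono) auto
        finally show ?thesis by simp
      qed
      ultimately have "(- 1 \<le> y $ i \<and> y $ i \<le> 1) \<and> (\<forall>k. k \<noteq> i \<longrightarrow> - r \<le> y $ k \<and> y $ k \<le> r)"
        by (simp add: abs_le_iff minus_le_iff)
      then show "y \<in> ?box" by (auto simp: mem_box_cart)
    qed
    then have "measure lborel (sgn -` cball ?e r \<inter> ball 0 1) \<le> measure lborel ?box"
      using measurable_sets[OF borel_measurable_sgn_euclidean, of "cball ?e r"]
      by (intro measure_mono_fmeasurable) (auto simp: fmeasurable_cbox)
    also have "\<dots> = 2 * 2 ^ ?n * r ^ ?n"
      using r by (subst measure_lborel_box_one_side) (auto simp: power_mult_distrib)
    finally show ?thesis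
      using \<omega> by (subst measure_uniform_sphere) (auto simp: \<omega>_def[symmetric] field_simps)
  qed
  show ?thesis
  proof (intro exI[of _ "2 * 2 ^ ?n / \<omega>"] conjI allI impI)
    fix x :: "real ^ 'd" and r :: real assume x: "norm x = 1" and r: "0 \<le> r"
    from uniform_sphere_rotate_to_axis[OF x] obtain T where T: "orthogonal_transformation T" "T ?e = x" .
    have "T -` cball x r = cball ?e r"
    proof (intro set_eqI)
      fix y
      have "dist x (T y) = dist ?e y"
        using orthogonal_transformation_norm[OF T(1), of "?e - y"] T(2)
        by (simp add: dist_norm linear_diff[OF orthogonal_transformation_linear[OF T(1)]])
      then show "y \<in> T -` cball x r \<longleftrightarrow> y \<in> cball ?e r" by auto
    qed
    then show "measure uniform_sphere (cball x r) \<le> 2 * 2 ^ ?n / \<omega> * r ^ ?n"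
      using e[OF r] measure_uniform_sphere_orthogonal[OF T(1), of "cball x r"] by simp
  qed (use \<omega> in auto)
qed

text \<open>The cone over the cap contains a box whose axis coordinate runs over
  \<open>[1/4, 1/2]\<close>, away from the apex of the cone and from the boundary of the ball, and
  whose transverse width is proportional to \<open>D\<close>.\<close>

lemma cap_axis_lower:
  fixes i :: "'d::finite" and D :: real
  assumes D: "0 \<le> D" "D \<le> 2"
  shows "(1/4) * (2 * (D / (8 * CARD('d)))) ^ (CARD('d) - 1) / measure lborel (ball (0::real^'d) 1)
     \<le> measure uniform_sphere {x :: real ^ 'd. axis i 1 \<bullet> x \<ge> 1 - D\<^sup>2 / 8}"
proof -
  define d where "d = real CARD('d)"
  have d: "d \<ge> 1" unfolding d_def by (simp add: Suc_leI)
  \<comment> \<open>Chosen so that the transverse part of a point of the box has squared norm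
    \<open>q \<le> D\<^sup>2 / 64\<close>.\<close>
  define \<theta> where "\<theta> = D / (8 * d)"
  have \<theta>: "0 \<le> \<theta>" using D d by (auto simp: \<theta>_def)
  let ?box = "cbox (\<chi> k. if k = i then 1/4 else - \<theta>) (\<chi> k. if k = i then 1/2 else \<theta>) :: (real^'d) set"
  let ?C = "{x :: real ^ 'd. axis i 1 \<bullet> x \<ge> 1 - D\<^sup>2 / 8}"
  have [measurable]: "?C \<in> sets borel" by measurable
  have d\<theta>: "d * \<theta>\<^sup>2 \<le> D\<^sup>2 / 64"
  proof -
    have "d * \<theta>\<^sup>2 = D\<^sup>2 / (64 * d)" using d by (simp add: \<theta>_def power2_eq_square)
    also have "\<dots> \<le> D\<^sup>2 / 64" using d by (intro divide_left_mono) auto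
    finally show ?thesis .
  qed
  have D2: "D\<^sup>2 \<le> 4" using D power_mono[of D 2 2] by simp
  have "?box \<subseteq> sgn -` ?C \<inter> ball 0 1"
  proof
    fix y assume "y \<in> ?box"
    then have yi: "1/4 \<le> y $ i" "y $ i \<le> 1/2" and yk: "\<And>k. k \<noteq> i \<Longrightarrow> \<bar>y $ k\<bar> \<le> \<theta>"
      unfolding mem_box_cart vec_lambda_beta abs_le_iff
      by (metis (full_types) neg_le_iff_le minus_minus)+
    define q where "q = (\<Sum>k\<in>UNIV - {i}. (y $ k)\<^sup>2)"
    have q0: "q \<ge> 0" unfolding q_def by (intro sum_nonneg) auto
    have "q \<le> (\<Sum>k\<in>UNIV - {i}. \<theta>\<^sup>2)"
      unfolding q_def using yk \<theta> by (intro sum_mono) (auto simp: abs_le_square_iff[symmetric])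
    also have "\<dots> \<le> d * \<theta>\<^sup>2" by (auto simp: d_def card_Diff_singleton intro!: mult_right_mono)
    finally have q: "q \<le> D\<^sup>2 / 64" using d\<theta> by simp
    have ny: "(norm y)\<^sup>2 = (y $ i)\<^sup>2 + q" unfolding q_def by (rule norm_vec_nth_split)
    have yi2: "(y $ i)\<^sup>2 \<le> 1/4" using yi power_mono[of "y $ i" "1/2" 2] by (simp add: power2_eq_square)
    have "(norm y)\<^sup>2 < 1\<^sup>2" using ny q D2 yi2 by simp
    then have n1: "norm y < 1" by (rule power_less_imp_less_base) simp
    have nylow: "norm y \<ge> 1/4" using component_le_norm_cart[of y i] yi by linarith
    \<comment> \<open>A linear bound for the square root: \<open>y $ i \<ge> 1/4\<close> gives
      \<open>4 * (y $ i * q) \<ge> q\<close>. The excess \<open>2 * q \<le> D\<^sup>2 / 32\<close>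
      is then paid for by \<open>D\<^sup>2 / 8 * norm y\<close> with
      \<open>norm y \<ge> 1/4\<close>.\<close>
    have "(norm y)\<^sup>2 \<le> (y $ i + 2 * q)\<^sup>2"
    proof -
      have "(1/4) * q \<le> y $ i * q" using yi q0 by (intro mult_right_mono) auto
      moreover have "(y $ i + 2 * q)\<^sup>2 = (y $ i)\<^sup>2 + 4 * (y $ i * q) + 4 * q\<^sup>2"
        by (simp add: power2_eq_square algebra_simps)
      moreover have "q\<^sup>2 \<ge> 0" by simp
      ultimately show ?thesis unfolding ny by linarith
    qed
    then have nyup: "norm y \<le> y $ i + 2 * q" by (rule power2_le_imp_le) (use yi q0 in auto)
    have "(1 - D\<^sup>2/8) * norm y = norm y - D\<^sup>2 / 8 * norm y" by (simp add: algebra_simps)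
    also have "\<dots> \<le> y $ i + 2 * q - D\<^sup>2 / 8 * (1/4)"
      using nyup nylow by (intro diff_mono mult_left_mono) auto
    also have "\<dots> \<le> y $ i" using q by simp
    finally have "(1 - D\<^sup>2 / 8) * norm y \<le> y $ i" .
    then have "1 - D\<^sup>2 / 8 \<le> y $ i / norm y" 
    proof -
      have "norm y > 0" using nylow by linarith
      then show ?thesis using \<open>(1 - D\<^sup>2 / 8) * norm y \<le> y $ i\<close> by (simp add: pos_le_divide_eq)
    qed
    moreover have "axis i 1 \<bullet> sgn y = y $ i / norm y"
      by (simp add: sgn_div_norm inner_axis' divide_inverse mult.commute)
    ultimately show "y \<in> sgn -` ?C \<inter> ball 0 1" using n1 by simp
  qed
  moreover have "sgn -` ?C \<inter> ball 0 1 \<in> sets lborel"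
    using measurable_sets[OF borel_measurable_sgn_euclidean \<open>?C \<in> sets borel\<close>]
    by (simp add: sets.Int)
  then have "sgn -` ?C \<inter> ball 0 1 \<in> fmeasurable lborel"
    using fmeasurableI2[OF fmeasurableI[OF _ emeasure_unit_ball(2)], of "sgn -` ?C \<inter> ball 0 1"]
    by (metis Int_lower2 borel_open open_ball sets_lborel)
  ultimately have "measure lborel ?box \<le> measure lborel (sgn -` ?C \<inter> ball 0 1)"
    by (metis (no_types, lifting) measure_mono_fmeasurable sets_lborel borel_closed closed_cbox)
  moreover have "measure lborel ?box = 1/4 * (2 * \<theta>) ^ (CARD('d) - 1)"
    using \<theta> by (subst measure_lborel_box_one_side) auto
  ultimately have "1/4 * (2 * \<theta>) ^ (CARD('d) - 1) \<le> measure lborel (sgn -` ?C \<inter> ball 0 1)"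
    by simp
  from divide_right_mono[OF this, of "measure lborel (ball (0::real^'d) 1)"] show ?thesis
    unfolding measure_uniform_sphere[OF \<open>?C \<in> sets borel\<close>] \<theta>_def d_def by simp
qed

text \<open>Turns the mass of a cap into a bound on distances inside it. For a unit normal
  \<open>a\<close>, both points have squared distance at most \<open>2 * (1 - b)\<close> from
  \<open>a\<close>, so their mutual distance \<open>D\<close> satisfies
  \<open>D\<^sup>2 \<le> 8 * (1 - b)\<close>. Hence the cap contains the one about \<open>a\<close>
  of height \<open>D\<^sup>2 / 8\<close>, whose mass is of order
  \<open>D ^ (CARD('d) - 1)\<close>.\<close>

lemma uniform_sphere_cap_lower:
  assumes "CARD('d::finite) \<ge> 2"
  shows "\<exists>c>0. \<forall>(a :: real ^ 'd) b y z. a \<noteq> 0 \<longrightarrow> norm y = 1 \<longrightarrow> norm z = 1 \<longrightarrow> b \<le> a \<bullet> y \<longrightarrow> b \<le> a \<bullet> z \<longrightarrow>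
     c * dist y z ^ (CARD('d) - 1) \<le> measure uniform_sphere {x. b \<le> a \<bullet> x}"
proof -
  let ?n = "CARD('d) - 1"
  define \<omega> where "\<omega> = measure lborel (ball (0::real^'d) 1)"
  have \<omega>: "\<omega> > 0" unfolding \<omega>_def by (rule content_ball_pos) simp
  define i :: 'd where "i = undefined"
  let ?e = "axis i 1 :: real ^ 'd"
  interpret prob_space "uniform_sphere :: (real^'d) measure" by (rule prob_space_uniform_sphere)
  define c where "c = (1/4) * (1 / (4 * real CARD('d))) ^ ?n / \<omega>"
  have "c > 0" using \<omega> by (auto simp: c_def)
  moreover have unit: "c * dist y z ^ ?n \<le> prob {x. b \<le> a \<bullet> x}"
    if a: "norm a = 1" and y: "norm y = 1" and z: "norm z = 1" and yb: "b \<le> a \<bullet> y" and bz: "b \<le> a \<bullet> z"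
    for a y z :: "real ^ 'd" and b
  proof -
    have dist2: "(dist v a)\<^sup>2 \<le> 2 * (1 - b)" if "norm v = 1" "b \<le> a \<bullet> v" for v
    proof -
      have "(dist v a)\<^sup>2 = (norm v)\<^sup>2 + (norm a)\<^sup>2 - 2 * (a \<bullet> v)"
        by (simp add: dist_norm power2_norm_eq_inner inner_diff_left inner_diff_right inner_commute)
      then show ?thesis using that a by simp
    qed
    define D where "D = dist y z"
    have "D \<le> dist y a + dist z a" unfolding D_def using dist_triangle2 by blast
    then have "D\<^sup>2 \<le> (dist y a + dist z a)\<^sup>2" by (intro power_mono) (auto simp: D_def)
    also have "\<dots> \<le> 2 * (dist y a)\<^sup>2 + 2 * (dist z a)\<^sup>2"
      using sum_squares_bound[of "dist y a" "dist z a"] by (simp add: power2_sum)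
    also have "\<dots> \<le> 8 * (1 - b)" using dist2[OF y yb] dist2[OF z bz] by simp
    finally have bD: "b \<le> 1 - D\<^sup>2 / 8" by simp
    have D: "0 \<le> D" "D \<le> 2" using y z norm_triangle_ineq4[of y z] by (auto simp: D_def dist_norm)
    obtain T where T: "orthogonal_transformation T" "T ?e = a"
      using uniform_sphere_rotate_to_axis[OF a] .
    have "T -` {x. 1 - D\<^sup>2 / 8 \<le> a \<bullet> x} = {x. 1 - D\<^sup>2 / 8 \<le> ?e \<bullet> x}"
      using orthogonal_transformation_inner[OF T(1), of ?e] T(2) by auto
    then have eq: "prob {x. 1 - D\<^sup>2 / 8 \<le> a \<bullet> x} = prob {x. 1 - D\<^sup>2 / 8 \<le> ?e \<bullet> x}"
      using measure_uniform_sphere_orthogonal[OF T(1), of "{x. 1 - D\<^sup>2 / 8 \<le> a \<bullet> x}"] by simp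
    have "c * D ^ ?n = (1/4) * (2 * (D / (8 * CARD('d)))) ^ ?n / \<omega>"
      by (simp add: c_def power_divide)
    also have "\<dots> \<le> prob {x. 1 - D\<^sup>2 / 8 \<le> a \<bullet> x}"
      unfolding eq \<omega>_def by (rule cap_axis_lower[OF D])
    also have "\<dots> \<le> prob {x. b \<le> a \<bullet> x}"
      using bD by (intro finite_measure_mono) auto
    finally show ?thesis unfolding D_def .
  qed
  moreover have "c * dist y z ^ ?n \<le> prob {x. b \<le> a \<bullet> x}"
    if a: "a \<noteq> 0" and y: "norm y = 1" and z: "norm z = 1" and yb: "b \<le> a \<bullet> y" and bz: "b \<le> a \<bullet> z"
    for a y z :: "real ^ 'd" and b
  proof -
    have *: "b / norm a \<le> sgn a \<bullet> x \<longleftrightarrow> b \<le> a \<bullet> x" for x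
      using a by (simp add: sgn_div_norm divide_inverse_commute)
    show ?thesis
      using unit[of "sgn a" y z "b / norm a"] a y z yb bz unfolding * by (simp add: norm_sgn)
  qed
  ultimately show ?thesis by blast
qed

section \<open>Lebesgue measure split along a coordinate axis\<close>

definition emb_perp :: "'a::euclidean_space \<Rightarrow> ('a \<Rightarrow> real) \<Rightarrow> 'a" where
  "emb_perp e v = (\<Sum>b\<in>Basis - {e}. v b *\<^sub>R b)"

text \<open>The orthogonal complement of \<open>e\<close> is not a type of its own; coordinate
  functions on \<open>Basis - {e}\<close> stand for it, and their product measure serves as its
  Lebesgue measure.\<close>

abbreviation perp_lborel :: "'a::euclidean_space \<Rightarrow> ('a \<Rightarrow> real) measure" where
  "perp_lborel e \<equiv> PiM (Basis - {e}) (\<lambda>_. lborel)"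

lemma measurable_emb_perp [measurable]: "emb_perp e \<in> perp_lborel e \<rightarrow>\<^sub>M borel"
  unfolding emb_perp_def [abs_def] by measurable

lemma inner_emb_perp: "e \<in> Basis \<Longrightarrow> emb_perp e v \<bullet> e = 0"
  unfolding emb_perp_def inner_sum_left by (intro sum.neutral) (auto simp: inner_Basis)

interpretation perp: product_sigma_finite "\<lambda>_. lborel :: real measure"
  by standard

lemma sigma_finite_perp: "sigma_finite_measure (perp_lborel (e::'a::euclidean_space))"
  by (rule perp.sigma_finite) simp

lemma nn_integral_lborel_split:
  fixes F :: "'a::euclidean_space \<Rightarrow> ennreal"
  assumes e: "e \<in> Basis" and [measurable]: "F \<in> borel_measurable borel"
  shows "(\<integral>\<^sup>+y. F y \<partial>lborel) = (\<integral>\<^sup>+v. (\<integral>\<^sup>+t. F (t *\<^sub>R e + emb_perp e v) \<partial>lborel) \<partial>perp_lborel e)"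
proof -
  let ?s = "\<lambda>f. \<Sum>b\<in>Basis. f b *\<^sub>R b :: 'a"
  have ins: "insert e (Basis - {e}) = Basis" using e by auto
  have "(\<integral>\<^sup>+y. F y \<partial>lborel) = (\<integral>\<^sup>+f. F (?s f) \<partial>(\<Pi>\<^sub>M b\<in>Basis. lborel))"
    by (subst lborel_eq, subst nn_integral_distr) auto
  also have "\<dots> = (\<integral>\<^sup>+v. (\<integral>\<^sup>+t. F (?s (v(e := t))) \<partial>lborel) \<partial>perp_lborel e)"
    using perp.product_nn_integral_insert[of "Basis - {e}" e "\<lambda>f. F (?s f)"] unfolding ins by simp
  also have "\<dots> = (\<integral>\<^sup>+v. (\<integral>\<^sup>+t. F (t *\<^sub>R e + emb_perp e v) \<partial>lborel) \<partial>perp_lborel e)"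
    using e unfolding emb_perp_def
    by (subst sum.remove[of Basis e]) (auto intro!: nn_integral_cong arg_cong[of _ _ F] sum.cong)
  finally show ?thesis .
qed

text \<open>Discards the axis itself, on which the substitutions in the axis coordinate degenerate.
  In dimension at least 2 some coordinate remains, and it vanishes only on a null set.\<close>

lemma AE_emb_perp_nonzero:
  fixes e :: "'a::euclidean_space"
  assumes e: "e \<in> Basis" and dim: "DIM('a) \<ge> 2"
  shows "AE v in perp_lborel e. emb_perp e v \<noteq> 0"
proof -
  let ?N = "\<Pi>\<^sub>E b\<in>Basis - {e}. {0::real}"
  have "card (Basis - {e}) \<noteq> 0" using e dim by (simp add: card_Diff_singleton)
  then have ne: "Basis - {e} \<noteq> {}" by force
  then have card_pos: "card (Basis - {e}) > 0" by (simp add: card_gt_0_iff)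
  have "emeasure (perp_lborel e) ?N = (\<Prod>b\<in>Basis - {e}. emeasure lborel {0::real})"
    by (rule perp.emeasure_PiM) auto
  also have "\<dots> = 0" using card_pos by simp
  finally have "emeasure (perp_lborel e) ?N = 0" .
  moreover have "?N \<in> sets (perp_lborel e)" by (rule sets_PiM_I_finite) auto
  ultimately have "?N \<in> null_sets (perp_lborel e)" by (simp only: null_sets_def mem_Collect_eq)
  moreover have "{v \<in> space (perp_lborel e). emb_perp e v = 0} \<subseteq> ?N"
  proof
    fix v assume "v \<in> {v \<in> space (perp_lborel e). emb_perp e v = 0}"
    then have v: "v \<in> space (perp_lborel e)" "emb_perp e v = 0" by auto
    have "v b = 0" if "b \<in> Basis - {e}" for b
    proof -
      have "emb_perp e v \<bullet> b = (\<Sum>b'\<in>Basis - {e}. if b' = b then v b else 0)"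
        unfolding emb_perp_def inner_sum_left using that
        by (intro sum.cong) (auto simp: inner_Basis)
      then show ?thesis using that v(2) by simp
    qed
    then show "v \<in> ?N" using v(1) unfolding space_PiM PiE_iff by auto
  qed
  ultimately show ?thesis by (intro AE_I'[where N="?N"]) auto
qed

lemma nn_integral_PiM_lborel_scale:
  fixes F :: "('i \<Rightarrow> real) \<Rightarrow> ennreal"
  assumes "finite I" and c: "c > 0" and "F \<in> borel_measurable (PiM I (\<lambda>_. lborel))"
  shows "(\<integral>\<^sup>+v. F v \<partial>PiM I (\<lambda>_. lborel))
       = ennreal (c ^ card I) * (\<integral>\<^sup>+v. F (\<lambda>k\<in>I. c * v k) \<partial>PiM I (\<lambda>_. lborel))"
  using assms(1,3)
proof (induction I arbitrary: F rule: finite_induct)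
  case empty
  then show ?case by (simp add: perp.nn_integral_empty restrict_def space_PiM PiE_empty_domain)
next
  case (insert i I)
  note [measurable] = insert.prems
  interpret I: sigma_finite_measure "PiM I (\<lambda>_. lborel :: real measure)"
    by (rule perp.sigma_finite) fact
  define G where "G v = (\<integral>\<^sup>+t. F (v(i := c * t)) \<partial>lborel)" for v
  have [measurable]: "G \<in> borel_measurable (PiM I (\<lambda>_. lborel))"
    unfolding G_def by measurable
  have "(\<integral>\<^sup>+v. F v \<partial>PiM (insert i I) (\<lambda>_. lborel))
      = (\<integral>\<^sup>+v. (\<integral>\<^sup>+t. F (v(i := t)) \<partial>lborel) \<partial>PiM I (\<lambda>_. lborel))"
    by (rule perp.product_nn_integral_insert) (use insert in auto)
  also have "\<dots> = (\<integral>\<^sup>+v. ennreal c * G v \<partial>PiM I (\<lambda>_. lborel))"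
  proof (rule nn_integral_cong)
    fix v assume [measurable]: "v \<in> space (PiM I (\<lambda>_. lborel :: real measure))"
    show "(\<integral>\<^sup>+t. F (v(i := t)) \<partial>lborel) = ennreal c * G v"
      unfolding G_def using c insert.hyps
      by (subst nn_integral_real_affine[where c=c and t=0]) (auto intro!: measurable_compose[OF measurable_fun_upd[where J=I] insert.prems])
  qed
  also have "\<dots> = ennreal c * (ennreal (c ^ card I) * (\<integral>\<^sup>+v. G (\<lambda>k\<in>I. c * v k) \<partial>PiM I (\<lambda>_. lborel)))"
    by (simp add: nn_integral_cmult insert.IH[symmetric])
  also have "\<dots> = ennreal (c ^ card (insert i I)) * (\<integral>\<^sup>+v. G (\<lambda>k\<in>I. c * v k) \<partial>PiM I (\<lambda>_. lborel))"
    using c insert.hyps by (simp add: ennreal_mult mult.assoc)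
  also have "(\<integral>\<^sup>+v. G (\<lambda>k\<in>I. c * v k) \<partial>PiM I (\<lambda>_. lborel))
     = (\<integral>\<^sup>+v. (\<integral>\<^sup>+t. F (\<lambda>k\<in>insert i I. c * (v(i := t)) k) \<partial>lborel) \<partial>PiM I (\<lambda>_. lborel))"
    unfolding G_def using insert.hyps
    by (intro nn_integral_cong arg_cong[of _ _ F]) (auto simp: fun_eq_iff)
  also have "\<dots> = (\<integral>\<^sup>+v. F (\<lambda>k\<in>insert i I. c * v k) \<partial>PiM (insert i I) (\<lambda>_. lborel))"
    by (rule perp.product_nn_integral_insert[symmetric]) (use insert in auto)
  finally show ?case .
qed

lemma nn_integral_perp_scale:
  fixes F :: "'a::euclidean_space \<Rightarrow> ennreal"
  assumes e: "e \<in> Basis" and c: "c > 0" and [measurable]: "F \<in> borel_measurable borel"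
  shows "(\<integral>\<^sup>+v. F (emb_perp e v) \<partial>perp_lborel e)
       = ennreal (c ^ (DIM('a) - 1)) * (\<integral>\<^sup>+v. F (c *\<^sub>R emb_perp e v) \<partial>perp_lborel e)"
proof -
  have "emb_perp e (\<lambda>k\<in>Basis - {e}. c * v k) = c *\<^sub>R emb_perp e v" for v
    unfolding emb_perp_def scaleR_sum_right by (intro sum.cong) auto
  then show ?thesis
    using nn_integral_PiM_lborel_scale[of "Basis - {e}" c "\<lambda>v. F (emb_perp e v)"] e c
    by (simp add: card_Diff_singleton)
qed

text \<open>Fubini over the lines parallel to \<open>e\<close>. On a line at squared distance
  \<open>s > 0\<close> from the origin, \<open>e \<bullet> sgn y = t / sqrt (t\<^sup>2 + s)\<close>
  takes the value \<open>b\<close> for at most one \<open>t\<close>.\<close>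

lemma uniform_sphere_hyperplane_null_axis:
  fixes e :: "'a::euclidean_space"
  assumes e: "e \<in> Basis" and dim: "DIM('a) \<ge> 2"
  shows "emeasure uniform_sphere {x. e \<bullet> x = b} = 0"
proof -
  let ?A = "{x::'a. e \<bullet> x = b}"
  have A [measurable]: "?A \<in> sets borel" by measurable
  have nrm: "(norm (t *\<^sub>R e + emb_perp e v))\<^sup>2 = t\<^sup>2 + (norm (emb_perp e v))\<^sup>2" for t v
    unfolding power2_norm_eq_inner using inner_emb_perp[OF e, of v] e
    by (simp add: inner_add inner_commute power2_eq_square)
  have sm: "sgn -` ?A \<in> sets borel"
    using measurable_sets[OF borel_measurable_sgn_euclidean A] by simp
  note [measurable] = sm
  have "emeasure lborel (sgn -` ?A \<inter> ball 0 1) \<le> emeasure lborel (sgn -` ?A - {0}) + emeasure lborel {0::'a}"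
  proof -
    have "emeasure lborel (sgn -` ?A \<inter> ball 0 1) \<le> emeasure lborel ((sgn -` ?A - {0}) \<union> {0::'a})"
      by (intro emeasure_mono) auto
    also have "\<dots> \<le> emeasure lborel (sgn -` ?A - {0}) + emeasure lborel {0::'a}"
      by (intro emeasure_subadditive) (use sm in auto)
    finally show ?thesis .
  qed
  also have "\<dots> = (\<integral>\<^sup>+y. indicator (sgn -` ?A - {0}) y \<partial>lborel)"
    using sm by simp
  also have "\<dots> = (\<integral>\<^sup>+v. (\<integral>\<^sup>+t. indicator (sgn -` ?A - {0}) (t *\<^sub>R e + emb_perp e v) \<partial>lborel) \<partial>perp_lborel e)"
    by (rule nn_integral_lborel_split[OF e]) measurable
  also have "\<dots> = (\<integral>\<^sup>+v. 0 \<partial>perp_lborel e)"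
  proof (rule nn_integral_cong_AE)
    show "AE v in perp_lborel e. (\<integral>\<^sup>+t. indicator (sgn -` ?A - {0}) (t *\<^sub>R e + emb_perp e v) \<partial>lborel) = 0"
      using AE_emb_perp_nonzero[OF e dim]
    proof eventually_elim
      fix v assume v: "emb_perp e v \<noteq> 0"
      define s where "s = (norm (emb_perp e v))\<^sup>2"
      have s: "s > 0" using v by (simp add: s_def)
      let ?T = "{t. t *\<^sub>R e + emb_perp e v \<in> sgn -` ?A - {0}}"
      have key: "t = b * sqrt (t\<^sup>2 + s)" if "t \<in> ?T" for t
      proof -
        define y where "y = t *\<^sub>R e + emb_perp e v"
        have n: "norm y = sqrt (t\<^sup>2 + s)" using nrm[of t v] unfolding s_def y_def by (metis norm_ge_zero real_sqrt_unique)
        have iy: "e \<bullet> y = t" using e inner_emb_perp[OF e, of v] by (simp add: y_def inner_add inner_commute)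
        have b: "e \<bullet> sgn y = b" using that by (auto simp: y_def)
        have "e \<bullet> sgn y = (e \<bullet> y) / norm y"
          by (simp only: sgn_div_norm inner_scaleR_right divide_inverse mult.commute)
        then have "b = t / sqrt (t\<^sup>2 + s)" unfolding n iy b .
        moreover have "sqrt (t\<^sup>2 + s) > 0" using s by (simp add: add_nonneg_pos)
        ultimately show ?thesis by simp
      qed
      have uniq: "t = t'" if t: "t \<in> ?T" and t': "t' \<in> ?T" for t t'
      proof -
        \<comment> \<open>Squaring \<open>key\<close> determines \<open>t\<^sup>2\<close>; the sign
          lost in squaring returns when the common value of the root is put back into
          \<open>key\<close>.\<close>
        have sq: "t\<^sup>2 * (1 - b\<^sup>2) = b\<^sup>2 * s" if "t \<in> ?T" for t
        proof -
          have "t\<^sup>2 = b\<^sup>2 * (t\<^sup>2 + s)"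
            using arg_cong[OF key[OF that], of "\<lambda>x. x\<^sup>2"] s by (simp add: power_mult_distrib add_nonneg_nonneg)
          then show ?thesis by (simp add: algebra_simps)
        qed
        show ?thesis
        proof (cases "b = 0")
          case True
          then show ?thesis using key[OF t] key[OF t'] by simp
        next
          case False
          then have "t\<^sup>2 * (1 - b\<^sup>2) > 0" using sq[OF t] s by simp
          then have b1: "1 - b\<^sup>2 > 0" by (simp add: zero_less_mult_iff)
          then have "t\<^sup>2 = t'\<^sup>2" using sq[OF t] sq[OF t'] by (metis less_irrefl mult_right_cancel)
          then have "sqrt (t\<^sup>2 + s) = sqrt (t'\<^sup>2 + s)" by simp
          then show ?thesis using key[OF t] key[OF t'] by metis
        qed
      qed
      have "countable ?T"
      proof (cases "?T = {}")
        case False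
        then obtain t where "t \<in> ?T" by blast
        then have "?T \<subseteq> {t}" using uniq by blast
        then show ?thesis by (meson countable_finite finite.emptyI finite.insertI finite_subset)
      next
        case True
        then show ?thesis by (simp only: countable_empty)
      qed
      then have "emeasure lborel ?T = 0" by (rule emeasure_lborel_countable)
      moreover have "?T \<in> sets lborel" using \<open>countable ?T\<close> by (simp add: sets.countable)
      moreover have "(\<integral>\<^sup>+t. indicator (sgn -` ?A - {0}) (t *\<^sub>R e + emb_perp e v) \<partial>lborel) = (\<integral>\<^sup>+t. indicator ?T t \<partial>lborel)"
        by (intro nn_integral_cong) (auto simp: indicator_def)
      ultimately show "(\<integral>\<^sup>+t. indicator (sgn -` ?A - {0}) (t *\<^sub>R e + emb_perp e v) \<partial>lborel) = 0"
        by simp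
    qed
  qed
  finally have "emeasure lborel (sgn -` ?A \<inter> ball 0 1) = 0" by simp
  then show ?thesis by (simp add: emeasure_uniform_sphere[OF A])
qed

lemma uniform_sphere_hyperplane_null:
  fixes a :: "real ^ 'd::finite"
  assumes "CARD('d) \<ge> 2" "a \<noteq> 0"
  shows "emeasure uniform_sphere {x. a \<bullet> x = b} = 0"
proof -
  define i :: 'd where "i = undefined"
  have a1: "norm (sgn a) = 1" using assms by (simp add: norm_sgn)
  obtain T :: "real ^ 'd \<Rightarrow> real ^ 'd" where T: "orthogonal_transformation T" "T (axis i 1) = sgn a"
    using uniform_sphere_rotate_to_axis[OF a1, of i] .
  note [measurable] = orthogonal_transformation_borel_measurable[OF T(1)]
  let ?A = "{x. a \<bullet> x = b}"
  have "T -` ?A = {x. axis i 1 \<bullet> x = b / norm a}"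
  proof (intro set_eqI)
    fix x
    have "axis i 1 \<bullet> x = sgn a \<bullet> T x"
      using orthogonal_transformation_inner[OF T(1), of "axis i 1" x] T(2) by simp
    then show "x \<in> T -` ?A \<longleftrightarrow> x \<in> {x. axis i 1 \<bullet> x = b / norm a}"
      using assms(2) by (auto simp: sgn_div_norm field_simps)
  qed
  then have "emeasure (distr uniform_sphere borel T) ?A = emeasure uniform_sphere {x :: real ^ 'd. axis i 1 \<bullet> x = b / norm a}"
    by (subst emeasure_distr) auto
  also have "\<dots> = 0"
    by (rule uniform_sphere_hyperplane_null_axis) (use assms in \<open>auto simp: axis_in_Basis_iff\<close>)
  finally show ?thesis by (simp add: distr_uniform_sphere_orthogonal[OF T(1)])
qed

section \<open>Stereographic projection\<close>

text \<open>The substitution \<open>t = (s\<^sup>2 / b - b) / 2\<close> inverts \<open>b = sqrt (t\<^sup>2 + s\<^sup>2) - t\<close>.\<close>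

lemma nn_integral_cone_substitution:
  fixes F :: "real \<Rightarrow> ennreal"
  assumes s: "s > 0" and [measurable]: "F \<in> borel_measurable borel"
  shows "(\<integral>\<^sup>+t. F t \<partial>lborel)
    = (\<integral>\<^sup>+b. F ((s\<^sup>2 / b - b) / 2) * ennreal ((s\<^sup>2 / b\<^sup>2 + 1) / 2) * indicator {0<..} b \<partial>lborel)"
proof -
  define g where "g b = (s\<^sup>2 / b - b) / 2" for b :: real
  define w where "w b = ennreal ((s\<^sup>2 / b\<^sup>2 + 1) / 2) * indicator {0<..} b" for b :: real
  define \<beta> where "\<beta> t = sqrt (t\<^sup>2 + s\<^sup>2) - t" for t :: real
  have [measurable]: "g \<in> borel_measurable borel" "w \<in> borel_measurable borel"
    unfolding g_def [abs_def] w_def [abs_def] by measurable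
  have \<beta>pos: "\<beta> t > 0" for t
  proof -
    have "\<bar>t\<bar> < sqrt (t\<^sup>2 + s\<^sup>2)" using s by (intro real_less_rsqrt) auto
    then show ?thesis unfolding \<beta>_def by linarith
  qed
  have g\<beta>: "g (\<beta> t) = t" for t
  proof -
    have "(\<beta> t)\<^sup>2 + 2 * t * \<beta> t = s\<^sup>2"
      unfolding \<beta>_def by (simp add: power2_eq_square algebra_simps)
    then have "s\<^sup>2 / \<beta> t = \<beta> t + 2 * t"
      using \<beta>pos[of t] by (simp add: field_simps power2_eq_square)
    then show ?thesis by (simp add: g_def)
  qed
  have gmono: "g b < g a" if "0 < a" "a < b" for a b
  proof -
    have "s\<^sup>2 / b < s\<^sup>2 / a" using that s by (intro divide_strict_left_mono) auto
    then show ?thesis using that unfolding g_def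
      by (intro divide_strict_right_mono diff_strict_mono) auto
  qed
  have g_lt: "g b < t \<longleftrightarrow> \<beta> t < b" and g_gt: "t < g b \<longleftrightarrow> b < \<beta> t" if "b > 0" for b t
    using gmono[OF that, of "\<beta> t"] gmono[OF \<beta>pos, of t b] g\<beta>[of t] by (cases "\<beta> t" b rule: linorder_cases; simp)+
  \<comment> \<open>The change of variables as an equality of measures, tested on intervals:
    \<open>g\<close> is decreasing with inverse \<open>\<beta>\<close>, so the preimage of an
    interval is again an interval, and \<open>w\<close> is the negative derivative of
    \<open>g\<close> on the positive half-line.\<close>
  have "lborel = distr (density lborel w) borel g"
  proof (rule lborel_eqI)
    fix l u :: real assume "\<And>b. b \<in> Basis \<Longrightarrow> l \<bullet> b \<le> u \<bullet> b"
    then have lu: "l \<le> u" by simp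
    have \<beta>le: "\<beta> u \<le> \<beta> l"
    proof (rule ccontr)
      assume "\<not> \<beta> u \<le> \<beta> l"
      then have "g (\<beta> u) < g (\<beta> l)" using \<beta>pos by (intro gmono) auto
      then show False using lu by (simp add: g\<beta>)
    qed
    have "emeasure (distr (density lborel w) borel g) (box l u) = (\<integral>\<^sup>+b. w b * indicator (g -` {l<..<u}) b \<partial>lborel)"
      using measurable_sets[of g borel borel "{l<..<u}"] by (simp add: emeasure_distr emeasure_density box_real)
    also have "\<dots> = (\<integral>\<^sup>+b. ennreal ((s\<^sup>2 / b\<^sup>2 + 1) / 2) * indicator {\<beta> u..\<beta> l} b \<partial>lborel)"
    proof (rule nn_integral_cong_AE)
      show "AE b in lborel. w b * indicator (g -` {l<..<u}) b = ennreal ((s\<^sup>2 / b\<^sup>2 + 1) / 2) * indicator {\<beta> u..\<beta> l} b"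
        using AE_lborel_singleton[of "\<beta> u"] AE_lborel_singleton[of "\<beta> l"]
      proof eventually_elim
        fix b assume "b \<noteq> \<beta> u" "b \<noteq> \<beta> l"
        then show "w b * indicator (g -` {l<..<u}) b = ennreal ((s\<^sup>2 / b\<^sup>2 + 1) / 2) * indicator {\<beta> u..\<beta> l} b"
          using g_lt[of b u] g_gt[of b l] \<beta>pos[of u]
          by (cases "b > 0") (auto simp: w_def indicator_def)
      qed
    qed
    also have "\<dots> = ennreal (- g (\<beta> l) - - g (\<beta> u))"
    proof (rule nn_integral_FTC_Icc[where F="\<lambda>x. - g x"])
      fix x assume "x \<in> {\<beta> u..\<beta> l}"
      then have x: "x > 0" using \<beta>pos[of u] by auto
      show "((\<lambda>x. - g x) has_real_derivative (s\<^sup>2 / x\<^sup>2 + 1) / 2) (at x)"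
        unfolding g_def using x
        by (auto intro!: derivative_eq_intros simp: power2_eq_square field_simps)
    qed (use \<beta>le in auto)
    finally show "emeasure (distr (density lborel w) borel g) (box l u) = (\<Prod>b\<in>Basis. (u - l) \<bullet> b)"
      by (simp add: g\<beta>)
  qed simp
  then have "(\<integral>\<^sup>+t. F t \<partial>lborel) = (\<integral>\<^sup>+t. F t \<partial>distr (density lborel w) borel g)" by simp
  also have "\<dots> = (\<integral>\<^sup>+b. w b * F (g b) \<partial>lborel)"
    by (simp add: nn_integral_distr nn_integral_density)
  finally show ?thesis unfolding w_def g_def by (simp add: mult_ac)
qed

lemma nn_integral_power_Ioo:
  fixes q :: real
  assumes q: "q > 0"
  shows "(\<integral>\<^sup>+b. ennreal (b ^ n) * indicator {0<..<1/q} b \<partial>lborel) = ennreal (1 / (real (n + 1) * q ^ (n + 1)))"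
proof -
  have "(\<integral>\<^sup>+b. ennreal (b ^ n) * indicator {0<..<1/q} b \<partial>lborel) = (\<integral>\<^sup>+b. ennreal (b ^ n) * indicator {0..1/q} b \<partial>lborel)"
  proof (rule nn_integral_cong_AE)
    show "AE b in lborel. ennreal (b ^ n) * indicator {0<..<1/q} b = ennreal (b ^ n) * indicator {0..1/q} b"
      using AE_lborel_singleton[of 0] AE_lborel_singleton[of "1/q"]
      by eventually_elim (auto simp: indicator_def)
  qed
  also have "\<dots> = ennreal ((1/q) ^ (n + 1) / real (n + 1) - 0 ^ (n + 1) / real (n + 1))"
  proof (rule nn_integral_FTC_Icc[where F="\<lambda>x. x ^ (n + 1) / real (n + 1)"])
    fix x :: real
    show "((\<lambda>x. x ^ (n + 1) / real (n + 1)) has_real_derivative x ^ n) (at x)"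
      by (rule derivative_eq_intros refl | simp)+
  qed (use q in auto)
  finally show ?thesis by (simp add: power_divide mult.commute)
qed

text \<open>Inverse stereographic projection from the pole \<open>e\<close>, for \<open>w\<close> orthogonal to \<open>e\<close>.\<close>

definition inv_stereo :: "'a::euclidean_space \<Rightarrow> 'a \<Rightarrow> 'a" where
  "inv_stereo e w = (2 / ((norm w)\<^sup>2 + 1)) *\<^sub>R w + (((norm w)\<^sup>2 - 1) / ((norm w)\<^sup>2 + 1)) *\<^sub>R e"

lemma measurable_inv_stereo [measurable]: "inv_stereo e \<in> borel_measurable borel"
  unfolding inv_stereo_def [abs_def] by measurable

lemma norm_axis_add_perp:
  fixes e w :: "'a::euclidean_space"
  assumes "norm e = 1" "w \<bullet> e = 0"
  shows "(norm (t *\<^sub>R e + w))\<^sup>2 = t\<^sup>2 + (norm w)\<^sup>2"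
  using assms unfolding power2_norm_eq_inner norm_eq_1
  by (simp add: inner_add inner_commute power2_eq_square)

text \<open>With \<open>b = norm y - y \<bullet> e\<close> and \<open>w = y' / b\<close>, where \<open>y'\<close> is the part of \<open>y\<close> orthogonal to \<open>e\<close>,
  the point \<open>sgn y\<close> depends only on \<open>w\<close>.\<close>

lemma cone_coordinates:
  fixes e w :: "'a::euclidean_space"
  assumes e: "norm e = 1" and w: "w \<bullet> e = 0" and b: "b > 0"
  defines "y \<equiv> (((norm (b *\<^sub>R w))\<^sup>2 / b - b) / 2) *\<^sub>R e + b *\<^sub>R w"
  shows "norm y = b * (((norm w)\<^sup>2 + 1) / 2)" "sgn y = inv_stereo e w"
proof -
  define q where "q = ((norm w)\<^sup>2 + 1) / 2"
  have q: "q > 0" by (simp add: q_def add_nonneg_pos)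
  have y: "y = b *\<^sub>R ((((norm w)\<^sup>2 - 1) / 2) *\<^sub>R e + w)"
    using b by (simp add: y_def power2_eq_square scaleR_add_right right_diff_distrib diff_divide_distrib mult_ac)
  have "(norm ((((norm w)\<^sup>2 - 1) / 2) *\<^sub>R e + w))\<^sup>2 = q\<^sup>2"
    unfolding norm_axis_add_perp[OF e w] q_def by (simp add: power2_eq_square field_simps)
  then have "norm ((((norm w)\<^sup>2 - 1) / 2) *\<^sub>R e + w) = q"
    using q by (simp add: power2_eq_iff_nonneg)
  then show n: "norm y = b * (((norm w)\<^sup>2 + 1) / 2)"
    using b by (simp add: y q_def)
  have "sgn y = inverse (b * q) *\<^sub>R y" by (simp add: sgn_div_norm n q_def)
  also have "\<dots> = (1 / q) *\<^sub>R ((((norm w)\<^sup>2 - 1) / 2) *\<^sub>R e + w)"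
    using b q by (simp add: y field_simps)
  also have "\<dots> = inv_stereo e w"
  proof -
    have "1 / q = 2 / ((norm w)\<^sup>2 + 1)" "(1 / q) * (((norm w)\<^sup>2 - 1) / 2) = ((norm w)\<^sup>2 - 1) / ((norm w)\<^sup>2 + 1)"
    proof -
      have *: "(1 / (p / 2)) * (x / 2) = x / p" for p x :: real by simp
      show "1 / q = 2 / ((norm w)\<^sup>2 + 1)" by (simp add: q_def)
      show "(1 / q) * (((norm w)\<^sup>2 - 1) / 2) = ((norm w)\<^sup>2 - 1) / ((norm w)\<^sup>2 + 1)"
        unfolding q_def by (rule *)
    qed
    then show ?thesis
      unfolding inv_stereo_def scaleR_add_right scaleR_scaleR by (simp only: add.commute)
  qed
  finally show "sgn y = inv_stereo e w" .
qed

text \<open>The ball is parametrised by \<open>b\<close> and \<open>w\<close> as in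
  \<open>cone_coordinates\<close>. The sphere point depends on \<open>w\<close> alone, so
  \<open>b\<close> can be integrated out over \<open>0 < b < 1 / q\<close>, where
  \<open>q = ((norm w)\<^sup>2 + 1) / 2\<close>. The weights are \<open>q\<close> from the
  substitution along the axis and \<open>b ^ n\<close>, with \<open>n = DIM('a) - 1\<close>, from
  scaling the transverse variable; they integrate to \<open>1 / (DIM('a) * q ^ n)\<close>.\<close>

lemma nn_integral_uniform_sphere_stereo:
  fixes f :: "'a::euclidean_space \<Rightarrow> ennreal"
  assumes e: "e \<in> Basis" and dim: "DIM('a) \<ge> 2" and [measurable]: "f \<in> borel_measurable borel"
  shows "(\<integral>\<^sup>+x. f x \<partial>uniform_sphere) =
    (\<integral>\<^sup>+v. f (inv_stereo e (emb_perp e v)) *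
       ennreal (1 / (DIM('a) * (((norm (emb_perp e v))\<^sup>2 + 1) / 2) ^ (DIM('a) - 1))) \<partial>perp_lborel e)
    / emeasure lborel (ball (0::'a) 1)"
proof -
  let ?n = "DIM('a) - 1"
  have e1: "norm e = 1" using e by simp
  interpret P: sigma_finite_measure "perp_lborel e" by (rule sigma_finite_perp)
  interpret PP: pair_sigma_finite "perp_lborel e" "lborel :: real measure" by standard
  define h where "h y = f (sgn y) * indicator (ball 0 1) y" for y :: 'a
  have [measurable]: "ball (0::'a) 1 \<in> sets borel" by simp
  have [measurable]: "h \<in> borel_measurable borel" unfolding h_def [abs_def] by measurable
  define J where "J w b = h ((((norm w)\<^sup>2 / b - b) / 2) *\<^sub>R e + w)
     * ennreal (((norm w)\<^sup>2 / b\<^sup>2 + 1) / 2) * indicator {0<..} b" for w :: 'a and b :: real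
  have J [measurable]: "(\<lambda>(w, b). J w b) \<in> borel_measurable (borel \<Otimes>\<^sub>M borel)"
    unfolding J_def [abs_def] by measurable
  define q where "q w = ((norm w)\<^sup>2 + 1) / 2" for w :: 'a
  have [measurable]: "q \<in> borel_measurable borel" unfolding q_def [abs_def] by measurable
  have q: "q w > 0" for w by (simp add: q_def add_nonneg_pos)
  have Jb: "ennreal (b ^ ?n) * J (b *\<^sub>R w) b = f (inv_stereo e w) * ennreal (q w) * (ennreal (b ^ ?n) * indicator {0<..<1 / q w} b)"
    if w: "w \<bullet> e = 0" for w b
  proof (cases "b > 0")
    case True
    have "h ((((norm (b *\<^sub>R w))\<^sup>2 / b - b) / 2) *\<^sub>R e + b *\<^sub>R w) = f (inv_stereo e w) * indicator {0<..<1 / q w} b"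
      unfolding h_def cone_coordinates(2)[OF e1 w True] using True q[of w] cone_coordinates(1)[OF e1 w True]
      by (auto simp: indicator_def q_def field_simps)
    moreover have "((norm (b *\<^sub>R w))\<^sup>2 / b\<^sup>2 + 1) / 2 = q w"
      using True by (simp add: q_def power_mult_distrib)
    ultimately show ?thesis using True unfolding J_def by (simp add: mult_ac)
  qed (auto simp: J_def)
  have "(\<integral>\<^sup>+y. h y \<partial>lborel) = (\<integral>\<^sup>+v. (\<integral>\<^sup>+t. h (t *\<^sub>R e + emb_perp e v) \<partial>lborel) \<partial>perp_lborel e)"
    by (rule nn_integral_lborel_split[OF e]) measurable
  also have "\<dots> = (\<integral>\<^sup>+v. (\<integral>\<^sup>+b. J (emb_perp e v) b \<partial>lborel) \<partial>perp_lborel e)"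
  proof (rule nn_integral_cong_AE)
    show "AE v in perp_lborel e. (\<integral>\<^sup>+t. h (t *\<^sub>R e + emb_perp e v) \<partial>lborel) = (\<integral>\<^sup>+b. J (emb_perp e v) b \<partial>lborel)"
      using AE_emb_perp_nonzero[OF e dim]
      by eventually_elim (auto simp: J_def intro!: nn_integral_cone_substitution)
  qed
  \<comment> \<open>The order is exchanged so that the transverse variable can be rescaled by the
    fixed number \<open>b\<close>; after changing back, \<open>b\<close> is innermost and the test
    function is constant in it.\<close>
  also have "\<dots> = (\<integral>\<^sup>+b. (\<integral>\<^sup>+v. J (emb_perp e v) b \<partial>perp_lborel e) \<partial>lborel)"
    by (rule PP.Fubini'[symmetric]) measurable
  also have "\<dots> = (\<integral>\<^sup>+b. (\<integral>\<^sup>+v. ennreal (b ^ ?n) * J (b *\<^sub>R emb_perp e v) b \<partial>perp_lborel e) \<partial>lborel)"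
  proof (rule nn_integral_cong)
    fix b :: real
    show "(\<integral>\<^sup>+v. J (emb_perp e v) b \<partial>perp_lborel e) = (\<integral>\<^sup>+v. ennreal (b ^ ?n) * J (b *\<^sub>R emb_perp e v) b \<partial>perp_lborel e)"
    proof (cases "b > 0")
      case True
      have "(\<integral>\<^sup>+v. J (emb_perp e v) b \<partial>perp_lborel e) = ennreal (b ^ ?n) * (\<integral>\<^sup>+v. J (b *\<^sub>R emb_perp e v) b \<partial>perp_lborel e)"
        by (rule nn_integral_perp_scale[OF e True]) measurable
      then show ?thesis by (subst nn_integral_cmult) auto
    qed (auto simp: J_def)
  qed
  also have "\<dots> = (\<integral>\<^sup>+v. (\<integral>\<^sup>+b. ennreal (b ^ ?n) * J (b *\<^sub>R emb_perp e v) b \<partial>lborel) \<partial>perp_lborel e)"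
    by (rule PP.Fubini') measurable
  also have "\<dots> = (\<integral>\<^sup>+v. f (inv_stereo e (emb_perp e v)) * ennreal (1 / (DIM('a) * q (emb_perp e v) ^ ?n)) \<partial>perp_lborel e)"
  proof (rule nn_integral_cong)
    fix v
    let ?w = "emb_perp e v"
    have "(\<integral>\<^sup>+b. ennreal (b ^ ?n) * J (b *\<^sub>R ?w) b \<partial>lborel)
       = (\<integral>\<^sup>+b. f (inv_stereo e ?w) * ennreal (q ?w) * (ennreal (b ^ ?n) * indicator {0<..<1 / q ?w} b) \<partial>lborel)"
      by (rule nn_integral_cong) (rule Jb[OF inner_emb_perp[OF e]])
    also have "\<dots> = f (inv_stereo e ?w) * (ennreal (q ?w) * ennreal (1 / (real (?n + 1) * q ?w ^ (?n + 1))))"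
    proof -
      have "(\<integral>\<^sup>+b. f (inv_stereo e ?w) * ennreal (q ?w) * (ennreal (b ^ ?n) * indicator {0<..<1 / q ?w} b) \<partial>lborel)
        = f (inv_stereo e ?w) * ennreal (q ?w) * (\<integral>\<^sup>+b. ennreal (b ^ ?n) * indicator {0<..<1 / q ?w} b \<partial>lborel)"
        by (rule nn_integral_cmult) measurable
      then show ?thesis by (simp only: nn_integral_power_Ioo[OF q] mult.assoc)
    qed
    also have "ennreal (q ?w) * ennreal (1 / (real (?n + 1) * q ?w ^ (?n + 1))) = ennreal (1 / (DIM('a) * q ?w ^ ?n))"
    proof -
      have "?n + 1 = DIM('a)" using dim by simp
      moreover have "x * (1 / (N * x ^ (k + 1))) = 1 / (N * x ^ k)" if "x > 0" for x N :: real and k :: nat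
        using that by simp
      note this[OF q[of ?w], of "real (?n + 1)" ?n]
      ultimately show ?thesis
        using q[of ?w] by (subst ennreal_mult'[symmetric]) (simp_all only: less_imp_le)
    qed
    finally show "(\<integral>\<^sup>+b. ennreal (b ^ ?n) * J (b *\<^sub>R ?w) b \<partial>lborel)
       = f (inv_stereo e ?w) * ennreal (1 / (DIM('a) * q ?w ^ ?n))" .
  qed
  finally show ?thesis
    by (subst nn_integral_uniform_sphere) (simp_all add: h_def q_def)
qed

text \<open>Projection from the pole \<open>e\<close>. At the pole, division by zero yields the
  value 0 instead of infinity; the lemmas relating it to hyperplanes and distances therefore assume
  \<open>x \<bullet> e \<noteq> 1\<close>.\<close>

definition stereo :: "'a::euclidean_space \<Rightarrow> 'a \<Rightarrow> 'a" where
  "stereo e x = (1 / (1 - x \<bullet> e)) *\<^sub>R (x - (x \<bullet> e) *\<^sub>R e)"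

lemma measurable_stereo [measurable]: "stereo e \<in> borel_measurable borel"
  unfolding stereo_def [abs_def] by measurable

lemma stereo_inv_stereo:
  assumes e: "norm e = 1" and w: "w \<bullet> e = 0"
  shows "stereo e (inv_stereo e w) = w"
proof -
  have ee: "e \<bullet> e = 1" using e by (simp add: norm_eq_1)
  have p: "(norm w)\<^sup>2 + 1 > 0" by (simp add: add_nonneg_pos)
  have "inv_stereo e w \<bullet> e = ((norm w)\<^sup>2 - 1) / ((norm w)\<^sup>2 + 1)"
    by (simp add: inv_stereo_def inner_add w ee)
  moreover from this have "inv_stereo e w - (inv_stereo e w \<bullet> e) *\<^sub>R e = (2 / ((norm w)\<^sup>2 + 1)) *\<^sub>R w"
    by (simp add: inv_stereo_def)
  moreover from calculation(1) have "1 - inv_stereo e w \<bullet> e = 2 / ((norm w)\<^sup>2 + 1)"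
    using p by (simp add: field_simps)
  ultimately have "stereo e (inv_stereo e w) = (1 / (2 / ((norm w)\<^sup>2 + 1))) *\<^sub>R ((2 / ((norm w)\<^sup>2 + 1)) *\<^sub>R w)"
    unfolding stereo_def by (simp only:)
  moreover have "(1 / (2 / p)) *\<^sub>R ((2 / p) *\<^sub>R w) = w" if "p > 0" for p
    using that by simp
  ultimately show ?thesis using p by metis
qed

text \<open>In the stereographic chart the law has density proportional to \<open>(1 + (norm w)\<^sup>2) powr (- n)\<close>
  for \<open>n = DIM('a) - 1\<close>; rescaled by \<open>R\<close> and multiplied by \<open>R ^ n\<close> this density increases with \<open>R\<close>.\<close>

lemma stereo_scaling_mono:
  fixes f :: "'a::euclidean_space \<Rightarrow> ennreal"
  assumes e: "e \<in> Basis" and dim: "DIM('a) \<ge> 2" and f [measurable]: "f \<in> borel_measurable borel"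
    and R: "0 < R" "R \<le> R'"
  shows "ennreal (R ^ (DIM('a) - 1)) * (\<integral>\<^sup>+x. f (stereo e x /\<^sub>R R) \<partial>uniform_sphere)
     \<le> ennreal (R' ^ (DIM('a) - 1)) * (\<integral>\<^sup>+x. f (stereo e x /\<^sub>R R') \<partial>uniform_sphere)"
proof -
  let ?n = "DIM('a) - 1"
  have e1: "norm e = 1" using e by simp
  define \<omega> where "\<omega> = emeasure lborel (ball (0::'a) 1)"
  \<comment> \<open>Up to normalisation, the chart density rescaled by \<open>R\<close> and
    multiplied by \<open>R ^ ?n\<close>. Substituting \<open>R *\<^sub>R w\<close> brings a second
    factor \<open>R ^ ?n\<close>, and the two cancel the power of \<open>R\<^sup>2\<close> drawn out
    of the denominator; only the term \<open>1 / R\<^sup>2\<close> still depends on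
    \<open>R\<close>.\<close>
  define p where "p R w = 1 / (DIM('a) * (((norm w)\<^sup>2 + 1 / R\<^sup>2) / 2) ^ ?n)" for R and w :: 'a
  have [measurable]: "p R \<in> borel_measurable borel" for R unfolding p_def [abs_def] by measurable
  have eq: "ennreal (R ^ ?n) * (\<integral>\<^sup>+x. f (stereo e x /\<^sub>R R) \<partial>uniform_sphere)
     = (\<integral>\<^sup>+v. f (emb_perp e v) * ennreal (p R (emb_perp e v)) \<partial>perp_lborel e) / \<omega>"
    if R: "R > 0" for R
  proof -
    define G where "G w = f (w /\<^sub>R R) * ennreal (1 / (DIM('a) * (((norm w)\<^sup>2 + 1) / 2) ^ ?n))" for w :: 'a
    have [measurable]: "G \<in> borel_measurable borel" unfolding G_def [abs_def] by measurable
    have G: "ennreal (R ^ ?n) * (ennreal (R ^ ?n) * G (R *\<^sub>R w)) = f w * ennreal (p R w)" for w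
    proof -
      have "((norm (R *\<^sub>R w))\<^sup>2 + 1) / 2 = R\<^sup>2 * (((norm w)\<^sup>2 + 1 / R\<^sup>2) / 2)"
        using R by (simp add: field_simps power2_eq_square)
      moreover have "R ^ ?n * (R ^ ?n * (1 / (DIM('a) * (R\<^sup>2 * B) ^ ?n))) = 1 / (DIM('a) * B ^ ?n)" for B :: real
        using R by (simp add: power_mult_distrib power2_eq_square)
      ultimately have "R ^ ?n * (R ^ ?n * (1 / (DIM('a) * (((norm (R *\<^sub>R w))\<^sup>2 + 1) / 2) ^ ?n))) = p R w"
        by (simp only: p_def)
      then have "ennreal (R ^ ?n) * (ennreal (R ^ ?n) * ennreal (1 / (DIM('a) * (((norm (R *\<^sub>R w))\<^sup>2 + 1) / 2) ^ ?n))) = ennreal (p R w)"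
        using R by (simp only: ennreal_mult'[symmetric] zero_le_power less_imp_le)
      moreover have "(R *\<^sub>R w) /\<^sub>R R = w" using R by simp
      ultimately show ?thesis unfolding G_def by (simp only: mult_ac)
    qed
    have "(\<integral>\<^sup>+x. f (stereo e x /\<^sub>R R) \<partial>uniform_sphere) = (\<integral>\<^sup>+v. G (emb_perp e v) \<partial>perp_lborel e) / \<omega>"
      by (subst nn_integral_uniform_sphere_stereo[OF e dim])
         (simp_all add: G_def \<omega>_def stereo_inv_stereo[OF e1 inner_emb_perp[OF e]])
    also have "(\<integral>\<^sup>+v. G (emb_perp e v) \<partial>perp_lborel e) = ennreal (R ^ ?n) * (\<integral>\<^sup>+v. G (R *\<^sub>R emb_perp e v) \<partial>perp_lborel e)"
      by (rule nn_integral_perp_scale[OF e R]) measurable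
    finally have "ennreal (R ^ ?n) * (\<integral>\<^sup>+x. f (stereo e x /\<^sub>R R) \<partial>uniform_sphere)
       = (ennreal (R ^ ?n) * (ennreal (R ^ ?n) * (\<integral>\<^sup>+v. G (R *\<^sub>R emb_perp e v) \<partial>perp_lborel e))) / \<omega>"
      by (simp add: ennreal_times_divide)
    also have "ennreal (R ^ ?n) * (ennreal (R ^ ?n) * (\<integral>\<^sup>+v. G (R *\<^sub>R emb_perp e v) \<partial>perp_lborel e))
       = (\<integral>\<^sup>+v. ennreal (R ^ ?n) * (ennreal (R ^ ?n) * G (R *\<^sub>R emb_perp e v)) \<partial>perp_lborel e)"
      by (simp add: nn_integral_cmult)
    finally show ?thesis unfolding G .
  qed
  have "p R w \<le> p R' w" for w
  proof -
    have "1 / R'\<^sup>2 \<le> 1 / R\<^sup>2" using R by (intro divide_left_mono power_mono) auto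
    then have "((norm w)\<^sup>2 + 1 / R'\<^sup>2) / 2 \<le> ((norm w)\<^sup>2 + 1 / R\<^sup>2) / 2" by simp
    moreover have "((norm w)\<^sup>2 + 1 / R'\<^sup>2) / 2 > 0" using R by (simp add: add_nonneg_pos)
    ultimately show ?thesis unfolding p_def
      by (intro divide_left_mono mult_left_mono power_mono mult_pos_pos zero_less_power) auto
  qed
  then show ?thesis
    unfolding eq[OF R(1)] eq[OF less_le_trans[OF R]]
    by (intro divide_right_mono_ennreal nn_integral_mono mult_left_mono ennreal_leI) auto
qed

section \<open>General position\<close>

text \<open>Cofactor expansion as an inner product: with the other rows fixed, a degenerate row
  \<open>y\<close> is one on a hyperplane.\<close>

lemma det_row_expand:
  fixes c :: "'d \<Rightarrow> real ^ 'd::finite"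
  shows "det (\<chi> k. if k = i then y else c k) = (\<chi> j. det (\<chi> k. if k = i then axis j 1 else c k)) \<bullet> y"
proof -
  have "det (\<chi> k. if k = i then y else c k) = det (\<chi> k. if k = i then (\<Sum>j\<in>UNIV. (y $ j) *s axis j 1) else c k)"
    by (simp only: basis_expansion)
  also have "\<dots> = (\<Sum>j\<in>UNIV. det (\<chi> k. if k = i then (y $ j) *s axis j 1 else c k))"
    by (rule det_linear_row_sum) simp
  also have "\<dots> = (\<Sum>j\<in>UNIV. (y $ j) * det (\<chi> k. if k = i then axis j 1 else c k))"
    by (simp only: det_row_mul)
  also have "\<dots> = (\<chi> j. det (\<chi> k. if k = i then axis j 1 else c k)) \<bullet> y"
    by (simp add: inner_vec_def mult.commute)
  finally show ?thesis .
qed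

text \<open>A normal vector of the hyperplane through the points \<open>p k\<close>; it is zero iff these are affinely
  dependent.\<close>

definition nrm :: "'d \<Rightarrow> ('d \<Rightarrow> real ^ 'd::finite) \<Rightarrow> real ^ 'd" where
  "nrm i p = (\<chi> j. det (\<chi> k. if k = i then axis j 1 else p k - p i))"

lemma nrm_inner: "nrm i p \<bullet> y = det (\<chi> k. if k = i then y else p k - p i)"
  unfolding nrm_def by (rule det_row_expand[symmetric])

lemma nrm_orthogonal: "nrm i p \<bullet> (p k - p i) = 0"
proof (cases "k = i")
  case False
  let ?A = "(\<chi> l. if l = i then p k - p i else p l - p i)"
  have "row k ?A = row i ?A" using False by (simp add: row_def vec_eq_iff)
  from det_identical_rows[OF False this] show ?thesis by (simp add: nrm_inner)
qed simp

text \<open>The matrix with row \<open>i\<close> equal to \<open>nrm i p\<close> and the differences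
  \<open>p k - p i\<close> as other rows has determinant \<open>nrm i p \<bullet> nrm i p\<close>,
  hence is invertible. The part of \<open>u\<close> orthogonal to \<open>nrm i p\<close> lies in its
  kernel.\<close>

lemma orthogonal_imp_multiple_nrm:
  assumes n: "nrm i p \<noteq> 0" and u: "\<And>k. u \<bullet> (p k - p i) = 0"
  shows "\<exists>c. u = c *\<^sub>R nrm i p"
proof -
  let ?M = "(\<chi> k. if k = i then nrm i p else p k - p i)"
  define c where "c = (u \<bullet> nrm i p) / (nrm i p \<bullet> nrm i p)"
  define v where "v = u - c *\<^sub>R nrm i p"
  have "det ?M = nrm i p \<bullet> nrm i p" by (simp only: nrm_inner)
  then have "det ?M \<noteq> 0" using n by simp
  then obtain B where B: "B ** ?M = mat 1"
    using invertible_det_nz[of ?M] unfolding invertible_def by blast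
  have "?M *v v = 0"
  proof (rule vec_eq_iff[THEN iffD2], rule allI)
    fix k
    have "(?M *v v) $ k = ?M $ k \<bullet> v"
      by (simp add: matrix_vector_mult_def inner_vec_def)
    also have "\<dots> = 0"
    proof (cases "k = i")
      case True
      then show ?thesis using n by (simp add: v_def c_def inner_diff_right inner_commute)
    next
      case False
      then show ?thesis using u[of k] nrm_orthogonal[of i p k]
        by (simp add: v_def inner_diff_right inner_commute)
    qed
    finally show "(?M *v v) $ k = 0 $ k" by simp
  qed
  then have "v = 0" using B matrix_left_invertible_ker[of ?M] by blast
  then show ?thesis by (auto simp: v_def)
qed

lemma hyperplane_imp_multiple_nrm:
  assumes n: "nrm i p \<noteq> 0" and u: "\<And>k. u \<bullet> p k = b"
  obtains c where "u = c *\<^sub>R nrm i p" "b = c * (nrm i p \<bullet> p i)"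
proof -
  have "u \<bullet> (p k - p i) = 0" for k using u by (simp add: inner_diff_right)
  from orthogonal_imp_multiple_nrm[OF n this] obtain c where c: "u = c *\<^sub>R nrm i p" by blast
  then have "b = c * (nrm i p \<bullet> p i)" using u[of i] by simp
  with c show thesis by (rule that)
qed

lemma borel_measurable_vec_lambda:
  fixes f :: "'a \<Rightarrow> 'd::finite \<Rightarrow> real"
  assumes "\<And>j. (\<lambda>x. f x j) \<in> borel_measurable M"
  shows "(\<lambda>x. \<chi> j. f x j) \<in> borel_measurable M"
proof -
  have "(\<lambda>x. \<Sum>j\<in>UNIV. f x j *\<^sub>R (axis j 1 :: real ^ 'd)) \<in> borel_measurable M"
    using assms by measurable
  also have "(\<lambda>x. \<Sum>j\<in>UNIV. f x j *\<^sub>R (axis j 1 :: real ^ 'd)) = (\<lambda>x. \<chi> j. f x j)"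
    by (simp add: fun_eq_iff vec_eq_iff axis_def if_distrib cong: if_cong)
  finally show ?thesis .
qed

lemma borel_measurable_det:
  fixes A :: "'a \<Rightarrow> 'd::finite \<Rightarrow> real ^ 'd"
  assumes [measurable]: "\<And>k. (\<lambda>x. A x k) \<in> borel_measurable M"
  shows "(\<lambda>x. det (\<chi> k. A x k)) \<in> borel_measurable M"
proof -
  have [measurable]: "(\<lambda>x. A x k $ j) \<in> borel_measurable M" for k j
  proof -
    have "(\<lambda>x. A x k $ j) = (\<lambda>x. A x k \<bullet> axis j 1)" by (simp add: inner_axis)
    then show ?thesis by simp
  qed
  show ?thesis unfolding det_def vec_lambda_beta by measurable
qed

lemma borel_measurable_nrm:
  assumes [measurable]: "\<And>k. (\<lambda>x. P x k) \<in> borel_measurable M"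
  shows "(\<lambda>x. nrm i (P x)) \<in> borel_measurable M"
  unfolding nrm_def
proof (intro borel_measurable_vec_lambda borel_measurable_det)
  show "(\<lambda>x. if k = i then axis j 1 else P x k - P x i) \<in> borel_measurable M" for j k
    by (cases "k = i") auto
qed

section \<open>Null sets of configurations of independent points\<close>

interpretation sph1: prob_space "uniform_sphere :: 'a::euclidean_space measure"
  by (rule prob_space_uniform_sphere)

interpretation sph: product_sigma_finite "\<lambda>_. uniform_sphere :: 'a::euclidean_space measure"
  by (intro product_sigma_finite.intro sph1.sigma_finite_measure_axioms)

text \<open>Fubini with the new coordinate innermost: the exceptional set for \<open>y\<close> may
  depend on the points already placed.\<close>

lemma AE_PiM_insertI:
  assumes "finite I" "i \<notin> I" and P [measurable]: "Measurable.pred (PiM (insert i I) (\<lambda>_. uniform_sphere :: 'a::euclidean_space measure)) P"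
    and ae: "AE x in PiM I (\<lambda>_. uniform_sphere). AE y in uniform_sphere. P (x(i := y))"
  shows "AE x in PiM (insert i I) (\<lambda>_. uniform_sphere :: 'a measure). P x"
proof -
  have "(\<integral>\<^sup>+x. indicator {x. \<not> P x} x \<partial>PiM (insert i I) (\<lambda>_. uniform_sphere :: 'a measure))
     = (\<integral>\<^sup>+x. (\<integral>\<^sup>+y. indicator {x. \<not> P x} (x(i := y)) \<partial>uniform_sphere) \<partial>PiM I (\<lambda>_. uniform_sphere))"
    by (rule sph.product_nn_integral_insert) (use assms in auto)
  also have "\<dots> = (\<integral>\<^sup>+x. 0 \<partial>PiM I (\<lambda>_. uniform_sphere :: 'a measure))"
  proof (rule nn_integral_cong_AE, use ae in eventually_elim)
    fix x assume "AE y in uniform_sphere. P (x(i := y))"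
    then have "(\<integral>\<^sup>+y. indicator {x. \<not> P x} (x(i := y)) \<partial>uniform_sphere) = (\<integral>\<^sup>+y. 0 \<partial>(uniform_sphere :: 'a measure))"
      by (intro nn_integral_cong_AE) (auto elim!: eventually_mono simp: indicator_def)
    then show "(\<integral>\<^sup>+y. indicator {x. \<not> P x} (x(i := y)) \<partial>uniform_sphere) = 0" by simp
  qed
  finally have "(\<integral>\<^sup>+x. indicator {x. \<not> P x} x \<partial>PiM (insert i I) (\<lambda>_. uniform_sphere :: 'a measure)) = 0" by simp
  then have "AE x in PiM (insert i I) (\<lambda>_. uniform_sphere :: 'a measure). indicator {x. \<not> P x} x = (0::ennreal)"
    by (subst (asm) nn_integral_0_iff_AE) auto
  then show ?thesis by eventually_elim (auto simp: indicator_def split: if_splits)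
qed

text \<open>Fubini in the other order, for statements in which one distinguished point can be frozen
  at an arbitrary \<open>y\<close> before the others are drawn.\<close>

lemma AE_PiM_insert_revI:
  assumes "finite I" "i \<notin> I" and P [measurable]: "Measurable.pred (PiM (insert i I) (\<lambda>_. uniform_sphere :: 'a::euclidean_space measure)) P"
    and ae: "\<And>y. AE x in PiM I (\<lambda>_. uniform_sphere). P (x(i := y))"
  shows "AE x in PiM (insert i I) (\<lambda>_. uniform_sphere :: 'a measure). P x"
proof -
  have "(\<integral>\<^sup>+x. indicator {x. \<not> P x} x \<partial>PiM (insert i I) (\<lambda>_. uniform_sphere :: 'a measure))
     = (\<integral>\<^sup>+y. (\<integral>\<^sup>+x. indicator {x. \<not> P x} (x(i := y)) \<partial>PiM I (\<lambda>_. uniform_sphere)) \<partial>uniform_sphere)"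
    by (rule sph.product_nn_integral_insert_rev) (use assms in auto)
  also have "\<dots> = (\<integral>\<^sup>+y. 0 \<partial>(uniform_sphere :: 'a measure))"
  proof (rule nn_integral_cong)
    fix y
    from ae[of y] have "(\<integral>\<^sup>+x. indicator {x. \<not> P x} (x(i := y)) \<partial>PiM I (\<lambda>_. uniform_sphere)) = (\<integral>\<^sup>+x. 0 \<partial>PiM I (\<lambda>_. uniform_sphere :: 'a measure))"
      by (intro nn_integral_cong_AE) (auto elim!: eventually_mono simp: indicator_def)
    then show "(\<integral>\<^sup>+x. indicator {x. \<not> P x} (x(i := y)) \<partial>PiM I (\<lambda>_. uniform_sphere)) = 0" by simp
  qed
  finally have "(\<integral>\<^sup>+x. indicator {x. \<not> P x} x \<partial>PiM (insert i I) (\<lambda>_. uniform_sphere :: 'a measure)) = 0" by simp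
  then have "AE x in PiM (insert i I) (\<lambda>_. uniform_sphere :: 'a measure). indicator {x. \<not> P x} x = (0::ennreal)"
    by (subst (asm) nn_integral_0_iff_AE) auto
  then show ?thesis by eventually_elim (auto simp: indicator_def split: if_splits)
qed

lemma AE_uniform_sphere_not_hyperplane:
  fixes a :: "real ^ 'd::finite"
  assumes "CARD('d) \<ge> 2" "a \<noteq> 0"
  shows "AE x in uniform_sphere. a \<bullet> x \<noteq> b"
  using uniform_sphere_hyperplane_null[OF assms, of b]
  by (intro AE_I[where N="{x. a \<bullet> x = b}"]) auto

text \<open>The rows in \<open>K\<close> are replaced one at a time; nonsingularity is lost only on a null set,
  a hyperplane for the new row.\<close>

lemma AE_det_nonzero:
  fixes r :: "'d \<Rightarrow> real ^ 'd::finite" and K :: "'d set"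
  assumes dim: "CARD('d) \<ge> 2" and r: "det (\<chi> k. r k) \<noteq> 0"
  shows "AE x in PiM K (\<lambda>_. uniform_sphere). det (\<chi> k. if k \<in> K then x k - c else r k) \<noteq> 0"
proof -
  have "finite K" by simp
  then show ?thesis
  proof (induction K rule: finite_induct)
    case empty
    then show ?case using r by simp
  next
    case (insert i K)
    show ?case
    proof (rule AE_PiM_insertI[OF insert.hyps])
      have "(\<lambda>x. if k \<in> insert i K then x k - c else r k) \<in> borel_measurable (PiM (insert i K) (\<lambda>_. uniform_sphere))" for k
      proof (cases "k \<in> insert i K")
        case True
        then have "(\<lambda>x. x k) \<in> borel_measurable (PiM (insert i K) (\<lambda>_. uniform_sphere))"
          using measurable_component_singleton[of k "insert i K" "\<lambda>_. uniform_sphere"] by simp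
        then show ?thesis using True by simp
      qed simp
      from borel_measurable_det[OF this] have [measurable]:
        "(\<lambda>x. det (\<chi> k. if k \<in> insert i K then x k - c else r k)) \<in> borel_measurable (PiM (insert i K) (\<lambda>_. uniform_sphere))" .
      show "Measurable.pred (PiM (insert i K) (\<lambda>_. uniform_sphere))
         (\<lambda>x. det (\<chi> k. if k \<in> insert i K then x k - c else r k) \<noteq> 0)" by measurable
      show "AE x in PiM K (\<lambda>_. uniform_sphere). AE y in uniform_sphere.
              det (\<chi> k. if k \<in> insert i K then (x(i := y)) k - c else r k) \<noteq> 0"
        using insert.IH
      proof eventually_elim
        fix x assume x: "det (\<chi> k. if k \<in> K then x k - c else r k) \<noteq> 0"
        define d where "d k = (if k \<in> K then x k - c else r k)" for k
        define w where "w = (\<chi> j. det (\<chi> k. if k = i then axis j 1 else d k))"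
        have w: "w \<bullet> z = det (\<chi> k. if k = i then z else d k)" for z
          unfolding w_def by (rule det_row_expand[symmetric])
        \<comment> \<open>The old determinant is \<open>w \<bullet> r i\<close>, so \<open>w\<close>
          is nonzero, and the new row fails only for \<open>y\<close> on the hyperplane
          \<open>w \<bullet> y = w \<bullet> c\<close>.\<close>
        have "(\<chi> k. d k) = (\<chi> k. if k = i then r i else d k)"
          by (rule Cart_lambda_cong) (use insert.hyps in \<open>simp add: d_def\<close>)
        then have "w \<bullet> r i = det (\<chi> k. d k)" by (simp only: w)
        then have "w \<noteq> 0" using x unfolding d_def by auto
        from AE_uniform_sphere_not_hyperplane[OF dim this, of "w \<bullet> c"]
        show "AE y in uniform_sphere. det (\<chi> k. if k \<in> insert i K then (x(i := y)) k - c else r k) \<noteq> 0"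
        proof eventually_elim
          fix y assume y: "w \<bullet> y \<noteq> w \<bullet> c"
          have "(\<chi> k. if k \<in> insert i K then (x(i := y)) k - c else r k) = (\<chi> k. if k = i then y - c else d k)"
            by (rule Cart_lambda_cong) (use insert.hyps in \<open>simp add: d_def\<close>)
          then show "det (\<chi> k. if k \<in> insert i K then (x(i := y)) k - c else r k) \<noteq> 0"
            using y by (simp add: w[symmetric] inner_diff_right)
        qed
      qed
    qed
  qed
qed

lemma det_axis_rows: "det (\<chi> k. (axis k 1 :: real ^ 'd::finite)) = 1"
proof -
  have "(\<chi> k. (axis k 1 :: real ^ 'd)) = mat 1"
    by (auto simp: vec_eq_iff mat_def axis_def)
  then show ?thesis by simp
qed

text \<open>With the base point frozen at \<open>y\<close>, component \<open>i\<close> of the normal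
  is the determinant obtained from the identity matrix by replacing every row but \<open>i\<close>
  by \<open>x k - y\<close>, which is the situation of \<open>AE_det_nonzero\<close>.\<close>

lemma AE_nrm_nonzero:
  fixes i :: "'d::finite"
  assumes dim: "CARD('d) \<ge> 2"
  shows "AE p in PiM UNIV (\<lambda>_::'d. uniform_sphere :: (real ^ 'd) measure). nrm i p \<noteq> 0"
proof -
  have ins: "insert i (UNIV - {i}) = UNIV" by auto
  have "AE p in PiM (insert i (UNIV - {i})) (\<lambda>_::'d. uniform_sphere :: (real ^ 'd) measure). nrm i p \<noteq> 0"
  proof (rule AE_PiM_insert_revI)
    have "(\<lambda>x. x k) \<in> borel_measurable (PiM (insert i (UNIV - {i})) (\<lambda>_::'d. uniform_sphere :: (real ^ 'd) measure))" for k
      by (cases "k = i") auto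
    from borel_measurable_nrm[OF this]
    show "Measurable.pred (PiM (insert i (UNIV - {i})) (\<lambda>_::'d. uniform_sphere)) (\<lambda>p. nrm i p \<noteq> 0)"
      by measurable
    fix y :: "real ^ 'd"
    have "AE x in PiM (UNIV - {i}) (\<lambda>_::'d. uniform_sphere). det (\<chi> k. if k \<in> UNIV - {i} then x k - y else axis k 1) \<noteq> 0"
      by (rule AE_det_nonzero[OF dim]) (simp add: det_axis_rows)
    then show "AE x in PiM (UNIV - {i}) (\<lambda>_::'d. uniform_sphere). nrm i (x(i := y)) \<noteq> 0"
    proof eventually_elim
      fix x :: "'d \<Rightarrow> real ^ 'd" assume x: "det (\<chi> k. if k \<in> UNIV - {i} then x k - y else axis k 1) \<noteq> 0"
      have "nrm i (x(i := y)) \<bullet> axis i 1 = det (\<chi> k. if k \<in> UNIV - {i} then x k - y else axis k 1)"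
        unfolding nrm_inner by (rule arg_cong[of _ _ det]) (auto simp: vec_eq_iff)
      then show "nrm i (x(i := y)) \<noteq> 0" using x by auto
    qed
  qed auto
  then show ?thesis unfolding ins .
qed

text \<open>Almost surely the points are linearly independent, and \<open>w\<close> solves the
  linear system with all right-hand sides 1. In this normalisation \<open>norm w\<close> is the
  reciprocal of the distance of the hyperplane from the origin.\<close>

lemma AE_hyperplane_not_through_origin:
  assumes dim: "CARD('d::finite) \<ge> 2"
  shows "AE p in PiM UNIV (\<lambda>_::'d. uniform_sphere :: (real ^ 'd) measure). \<exists>w. \<forall>k. w \<bullet> p k = 1"
proof -
  have "AE p in PiM UNIV (\<lambda>_::'d. uniform_sphere :: (real ^ 'd) measure). det (\<chi> k. if k \<in> UNIV then p k - 0 else axis k 1) \<noteq> 0"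
    by (rule AE_det_nonzero[OF dim]) (simp add: det_axis_rows)
  then show ?thesis
  proof eventually_elim
    fix p :: "'d \<Rightarrow> real ^ 'd" assume "det (\<chi> k. if k \<in> UNIV then p k - 0 else axis k 1) \<noteq> 0"
    then have "det (\<chi> k. p k) \<noteq> 0" by simp
    then obtain B where B: "(\<chi> k. p k) ** B = mat 1"
      using invertible_det_nz[of "\<chi> k. p k"] unfolding invertible_def by blast
    let ?w = "B *v (\<chi> k. 1)"
    have "(\<chi> k. p k) *v ?w = (\<chi> k. 1)"
      by (simp add: matrix_vector_mul_assoc B)
    then have "((\<chi> k. p k) *v ?w) $ k = 1" for k by simp
    then have "?w \<bullet> p k = 1" for k
      by (simp add: matrix_vector_mult_def inner_vec_def mult.commute)
    then show "\<exists>w. \<forall>k. w \<bullet> p k = 1" by blast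
  qed
qed

text \<open>Measurability of an existential statement over uncountably many parameters. A countable
  dense set of parameters suffices once the inequality is relaxed to \<open>< 1 / Suc n\<close> for
  all \<open>n\<close>, and compactness turns approximate solutions into an exact one.\<close>

lemma sets_ex_compact:
  fixes g :: "'a \<Rightarrow> 'b::euclidean_space \<Rightarrow> real"
  assumes K: "compact K" and cont: "\<And>x. x \<in> space M \<Longrightarrow> continuous_on K (g x)"
    and meas: "\<And>c. c \<in> K \<Longrightarrow> (\<lambda>x. g x c) \<in> borel_measurable M"
  shows "{x \<in> space M. \<exists>c\<in>K. g x c \<le> 0} \<in> sets M"
proof -
  obtain D where D: "countable D" "D \<subseteq> K" "K \<subseteq> closure D"
    using separable[of K] by metis
  have "(\<exists>c\<in>K. g x c \<le> 0) \<longleftrightarrow> (\<forall>n. \<exists>c\<in>D. g x c < 1 / real (Suc n))" if x: "x \<in> space M" for x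
  proof
    assume "\<exists>c\<in>K. g x c \<le> 0"
    then obtain c where c: "c \<in> K" "g x c \<le> 0" by blast
    show "\<forall>n. \<exists>c\<in>D. g x c < 1 / real (Suc n)"
    proof
      fix n
      have "1 / real (Suc n) > 0" by simp
      then obtain \<delta> where \<delta>: "\<delta> > 0" "\<And>c'. c' \<in> K \<Longrightarrow> dist c' c < \<delta> \<Longrightarrow> dist (g x c') (g x c) < 1 / real (Suc n)"
        using cont[OF x] c(1) unfolding continuous_on_iff by blast
      obtain c' where c': "c' \<in> D" "dist c' c < \<delta>"
        using D(3) c(1) \<delta>(1) by (metis closure_approachable subsetD)
      then have "dist (g x c') (g x c) < 1 / real (Suc n)" using \<delta>(2) D(2) by blast
      then show "\<exists>c\<in>D. g x c < 1 / real (Suc n)" using c(2) c'(1) unfolding dist_real_def by (intro bexI[of _ c']) linarith+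
    qed
  next
    assume "\<forall>n. \<exists>c\<in>D. g x c < 1 / real (Suc n)"
    then obtain c where c: "\<And>n. c n \<in> D" "\<And>n. g x (c n) < 1 / real (Suc n)" by metis
    then have "\<forall>n. c n \<in> K" using D(2) by blast
    \<comment> \<open>A limit point of the approximate solutions is a solution by
      continuity.\<close>
    with K obtain l r where l: "l \<in> K" "strict_mono r" "(c \<circ> r) \<longlonglongrightarrow> l"
      unfolding compact_def by blast
    have "(\<lambda>n. g x ((c \<circ> r) n)) \<longlonglongrightarrow> g x l"
      using cont[OF x] l(1,3) \<open>\<forall>n. c n \<in> K\<close>
      by (intro continuous_on_tendsto_compose[of K "g x" "c \<circ> r"]) auto
    moreover have "(\<lambda>n. 1 / real (Suc (r n))) \<longlonglongrightarrow> 0"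
      using LIMSEQ_subseq_LIMSEQ[OF LIMSEQ_inverse_real_of_nat l(2)] by (simp add: o_def inverse_eq_divide)
    ultimately have "g x l \<le> 0"
      by (rule LIMSEQ_le) (use c(2) in \<open>auto intro!: exI[of _ 0] less_imp_le\<close>)
    then show "\<exists>c\<in>K. g x c \<le> 0" using l(1) by blast
  qed
  then have "{x \<in> space M. \<exists>c\<in>K. g x c \<le> 0} = (\<Inter>n. \<Union>c\<in>D. {x \<in> space M. g x c < 1 / real (Suc n)})"
    by auto
  also have "\<dots> \<in> sets M"
  proof -
    have "(\<Union>c\<in>D. {x \<in> space M. g x c < 1 / real (Suc n)}) \<in> sets M" for n
    proof (rule sets.countable_UN''[OF D(1)])
      fix c assume "c \<in> D"
      then have [measurable]: "(\<lambda>x. g x c) \<in> borel_measurable M" using meas D(2) by blast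
      show "{x \<in> space M. g x c < 1 / real (Suc n)} \<in> sets M" by measurable
    qed
    then show ?thesis by (intro sets.countable_INT) auto
  qed
  finally show ?thesis .
qed

section \<open>One point rotated to the pole, the others in the stereographic chart\<close>

lemma PiM_uniform_sphere_orthogonal:
  fixes T :: "'a::euclidean_space \<Rightarrow> 'a"
  assumes T: "orthogonal_transformation T" and "finite I"
  shows "distr (PiM I (\<lambda>_. uniform_sphere)) (PiM I (\<lambda>_. uniform_sphere)) (compose I T) = PiM I (\<lambda>_. uniform_sphere)"
proof -
  have "distr (PiM I (\<lambda>_. uniform_sphere)) (PiM I (\<lambda>_. uniform_sphere)) (compose I T)
      = PiM I (\<lambda>_. distr uniform_sphere uniform_sphere T)"
    using orthogonal_transformation_borel_measurable[OF T]
    by (intro distr_PiM_finite_prob_space' assms prob_space_uniform_sphere)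
       (simp add: measurable_def)
  also have "distr uniform_sphere uniform_sphere T = distr uniform_sphere borel T"
    by (rule distr_cong) auto
  finally show ?thesis by (simp add: distr_uniform_sphere_orthogonal[OF T])
qed

text \<open>For each unit vector \<open>y\<close> there is an orthogonal \<open>T\<close> with
  \<open>T e = y\<close>. Applying it to the remaining points keeps their joint law and turns the
  pole into \<open>y\<close>, so the inner integral is the same for every position of the
  distinguished point.\<close>

lemma nn_integral_PiM_fix_point:
  fixes G :: "('i \<Rightarrow> real ^ 'd::finite) \<Rightarrow> ennreal" and e :: "real ^ 'd"
  assumes I: "finite I" "i \<notin> I" and e: "norm e = 1"
    and [measurable]: "G \<in> borel_measurable (PiM (insert i I) (\<lambda>_. uniform_sphere))"
    and inv: "\<And>T x. orthogonal_transformation T \<Longrightarrow> x \<in> extensional (insert i I) \<Longrightarrow> G (compose (insert i I) T x) = G x"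
  shows "(\<integral>\<^sup>+x. G x \<partial>PiM (insert i I) (\<lambda>_. uniform_sphere)) = (\<integral>\<^sup>+x. G (x(i := e)) \<partial>PiM I (\<lambda>_. uniform_sphere))"
proof -
  have inner: "(\<integral>\<^sup>+x. G (x(i := y)) \<partial>PiM I (\<lambda>_. uniform_sphere)) = (\<integral>\<^sup>+x. G (x(i := e)) \<partial>PiM I (\<lambda>_. uniform_sphere))"
    if "y \<in> sphere 0 1" for y
  proof -
    have "norm e = norm y" using e that by simp
    then obtain T :: "real ^ 'd \<Rightarrow> real ^ 'd" where T: "orthogonal_transformation T" "T e = y"
      using orthogonal_transformation_exists by metis
    have m: "compose I T \<in> PiM I (\<lambda>_. uniform_sphere) \<rightarrow>\<^sub>M PiM I (\<lambda>_. uniform_sphere :: (real ^ 'd) measure)"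
      using orthogonal_transformation_borel_measurable[OF T(1)] unfolding compose_def by measurable
    have m2: "(\<lambda>x. x(i := z)) \<in> PiM I (\<lambda>_. uniform_sphere) \<rightarrow>\<^sub>M PiM (insert i I) (\<lambda>_. uniform_sphere :: (real ^ 'd) measure)" for z
      by (rule measurable_fun_upd[where J=I]) auto
    have "(\<integral>\<^sup>+x. G (x(i := y)) \<partial>PiM I (\<lambda>_. uniform_sphere))
        = (\<integral>\<^sup>+x. G (x(i := y)) \<partial>distr (PiM I (\<lambda>_. uniform_sphere)) (PiM I (\<lambda>_. uniform_sphere)) (compose I T))"
      by (simp add: PiM_uniform_sphere_orthogonal[OF T(1) I(1)])
    also have "\<dots> = (\<integral>\<^sup>+x. G ((compose I T x)(i := y)) \<partial>PiM I (\<lambda>_. uniform_sphere))"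
      by (rule nn_integral_distr[OF m]) (use measurable_compose[OF m2 assms(4)] in simp)
    also have "\<dots> = (\<integral>\<^sup>+x. G (x(i := e)) \<partial>PiM I (\<lambda>_. uniform_sphere))"
    proof (rule nn_integral_cong)
      fix x assume x: "x \<in> space (PiM I (\<lambda>_. uniform_sphere :: (real ^ 'd) measure))"
      have "(compose I T x)(i := y) = compose (insert i I) T (x(i := e))"
        using I T(2) by (auto simp: compose_def fun_eq_iff)
      moreover have "x(i := e) \<in> extensional (insert i I)"
        using x by (auto simp: space_PiM PiE_def extensional_def)
      ultimately show "G ((compose I T x)(i := y)) = G (x(i := e))" using inv[OF T(1)] by simp
    qed
    finally show ?thesis .
  qed
  have "(\<integral>\<^sup>+x. G x \<partial>PiM (insert i I) (\<lambda>_. uniform_sphere))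
      = (\<integral>\<^sup>+y. (\<integral>\<^sup>+x. G (x(i := y)) \<partial>PiM I (\<lambda>_. uniform_sphere)) \<partial>uniform_sphere)"
    by (rule sph.product_nn_integral_insert_rev) (use I in auto)
  also have "\<dots> = (\<integral>\<^sup>+y. (\<integral>\<^sup>+x. G (x(i := e)) \<partial>PiM I (\<lambda>_. uniform_sphere)) \<partial>(uniform_sphere :: (real ^ 'd) measure))"
    by (rule nn_integral_cong_AE, use AE_uniform_sphere in eventually_elim) (rule inner)
  also have "\<dots> = (\<integral>\<^sup>+x. G (x(i := e)) \<partial>PiM I (\<lambda>_. uniform_sphere))"
    using prob_space.emeasure_space_1[OF prob_space_uniform_sphere[where 'a="real ^ 'd"]] by simp
  finally show ?thesis .
qed

text \<open>Each point contributes its own factor \<open>R ^ (DIM('a) - 1)\<close>, and the points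
  are rescaled one at a time: the last one with the others frozen, the others by induction.\<close>

lemma stereo_scaling_mono_PiM:
  fixes F :: "('i \<Rightarrow> 'a::euclidean_space) \<Rightarrow> ennreal"
  assumes e: "e \<in> Basis" and dim: "DIM('a) \<ge> 2" and "finite I"
    and R: "0 < R" "R \<le> R'" and F: "F \<in> borel_measurable (PiM I (\<lambda>_. borel))"
  shows "ennreal (R ^ (DIM('a) - 1)) ^ card I * (\<integral>\<^sup>+x. F (\<lambda>k\<in>I. stereo e (x k) /\<^sub>R R) \<partial>PiM I (\<lambda>_. uniform_sphere))
       \<le> ennreal (R' ^ (DIM('a) - 1)) ^ card I * (\<integral>\<^sup>+x. F (\<lambda>k\<in>I. stereo e (x k) /\<^sub>R R') \<partial>PiM I (\<lambda>_. uniform_sphere))"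
  using assms(3) F
proof (induction I arbitrary: F rule: finite_induct)
  case empty
  then show ?case by (simp add: sph.nn_integral_empty restrict_def)
next
  case (insert i I)
  note [measurable] = insert.prems
  let ?n = "DIM('a) - 1"
  define H where "H R v = (\<integral>\<^sup>+y. F (v(i := stereo e y /\<^sub>R R)) \<partial>uniform_sphere)" for R v
  have Hm [measurable]: "H R \<in> borel_measurable (PiM I (\<lambda>_. borel))" for R
    unfolding H_def by measurable
  have Hmono: "ennreal (R ^ ?n) * H R v \<le> ennreal (R' ^ ?n) * H R' v" if v: "v \<in> space (PiM I (\<lambda>_. borel))" for v
  proof -
    have "(\<lambda>w. v(i := w)) \<in> borel \<rightarrow>\<^sub>M PiM (insert i I) (\<lambda>_. borel)"
      using v by (intro measurable_fun_upd[where J=I]) auto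
    then have "(\<lambda>w. F (v(i := w))) \<in> borel_measurable borel" by simp
    from stereo_scaling_mono[OF e dim this R] show ?thesis by (simp add: H_def)
  qed
  have eq: "(\<integral>\<^sup>+x. F (\<lambda>k\<in>insert i I. stereo e (x k) /\<^sub>R R) \<partial>PiM (insert i I) (\<lambda>_. uniform_sphere))
       = (\<integral>\<^sup>+x. H R (\<lambda>k\<in>I. stereo e (x k) /\<^sub>R R) \<partial>PiM I (\<lambda>_. uniform_sphere))" for R
  proof -
    have "(\<integral>\<^sup>+x. F (\<lambda>k\<in>insert i I. stereo e (x k) /\<^sub>R R) \<partial>PiM (insert i I) (\<lambda>_. uniform_sphere))
       = (\<integral>\<^sup>+x. (\<integral>\<^sup>+y. F (\<lambda>k\<in>insert i I. stereo e ((x(i := y)) k) /\<^sub>R R) \<partial>uniform_sphere) \<partial>PiM I (\<lambda>_. uniform_sphere))"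
      by (rule sph.product_nn_integral_insert) (use insert in auto)
    also have "\<dots> = (\<integral>\<^sup>+x. H R (\<lambda>k\<in>I. stereo e (x k) /\<^sub>R R) \<partial>PiM I (\<lambda>_. uniform_sphere))"
    proof (rule nn_integral_cong)
      fix x :: "'i \<Rightarrow> 'a"
      have "(\<lambda>k\<in>insert i I. stereo e ((x(i := y)) k) /\<^sub>R R) = (\<lambda>k\<in>I. stereo e (x k) /\<^sub>R R)(i := stereo e y /\<^sub>R R)" for y
        using insert.hyps by (auto simp: fun_eq_iff)
      then show "(\<integral>\<^sup>+y. F (\<lambda>k\<in>insert i I. stereo e ((x(i := y)) k) /\<^sub>R R) \<partial>uniform_sphere) = H R (\<lambda>k\<in>I. stereo e (x k) /\<^sub>R R)"
        by (simp add: H_def)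
    qed
    finally show ?thesis .
  qed
  let ?c = "ennreal (R ^ ?n)" and ?c' = "ennreal (R' ^ ?n)"
  have "?c ^ card (insert i I) * (\<integral>\<^sup>+x. F (\<lambda>k\<in>insert i I. stereo e (x k) /\<^sub>R R) \<partial>PiM (insert i I) (\<lambda>_. uniform_sphere))
     = ?c ^ card I * (\<integral>\<^sup>+x. ?c * H R (\<lambda>k\<in>I. stereo e (x k) /\<^sub>R R) \<partial>PiM I (\<lambda>_. uniform_sphere))"
    using insert.hyps by (simp add: eq nn_integral_cmult mult_ac)
  \<comment> \<open>A mixed stage: the integrated point already has scale \<open>R'\<close> while
    the rest still has scale \<open>R\<close>.\<close>
  also have "\<dots> \<le> ?c ^ card I * (\<integral>\<^sup>+x. ?c' * H R' (\<lambda>k\<in>I. stereo e (x k) /\<^sub>R R) \<partial>PiM I (\<lambda>_. uniform_sphere))"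
    by (intro mult_left_mono nn_integral_mono Hmono) (auto simp: space_PiM)
  also have "\<dots> \<le> ?c' ^ card I * (\<integral>\<^sup>+x. ?c' * H R' (\<lambda>k\<in>I. stereo e (x k) /\<^sub>R R') \<partial>PiM I (\<lambda>_. uniform_sphere))"
    by (rule insert.IH) measurable
  also have "\<dots> = ?c' ^ card (insert i I) * (\<integral>\<^sup>+x. F (\<lambda>k\<in>insert i I. stereo e (x k) /\<^sub>R R') \<partial>PiM (insert i I) (\<lambda>_. uniform_sphere))"
    using insert.hyps by (simp add: eq nn_integral_cmult mult_ac)
  finally show ?case .
qed

text \<open>The limit is the supremum. That it also bounds \<open>f\<close> on the whole half-line
  is recorded because the later asymptotic estimates use the limits as global bounds.\<close>

lemma tendsto_at_right_0_antimono:
  fixes f :: "real \<Rightarrow> real"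
  assumes mono: "\<And>x y. 0 < x \<Longrightarrow> x \<le> y \<Longrightarrow> f y \<le> f x" and bd: "\<And>x. 0 < x \<Longrightarrow> f x \<le> B"
  shows "\<exists>l. (f \<longlongrightarrow> l) (at_right 0) \<and> (\<forall>x>0. f x \<le> l)"
proof -
  define l where "l = Sup (f ` {0<..})"
  have bdd: "bdd_above (f ` {0<..})" using bd by (auto intro!: bdd_aboveI2)
  have le: "f x \<le> l" if "x > 0" for x unfolding l_def using that bdd by (intro cSup_upper) auto
  have "(f \<longlongrightarrow> l) (at_right 0)"
  proof (rule order_tendstoI)
    fix a assume "a < l"
    then obtain x where x: "x > 0" "a < f x"
      unfolding l_def by (subst (asm) less_cSup_iff) (use bdd in auto)
    then have "\<And>y. 0 < y \<Longrightarrow> y < x \<Longrightarrow> a < f y" using mono by (meson less_le_trans less_imp_le)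
    then show "\<forall>\<^sub>F x in at_right 0. a < f x" using x(1) by (auto simp: eventually_at_right_field)
  next
    fix a assume "l < a"
    then show "\<forall>\<^sub>F x in at_right 0. f x < a"
      using le by (auto simp: eventually_at_right_field intro!: exI[of _ 1] intro: le_less_trans)
  qed
  with le show ?thesis by blast
qed

text \<open>With \<open>t = x \<bullet> e\<close> the projected point has squared norm
  \<open>(1 + t) / (1 - t)\<close>, while the squared distance to \<open>e\<close> is
  \<open>2 * (1 - t)\<close>; their product is \<open>2 * (1 + t) \<le> 4\<close>.\<close>

lemma stereo_norm_ge_imp_near:
  fixes x e :: "'a::euclidean_space"
  assumes x: "norm x = 1" and e: "norm e = 1" and ne: "x \<bullet> e \<noteq> 1" and R: "R > 0" and ge: "norm (stereo e x) \<ge> R"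
  shows "x \<in> cball e (2 / R)"
proof -
  define t where "t = x \<bullet> e"
  have "\<bar>t\<bar> \<le> 1" using Cauchy_Schwarz_ineq2[of x e] x e by (simp add: t_def)
  then have t: "t < 1" "-1 \<le> t" using ne by (auto simp: t_def)
  have "(norm (x - t *\<^sub>R e))\<^sup>2 = 1 - t\<^sup>2"
    using x e unfolding power2_norm_eq_inner norm_eq_1
    by (simp add: inner_diff_left inner_diff_right t_def inner_commute power2_eq_square)
  then have "(norm (stereo e x))\<^sup>2 = (1 - t\<^sup>2) / (1 - t)\<^sup>2"
    using t by (simp add: stereo_def t_def[symmetric] power_mult_distrib power_divide)
  moreover have "1 - t\<^sup>2 = (1 - t) * (1 + t)" by (simp add: power2_eq_square algebra_simps)
  ultimately have "(norm (stereo e x))\<^sup>2 = (1 + t) / (1 - t)"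
    using t by (simp add: power2_eq_square)
  moreover have "R\<^sup>2 \<le> (norm (stereo e x))\<^sup>2" using ge R by (intro power_mono) auto
  ultimately have "R\<^sup>2 * (1 - t) \<le> 1 + t" using t by (simp add: pos_le_divide_eq)
  then have *: "R\<^sup>2 * (2 * (1 - t)) \<le> 4" using t by linarith
  have d: "(dist e x)\<^sup>2 = 2 * (1 - t)"
    using x e unfolding dist_norm power2_norm_eq_inner norm_eq_1
    by (simp add: inner_diff_left inner_diff_right t_def inner_commute)
  have "R\<^sup>2 * (dist e x)\<^sup>2 \<le> 4" unfolding d by (rule *)
  then have "(R * dist e x)\<^sup>2 \<le> 2\<^sup>2" by (simp add: power_mult_distrib)
  then have "R * dist e x \<le> 2" by (rule power2_le_imp_le) simp
  then have "dist e x \<le> 2 / R" using R by (simp add: pos_le_divide_eq mult.commute)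
  then show ?thesis by simp
qed


abbreviation dtuple :: "('d \<Rightarrow> real ^ 'd::finite) measure" where
  "dtuple \<equiv> PiM UNIV (\<lambda>_. uniform_sphere)"

text \<open>The hyperplane through the points \<open>p k\<close> has distance at least \<open>1 / sqrt (1 + \<rho>\<^sup>2)\<close> from the origin.\<close>

definition far_hyperplane :: "real \<Rightarrow> ('d \<Rightarrow> real ^ 'd::finite) \<Rightarrow> bool" where
  "far_hyperplane \<rho> p \<longleftrightarrow> (\<exists>w. norm w \<le> sqrt (1 + \<rho>\<^sup>2) \<and> (\<forall>k. w \<bullet> p k = 1))"

text \<open>The norm bound confines \<open>w\<close> to a compact ball, and the equations are
  collected into one sum of absolute values that has to be \<open>\<le> 0\<close>, the form required
  by \<open>sets_ex_compact\<close>.\<close>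

lemma pred_far_hyperplane [measurable]: "Measurable.pred dtuple (far_hyperplane \<rho> :: ('d \<Rightarrow> real ^ 'd::finite) \<Rightarrow> bool)"
proof -
  have eq: "far_hyperplane \<rho> p \<longleftrightarrow> (\<exists>w\<in>cball 0 (sqrt (1 + \<rho>\<^sup>2)). (\<Sum>k\<in>UNIV. \<bar>w \<bullet> p k - 1\<bar>) \<le> 0)" for p :: "'d \<Rightarrow> real ^ 'd"
  proof -
    have "(\<Sum>k\<in>UNIV. \<bar>w \<bullet> p k - 1\<bar>) \<le> 0 \<longleftrightarrow> (\<forall>k. w \<bullet> p k = 1)" for w
      by (subst sum_nonneg_eq_0_iff[symmetric, of UNIV "\<lambda>k. \<bar>w \<bullet> p k - 1\<bar>", simplified]) (auto intro!: antisym sum_nonneg)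
    then show ?thesis unfolding far_hyperplane_def by auto
  qed
  have "{p \<in> space dtuple. far_hyperplane \<rho> p} \<in> sets (dtuple :: ('d \<Rightarrow> real ^ 'd) measure)"
    unfolding eq
    by (rule sets_ex_compact) (auto intro!: continuous_intros)
  then show ?thesis by (simp add: pred_def)
qed

lemma far_hyperplane_orthogonal:
  fixes p :: "'d \<Rightarrow> real ^ 'd::finite"
  assumes T: "orthogonal_transformation T"
  shows "far_hyperplane \<rho> (\<lambda>k. T (p k)) \<longleftrightarrow> far_hyperplane \<rho> p"
proof
  assume "far_hyperplane \<rho> p"
  then obtain w where "norm w \<le> sqrt (1 + \<rho>\<^sup>2)" "\<forall>k. w \<bullet> p k = 1" unfolding far_hyperplane_def by blast
  then show "far_hyperplane \<rho> (\<lambda>k. T (p k))"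
    unfolding far_hyperplane_def using T
    by (intro exI[of _ "T w"]) (simp add: orthogonal_transformation_norm orthogonal_transformation_inner)
next
  assume "far_hyperplane \<rho> (\<lambda>k. T (p k))"
  then obtain w where w: "norm w \<le> sqrt (1 + \<rho>\<^sup>2)" "\<forall>k. w \<bullet> T (p k) = 1" unfolding far_hyperplane_def by blast
  obtain v where v: "w = T v" using orthogonal_transformation_surj[OF T] by (metis surjD)
  show "far_hyperplane \<rho> p"
    using w unfolding far_hyperplane_def v orthogonal_transformation_norm[OF T] orthogonal_transformation_inner[OF T] by blast
qed

section \<open>Caps cut off by a random hyperplane\<close>

lemma prob_space_PiM_uniform_sphere: "prob_space (PiM I (\<lambda>_. uniform_sphere :: 'a::euclidean_space measure))"
  by (intro prob_space_PiM prob_space_uniform_sphere)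

lemma AE_PiM_uniform_sphere_component:
  assumes "finite I" "AE x in uniform_sphere. P (x :: 'a::euclidean_space)"
  shows "AE x in PiM I (\<lambda>_. uniform_sphere). \<forall>k\<in>I. P (x k)"
  using assms by (intro AE_finite_allI AE_PiM_component prob_space_uniform_sphere) auto

text \<open>For chart points \<open>v k\<close> with \<open>k \<noteq> i\<close> this says that they
  lie on a hyperplane, within the orthogonal complement of the axis, at distance at least 1 from the
  origin. It is stated over a compact set and as one inequality to suit
  \<open>sets_ex_compact\<close>.\<close>

definition unit_solvable :: "'d \<Rightarrow> ('d \<Rightarrow> real ^ 'd::finite) \<Rightarrow> bool" where
  "unit_solvable i v \<longleftrightarrow> (\<exists>u\<in>cball 0 1 \<inter> {u. u \<bullet> axis i 1 = 0}. (\<Sum>k\<in>UNIV - {i}. \<bar>u \<bullet> v k - 1\<bar>) \<le> 0)"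

lemma unit_solvable_iff:
  "unit_solvable i v \<longleftrightarrow> (\<exists>u. norm u \<le> 1 \<and> u \<bullet> axis i 1 = 0 \<and> (\<forall>k. k \<noteq> i \<longrightarrow> u \<bullet> v k = 1))"
proof -
  have "(\<Sum>k\<in>UNIV - {i}. \<bar>u \<bullet> v k - 1\<bar>) \<le> 0 \<longleftrightarrow> (\<forall>k. k \<noteq> i \<longrightarrow> u \<bullet> v k = 1)" for u
  proof -
    have "(\<Sum>k\<in>UNIV - {i}. \<bar>u \<bullet> v k - 1\<bar>) \<le> 0 \<longleftrightarrow> (\<Sum>k\<in>UNIV - {i}. \<bar>u \<bullet> v k - 1\<bar>) = 0"
      by (auto intro!: antisym sum_nonneg)
    also have "\<dots> \<longleftrightarrow> (\<forall>k\<in>UNIV - {i}. \<bar>u \<bullet> v k - 1\<bar> = 0)" by (rule sum_nonneg_eq_0_iff) auto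
    finally show ?thesis by auto
  qed
  then show ?thesis unfolding unit_solvable_def by auto
qed

lemma pred_unit_solvable [measurable]:
  "Measurable.pred (PiM (UNIV - {i}) (\<lambda>_. borel)) (unit_solvable i :: ('d \<Rightarrow> real ^ 'd::finite) \<Rightarrow> bool)"
proof -
  have "compact (cball 0 1 \<inter> {u :: real ^ 'd. u \<bullet> axis i 1 = 0})"
    by (intro compact_Int_closed compact_cball closed_Collect_eq continuous_intros)
  then have "{v \<in> space (PiM (UNIV - {i}) (\<lambda>_. borel)). unit_solvable i v} \<in> sets (PiM (UNIV - {i}) (\<lambda>_. borel :: (real ^ 'd) measure))"
    unfolding unit_solvable_def
    by (rule sets_ex_compact) (auto intro!: continuous_intros)
  then show ?thesis by (simp add: pred_def)
qed

text \<open>A hyperplane through the pole but not through the origin has an equation with normal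
  \<open>e + u\<close>, \<open>u\<close> orthogonal to \<open>e\<close>. In the chart it becomes the
  hyperplane with normal \<open>u\<close>, one dimension lower.\<close>

lemma inner_stereo_eq_1_iff:
  assumes "u \<bullet> e = 0" "x \<bullet> e \<noteq> 1"
  shows "u \<bullet> stereo e x = 1 \<longleftrightarrow> (e + u) \<bullet> x = 1"
proof -
  have eq: "u \<bullet> stereo e x = (u \<bullet> x) / (1 - x \<bullet> e)"
    using assms(1) by (simp add: stereo_def inner_diff_right)
  have nz: "1 - x \<bullet> e \<noteq> 0" using assms(2) by simp
  have "u \<bullet> stereo e x = 1 \<longleftrightarrow> u \<bullet> x = 1 - x \<bullet> e"
    unfolding eq nonzero_divide_eq_eq[OF nz] mult_1 ..
  also have "\<dots> \<longleftrightarrow> (e + u) \<bullet> x = 1"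
    unfolding inner_add_left inner_commute[of e x] by linarith
  finally show ?thesis .
qed

lemma norm_unit_add_perp_le_iff:
  fixes e u :: "'a::euclidean_space"
  assumes "norm e = 1" "u \<bullet> e = 0" "\<rho> > 0"
  shows "norm (e + u) \<le> sqrt (1 + \<rho>\<^sup>2) \<longleftrightarrow> norm u \<le> \<rho>"
proof -
  have "(norm (e + u))\<^sup>2 = 1 + (norm u)\<^sup>2"
    using norm_axis_add_perp[OF assms(1,2), of 1] by simp
  then have "norm (e + u) = sqrt (1 + (norm u)\<^sup>2)"
    by (metis norm_ge_zero real_sqrt_unique)
  then have "norm (e + u) \<le> sqrt (1 + \<rho>\<^sup>2) \<longleftrightarrow> (norm u)\<^sup>2 \<le> \<rho>\<^sup>2" by simp
  then show ?thesis using assms(3) by (simp add: abs_le_square_iff[symmetric])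
qed

text \<open>The pole on the hyperplane forces \<open>w \<bullet> e = 1\<close>, hence
  \<open>w = e + u\<close> with \<open>u\<close> orthogonal to \<open>e\<close>, and by Pythagoras
  the norm bound becomes \<open>norm u \<le> \<rho>\<close>. Dividing \<open>u\<close> by
  \<open>\<rho>\<close> moves the parameter into the scale \<open>R = 1 / \<rho>\<close> of the
  chart.\<close>

lemma far_hyperplane_iff_unit_solvable:
  fixes x :: "'d \<Rightarrow> real ^ 'd::finite"
  assumes \<rho>: "\<rho> > 0" and ne: "\<And>k. k \<noteq> i \<Longrightarrow> x k \<bullet> axis i 1 \<noteq> 1"
  shows "far_hyperplane \<rho> (x(i := axis i 1)) \<longleftrightarrow> unit_solvable i (\<lambda>k\<in>UNIV - {i}. stereo (axis i 1) (x k) /\<^sub>R (1 / \<rho>))"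
proof -
  define e :: "real ^ 'd" where "e = axis i 1"
  have e1: "norm e = 1" by (simp add: e_def)
  then have ee: "e \<bullet> e = 1" by (simp add: norm_eq_1)
  have st: "u \<bullet> stereo e (x k) = 1 \<longleftrightarrow> (e + u) \<bullet> x k = 1" if "u \<bullet> e = 0" "k \<noteq> i" for u k
    using inner_stereo_eq_1_iff[OF that(1)] ne[OF that(2)] by (simp add: e_def)
  have "far_hyperplane \<rho> (x(i := e)) \<longleftrightarrow> (\<exists>u. norm u \<le> \<rho> \<and> u \<bullet> e = 0 \<and> (\<forall>k. k \<noteq> i \<longrightarrow> u \<bullet> stereo e (x k) = 1))"
  proof
    assume "far_hyperplane \<rho> (x(i := e))"
    then obtain w where w: "norm w \<le> sqrt (1 + \<rho>\<^sup>2)" and wk: "\<And>k. w \<bullet> (x(i := e)) k = 1"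
      unfolding far_hyperplane_def by blast
    have we: "w \<bullet> e = 1" using wk[of i] by simp
    define u where "u = w - e"
    have wu: "w = e + u" by (simp add: u_def)
    have ue: "u \<bullet> e = 0" using we ee by (simp add: u_def inner_diff_left)
    have "norm u \<le> \<rho>" using w unfolding wu norm_unit_add_perp_le_iff[OF e1 ue \<rho>] .
    moreover have "u \<bullet> stereo e (x k) = 1" if "k \<noteq> i" for k
      using wk[of k] that unfolding st[OF ue that] wu by simp
    ultimately show "\<exists>u. norm u \<le> \<rho> \<and> u \<bullet> e = 0 \<and> (\<forall>k. k \<noteq> i \<longrightarrow> u \<bullet> stereo e (x k) = 1)"
      using ue by blast
  next
    assume "\<exists>u. norm u \<le> \<rho> \<and> u \<bullet> e = 0 \<and> (\<forall>k. k \<noteq> i \<longrightarrow> u \<bullet> stereo e (x k) = 1)"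
    then obtain u where u: "norm u \<le> \<rho>" and ue: "u \<bullet> e = 0" and uk: "\<And>k. k \<noteq> i \<Longrightarrow> u \<bullet> stereo e (x k) = 1"
      by blast
    have "norm (e + u) \<le> sqrt (1 + \<rho>\<^sup>2)" unfolding norm_unit_add_perp_le_iff[OF e1 ue \<rho>] by (rule u)
    moreover have "(e + u) \<bullet> (x(i := e)) k = 1" for k
    proof (cases "k = i")
      case True
      then show ?thesis using ue ee by (simp add: inner_add_left)
    next
      case False
      then show ?thesis using uk[OF False] unfolding st[OF ue False] by simp
    qed
    ultimately show "far_hyperplane \<rho> (x(i := e))" unfolding far_hyperplane_def by blast
  qed
  also have "\<dots> \<longleftrightarrow> unit_solvable i (\<lambda>k\<in>UNIV - {i}. stereo e (x k) /\<^sub>R (1 / \<rho>))"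
  proof
    assume "\<exists>u. norm u \<le> \<rho> \<and> u \<bullet> e = 0 \<and> (\<forall>k. k \<noteq> i \<longrightarrow> u \<bullet> stereo e (x k) = 1)"
    then obtain u where u: "norm u \<le> \<rho>" "u \<bullet> e = 0" "\<And>k. k \<noteq> i \<Longrightarrow> u \<bullet> stereo e (x k) = 1" by blast
    define u' where "u' = (1 / \<rho>) *\<^sub>R u"
    have "norm u' = norm u / \<rho>" using \<rho> by (simp add: u'_def)
    then have "norm u' \<le> 1" using \<rho> u(1) by simp
    moreover have "u' \<bullet> e = 0" using u(2) by (simp add: u'_def)
    moreover have "u' \<bullet> (stereo e (x k) /\<^sub>R (1 / \<rho>)) = 1" if "k \<noteq> i" for k
      using u(3)[OF that] \<rho> by (simp add: u'_def)
    ultimately show "unit_solvable i (\<lambda>k\<in>UNIV - {i}. stereo e (x k) /\<^sub>R (1 / \<rho>))"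
      unfolding unit_solvable_iff e_def[symmetric] by (intro exI[of _ u']) simp
  next
    assume "unit_solvable i (\<lambda>k\<in>UNIV - {i}. stereo e (x k) /\<^sub>R (1 / \<rho>))"
    then obtain u where u: "norm u \<le> 1" "u \<bullet> e = 0" "\<And>k. k \<noteq> i \<Longrightarrow> u \<bullet> (\<rho> *\<^sub>R stereo e (x k)) = 1"
      unfolding unit_solvable_iff e_def[symmetric] by (auto simp: inverse_eq_divide)
    have "norm (\<rho> *\<^sub>R u) \<le> \<rho>" using u(1) \<rho> by (simp add: mult_left_le)
    then show "\<exists>u. norm u \<le> \<rho> \<and> u \<bullet> e = 0 \<and> (\<forall>k. k \<noteq> i \<longrightarrow> u \<bullet> stereo e (x k) = 1)"
      using u(2,3) by (intro exI[of _ "\<rho> *\<^sub>R u"]) simp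
  qed
  finally show ?thesis unfolding e_def .
qed

text \<open>The event is rotation invariant, so the point with index \<open>i\<close> may be put at
  the pole; almost surely none of the others is there.\<close>

lemma emeasure_far_hyperplane:
  fixes i :: "'d::finite"
  assumes dim: "CARD('d) \<ge> 2" and \<rho>: "\<rho> > 0"
  shows "emeasure (dtuple :: ('d \<Rightarrow> real ^ 'd) measure) {p \<in> space dtuple. far_hyperplane \<rho> p} =
    (\<integral>\<^sup>+x. indicator {v. unit_solvable i v} (\<lambda>k\<in>UNIV - {i}. stereo (axis i 1) (x k) /\<^sub>R (1 / \<rho>)) \<partial>PiM (UNIV - {i}) (\<lambda>_. uniform_sphere))"
proof -
  let ?e = "axis i 1 :: real ^ 'd"
  have ins: "insert i (UNIV - {i}) = UNIV" by auto
  let ?G = "indicator {p. far_hyperplane \<rho> p} :: ('d \<Rightarrow> real ^ 'd) \<Rightarrow> ennreal"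
  have Gm: "?G \<in> borel_measurable dtuple" by measurable
  let ?S = "{p \<in> space (dtuple :: ('d \<Rightarrow> real ^ 'd) measure). far_hyperplane \<rho> p}"
  have "?S \<in> sets dtuple" by measurable
  then have "emeasure dtuple ?S = (\<integral>\<^sup>+p. indicator ?S p \<partial>dtuple)" by simp
  also have "\<dots> = (\<integral>\<^sup>+p. ?G p \<partial>dtuple)"
    by (rule nn_integral_cong) (simp add: indicator_def)
  also have "\<dots> = (\<integral>\<^sup>+x. ?G (x(i := ?e)) \<partial>PiM (UNIV - {i}) (\<lambda>_. uniform_sphere))"
  proof -
    have "?G (compose UNIV T x) = ?G x" if "orthogonal_transformation T" for T x
      using far_hyperplane_orthogonal[OF that, of \<rho> x] by (simp add: compose_def restrict_UNIV indicator_def)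
    then show ?thesis
      using Gm by (intro nn_integral_PiM_fix_point[of "UNIV - {i}" i ?e ?G, unfolded ins]) auto
  qed
  also have "\<dots> = (\<integral>\<^sup>+x. indicator {v. unit_solvable i v} (\<lambda>k\<in>UNIV - {i}. stereo ?e (x k) /\<^sub>R (1 / \<rho>)) \<partial>PiM (UNIV - {i}) (\<lambda>_. uniform_sphere))"
  proof (rule nn_integral_cong_AE)
    have "AE x in uniform_sphere. ?e \<bullet> x \<noteq> 1"
      by (rule AE_uniform_sphere_not_hyperplane[OF dim]) (simp add: axis_eq_0_iff)
    then have "AE x in PiM (UNIV - {i}) (\<lambda>_. uniform_sphere). \<forall>k\<in>UNIV - {i}. ?e \<bullet> x k \<noteq> 1"
      by (intro AE_PiM_uniform_sphere_component) auto
    then show "AE x in PiM (UNIV - {i}) (\<lambda>_. uniform_sphere). (?G (x(i := ?e)) :: ennreal) =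
      indicator {v. unit_solvable i v} (\<lambda>k\<in>UNIV - {i}. stereo ?e (x k) /\<^sub>R (1 / \<rho>))"
    proof eventually_elim
      fix x :: "'d \<Rightarrow> real ^ 'd" assume "\<forall>k\<in>UNIV - {i}. ?e \<bullet> x k \<noteq> 1"
      then have "far_hyperplane \<rho> (x(i := ?e)) \<longleftrightarrow> unit_solvable i (\<lambda>k\<in>UNIV - {i}. stereo ?e (x k) /\<^sub>R (1 / \<rho>))"
        by (intro far_hyperplane_iff_unit_solvable[OF \<rho>]) (auto simp: inner_commute)
      then show "(?G (x(i := ?e)) :: ennreal) = indicator {v. unit_solvable i v} (\<lambda>k\<in>UNIV - {i}. stereo ?e (x k) /\<^sub>R (1 / \<rho>))"
        by (simp only: indicator_def mem_Collect_eq)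
    qed
  qed
  finally show ?thesis .
qed

definition far_prob :: "'d::finite itself \<Rightarrow> real \<Rightarrow> real" where
  "far_prob _ \<rho> = measure (dtuple :: ('d \<Rightarrow> real ^ 'd) measure) {p \<in> space dtuple. far_hyperplane \<rho> p}"

text \<open>Monotonicity in the scale \<open>R = 1 / \<rho>\<close>. There are \<open>n\<close>
  points in the chart and each carries a factor \<open>R ^ n\<close>, which explains the exponent
  \<open>n * n\<close>.\<close>

lemma far_prob_scaling_mono:
  assumes dim: "CARD('d::finite) \<ge> 2" and \<rho>: "0 < \<rho>" "\<rho> \<le> \<rho>'"
  defines "n \<equiv> CARD('d) - 1"
  shows "far_prob TYPE('d) \<rho>' / \<rho>' ^ (n * n) \<le> far_prob TYPE('d) \<rho> / \<rho> ^ (n * n)"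
proof -
  interpret prob_space "dtuple :: ('d \<Rightarrow> real ^ 'd) measure" by (rule prob_space_PiM_uniform_sphere)
  define i :: 'd where "i = undefined"
  have \<rho>': "\<rho>' > 0" using \<rho> by simp
  have cn: "card (UNIV - {i}) = n" by (simp add: n_def card_Diff_singleton)
  have "axis i 1 \<in> (Basis :: (real ^ 'd) set)" by (simp add: axis_in_Basis_iff)
  moreover have "DIM(real ^ 'd) \<ge> 2" using dim by simp
  moreover have "0 < 1 / \<rho>'" "1 / \<rho>' \<le> 1 / \<rho>" using \<rho> \<rho>' by (auto intro: divide_left_mono)
  moreover have "indicator {v :: 'd \<Rightarrow> real ^ 'd. unit_solvable i v} \<in> borel_measurable (PiM (UNIV - {i}) (\<lambda>_. borel))"
    by measurable
  ultimately have "ennreal ((1 / \<rho>') ^ n) ^ n * emeasure dtuple {p \<in> space (dtuple :: ('d \<Rightarrow> real ^ 'd) measure). far_hyperplane \<rho>' p}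
      \<le> ennreal ((1 / \<rho>) ^ n) ^ n * emeasure dtuple {p \<in> space (dtuple :: ('d \<Rightarrow> real ^ 'd) measure). far_hyperplane \<rho> p}"
    using stereo_scaling_mono_PiM[of "axis i 1 :: real ^ 'd" "UNIV - {i}" "1 / \<rho>'" "1 / \<rho>" "indicator {v. unit_solvable i v}"]
    unfolding emeasure_far_hyperplane[OF dim \<rho>(1), of i] emeasure_far_hyperplane[OF dim \<rho>', of i] cn
    by (simp add: n_def)
  then have "ennreal ((1 / \<rho>') ^ (n * n) * far_prob TYPE('d) \<rho>') \<le> ennreal ((1 / \<rho>) ^ (n * n) * far_prob TYPE('d) \<rho>)"
    using \<rho> \<rho>' unfolding emeasure_eq_measure far_prob_def[symmetric]
    by (simp add: ennreal_power ennreal_mult power_mult far_prob_def)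
  then show ?thesis
    using \<rho> by (subst (asm) ennreal_le_iff) (auto simp: far_prob_def power_one_over field_simps)
qed

text \<open>A solution \<open>u\<close> with \<open>norm u \<le> 1\<close> and
  \<open>u \<bullet> v k = 1\<close> forces \<open>norm (v k) \<ge> 1\<close>, so all
  \<open>n\<close> independent points lie within \<open>2 * \<rho>\<close> of the pole, each with
  probability \<open>O(\<rho> ^ n)\<close>.\<close>

lemma far_prob_bounded:
  assumes dim: "CARD('d::finite) \<ge> 2"
  defines "n \<equiv> CARD('d) - 1"
  shows "\<exists>B. \<forall>\<rho>>0. far_prob TYPE('d) \<rho> / \<rho> ^ (n * n) \<le> B"
proof -
  interpret prob_space "dtuple :: ('d \<Rightarrow> real ^ 'd) measure" by (rule prob_space_PiM_uniform_sphere)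
  define i :: 'd where "i = undefined"
  let ?e = "axis i 1 :: real ^ 'd"
  have e1: "norm ?e = 1" by simp
  have cn: "card (UNIV - {i}) = n" by (simp add: n_def card_Diff_singleton)
  obtain C where C: "C > 0" "\<And>x r. norm (x :: real ^ 'd) = 1 \<Longrightarrow> 0 \<le> r \<Longrightarrow> measure uniform_sphere (cball x r) \<le> C * r ^ n"
    using uniform_sphere_cball_upper[where 'd='d] unfolding n_def by blast
  have "far_prob TYPE('d) \<rho> / \<rho> ^ (n * n) \<le> (C * 2 ^ n) ^ n" if \<rho>: "\<rho> > 0" for \<rho>
  proof -
    have "AE x in uniform_sphere. ?e \<bullet> x \<noteq> 1"
      by (rule AE_uniform_sphere_not_hyperplane[OF dim]) (simp add: axis_eq_0_iff)
    then have ae1: "AE x in uniform_sphere. norm x = 1 \<and> x \<bullet> ?e \<noteq> 1"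
      using AE_uniform_sphere by eventually_elim (auto simp: inner_commute)
    have "emeasure dtuple {p \<in> space (dtuple :: ('d \<Rightarrow> real ^ 'd) measure). far_hyperplane \<rho> p}
       \<le> (\<integral>\<^sup>+x. (\<Prod>k\<in>UNIV - {i}. indicator (cball ?e (2 * \<rho>)) (x k)) \<partial>PiM (UNIV - {i}) (\<lambda>_. uniform_sphere))"
      unfolding emeasure_far_hyperplane[OF dim \<rho>, of i]
    proof (rule nn_integral_mono_AE)
      show "AE x in PiM (UNIV - {i}) (\<lambda>_. uniform_sphere).
         indicator {v. unit_solvable i v} (\<lambda>k\<in>UNIV - {i}. stereo ?e (x k) /\<^sub>R (1 / \<rho>))
         \<le> (\<Prod>k\<in>UNIV - {i}. indicator (cball ?e (2 * \<rho>)) (x k) :: ennreal)"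
        using AE_PiM_uniform_sphere_component[OF finite ae1, of "UNIV - {i}"]
      proof eventually_elim
        fix x :: "'d \<Rightarrow> real ^ 'd" assume x: "\<forall>k\<in>UNIV - {i}. norm (x k) = 1 \<and> x k \<bullet> ?e \<noteq> 1"
        show "indicator {v. unit_solvable i v} (\<lambda>k\<in>UNIV - {i}. stereo ?e (x k) /\<^sub>R (1 / \<rho>))
         \<le> (\<Prod>k\<in>UNIV - {i}. indicator (cball ?e (2 * \<rho>)) (x k) :: ennreal)"
        proof (cases "unit_solvable i (\<lambda>k\<in>UNIV - {i}. stereo ?e (x k) /\<^sub>R (1 / \<rho>))")
          case True
          then obtain u where u: "norm u \<le> 1" and uk: "\<And>k. k \<noteq> i \<Longrightarrow> u \<bullet> (stereo ?e (x k) /\<^sub>R (1 / \<rho>)) = 1"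
            unfolding unit_solvable_iff by (auto simp del: inner_scaleR_right)
          have "x k \<in> cball ?e (2 * \<rho>)" if k: "k \<noteq> i" for k
          proof -
            have "1 \<le> norm u * norm (stereo ?e (x k) /\<^sub>R (1 / \<rho>))"
              using norm_cauchy_schwarz[of u "stereo ?e (x k) /\<^sub>R (1 / \<rho>)"] uk[OF k] by linarith
            also have "\<dots> \<le> 1 * norm (stereo ?e (x k) /\<^sub>R (1 / \<rho>))" using u by (intro mult_right_mono) auto
            finally have "1 / \<rho> \<le> norm (stereo ?e (x k))" using \<rho> by (simp add: field_simps)
            from stereo_norm_ge_imp_near[OF _ e1 _ _ this] x k \<rho> show ?thesis by simp
          qed
          then have "(\<Prod>k\<in>UNIV - {i}. indicator (cball ?e (2 * \<rho>)) (x k) :: ennreal) = 1"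
            by (intro prod.neutral) auto
          then show ?thesis by (simp add: indicator_def)
        qed simp
      qed
    qed
    also have "\<dots> = (\<Prod>k\<in>UNIV - {i}. \<integral>\<^sup>+y. indicator (cball ?e (2 * \<rho>)) y \<partial>uniform_sphere)"
      by (rule sph.product_nn_integral_prod) (auto intro!: borel_measurable_indicator)
    also have "\<dots> = ennreal (measure uniform_sphere (cball ?e (2 * \<rho>)) ^ n)"
      by (simp add: cn sph1.emeasure_eq_measure ennreal_power)
    finally have "far_prob TYPE('d) \<rho> \<le> measure uniform_sphere (cball ?e (2 * \<rho>)) ^ n"
      unfolding emeasure_eq_measure far_prob_def by simp
    also have "\<dots> \<le> (C * (2 * \<rho>) ^ n) ^ n"
      using C(2)[OF e1, of "2 * \<rho>"] \<rho> by (intro power_mono) auto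
    also have "\<dots> = (C * 2 ^ n) ^ n * \<rho> ^ (n * n)"
      by (simp add: power_mult_distrib power_mult)
    finally show ?thesis using \<rho> by (simp add: pos_divide_le_eq)
  qed
  then show ?thesis by blast
qed

text \<open>Otherwise almost every tuple would avoid the events for all positive integers
  \<open>\<rho>\<close>; but almost surely a normal \<open>w\<close> exists, and its norm is below
  some integer.\<close>

lemma far_prob_positive:
  assumes dim: "CARD('d::finite) \<ge> 2"
  shows "\<exists>\<rho>>0. far_prob TYPE('d) \<rho> > 0"
proof (rule ccontr)
  interpret prob_space "dtuple :: ('d \<Rightarrow> real ^ 'd) measure" by (rule prob_space_PiM_uniform_sphere)
  assume neg: "\<not> ?thesis"
  have "far_prob TYPE('d) (real (Suc N)) = 0" for N
  proof -
    have "\<not> far_prob TYPE('d) (real (Suc N)) > 0" using neg of_nat_0_less_iff[of "Suc N"] by blast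
    moreover have "far_prob TYPE('d) (real (Suc N)) \<ge> 0" by (simp add: far_prob_def)
    ultimately show ?thesis by linarith
  qed
  then have "AE p in (dtuple :: ('d \<Rightarrow> real ^ 'd) measure). \<not> far_hyperplane (real (Suc N)) p" for N
    unfolding far_prob_def by (subst AE_iff_measurable[OF _ refl]) (auto simp: emeasure_eq_measure)
  then have "AE p in (dtuple :: ('d \<Rightarrow> real ^ 'd) measure). \<forall>N. \<not> far_hyperplane (real (Suc N)) p"
    by (subst AE_all_countable) blast
  moreover have "AE p in (dtuple :: ('d \<Rightarrow> real ^ 'd) measure). \<exists>w. \<forall>k. w \<bullet> p k = 1"
    by (rule AE_hyperplane_not_through_origin[OF dim])
  ultimately have "AE p in (dtuple :: ('d \<Rightarrow> real ^ 'd) measure). False"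
  proof eventually_elim
    fix p :: "'d \<Rightarrow> real ^ 'd"
    assume N: "\<forall>N. \<not> far_hyperplane (real (Suc N)) p" and "\<exists>w. \<forall>k. w \<bullet> p k = 1"
    then obtain w where w: "\<forall>k. w \<bullet> p k = 1" by blast
    obtain N :: nat where "norm w \<le> real N" using real_arch_simple by blast
    also have "real N \<le> sqrt (1 + (real (Suc N))\<^sup>2)" by (rule real_le_rsqrt) (simp add: power2_eq_square algebra_simps)
    finally show False using N w unfolding far_hyperplane_def by blast
  qed
  then show False by simp
qed

lemma far_prob_asymptotics:
  assumes dim: "CARD('d::finite) \<ge> 2"
  defines "n \<equiv> CARD('d) - 1"
  shows "\<exists>K>0. ((\<lambda>\<rho>. far_prob TYPE('d) \<rho> / \<rho> ^ (n * n)) \<longlongrightarrow> K) (at_right 0) \<and>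
    (\<forall>\<rho>>0. far_prob TYPE('d) \<rho> / \<rho> ^ (n * n) \<le> K)"
proof -
  obtain B where B: "\<And>\<rho>. \<rho> > 0 \<Longrightarrow> far_prob TYPE('d) \<rho> / \<rho> ^ (n * n) \<le> B"
    using far_prob_bounded[OF dim] unfolding n_def by blast
  obtain K where K: "((\<lambda>\<rho>. far_prob TYPE('d) \<rho> / \<rho> ^ (n * n)) \<longlongrightarrow> K) (at_right 0)"
    "\<And>\<rho>. \<rho> > 0 \<Longrightarrow> far_prob TYPE('d) \<rho> / \<rho> ^ (n * n) \<le> K"
    using tendsto_at_right_0_antimono[of "\<lambda>\<rho>. far_prob TYPE('d) \<rho> / \<rho> ^ (n * n)", OF _ B]
      far_prob_scaling_mono[OF dim, folded n_def] by blast
  obtain \<rho> where "\<rho> > 0" "far_prob TYPE('d) \<rho> > 0" using far_prob_positive[OF dim] by blast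
  then have "0 < far_prob TYPE('d) \<rho> / \<rho> ^ (n * n)" by simp
  then have "K > 0" using K(2)[OF \<open>\<rho> > 0\<close>] by linarith
  with K show ?thesis by blast
qed

text \<open>The cap whose angular radius has tangent \<open>\<rho>\<close>, the parametrisation
  matching \<open>far_hyperplane\<close>. By rotation invariance the choice of the axis is
  immaterial.\<close>

definition cap_mass :: "'d::finite itself \<Rightarrow> real \<Rightarrow> real" where
  "cap_mass _ \<rho> = measure (uniform_sphere :: (real ^ 'd) measure) {x. 1 \<le> (sqrt (1 + \<rho>\<^sup>2) *\<^sub>R axis undefined 1) \<bullet> x}"

lemma measure_cap_norm_cong:
  fixes v w :: "real ^ 'd::finite"
  assumes "norm v = norm w"
  shows "measure uniform_sphere {x. b \<le> v \<bullet> x} = measure uniform_sphere {x. b \<le> w \<bullet> x}"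
proof -
  obtain T :: "real ^ 'd \<Rightarrow> real ^ 'd" where T: "orthogonal_transformation T" "T v = w"
    using orthogonal_transformation_exists[OF assms] by metis
  have "{x. b \<le> w \<bullet> x} \<in> sets borel" by measurable
  from measure_uniform_sphere_orthogonal[OF T(1) this]
  have "measure uniform_sphere (T -` {x. b \<le> w \<bullet> x}) = measure uniform_sphere {x. b \<le> w \<bullet> x}" .
  moreover have "T -` {x. b \<le> w \<bullet> x} = {x. b \<le> v \<bullet> x}"
    by (simp add: vimage_def T(2)[symmetric] orthogonal_transformation_inner[OF T(1)])
  ultimately show ?thesis by simp
qed

lemma cap_mass_eq:
  fixes w :: "real ^ 'd::finite"
  assumes "norm w = sqrt (1 + \<rho>\<^sup>2)"
  shows "measure uniform_sphere {x. 1 \<le> w \<bullet> x} = cap_mass TYPE('d) \<rho>"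
  unfolding cap_mass_def using assms by (intro measure_cap_norm_cong) simp

lemma cap_mass_mono:
  assumes "0 \<le> \<rho>" "\<rho> \<le> \<rho>'"
  shows "cap_mass TYPE('d::finite) \<rho> \<le> cap_mass TYPE('d) \<rho>'"
proof -
  let ?e = "axis undefined 1 :: real ^ 'd"
  have le: "sqrt (1 + \<rho>\<^sup>2) \<le> sqrt (1 + \<rho>'\<^sup>2)" using assms by (simp add: power_mono)
  have pos: "sqrt (1 + \<rho>\<^sup>2) > 0" by (simp add: add_pos_nonneg)
  have "{x. 1 \<le> (sqrt (1 + \<rho>\<^sup>2) *\<^sub>R ?e) \<bullet> x} \<subseteq> {x. 1 \<le> (sqrt (1 + \<rho>'\<^sup>2) *\<^sub>R ?e) \<bullet> x}"
  proof
    fix x assume x: "x \<in> {x. 1 \<le> (sqrt (1 + \<rho>\<^sup>2) *\<^sub>R ?e) \<bullet> x}"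
    then have "0 < sqrt (1 + \<rho>\<^sup>2) * (?e \<bullet> x)" by simp
    then have "0 < ?e \<bullet> x" using pos by (simp add: zero_less_mult_iff)
    then have "sqrt (1 + \<rho>\<^sup>2) * (?e \<bullet> x) \<le> sqrt (1 + \<rho>'\<^sup>2) * (?e \<bullet> x)" using le by (intro mult_right_mono) auto
    then show "x \<in> {x. 1 \<le> (sqrt (1 + \<rho>'\<^sup>2) *\<^sub>R ?e) \<bullet> x}" using x by simp
  qed
  then show ?thesis unfolding cap_mass_def by (intro sph1.finite_measure_mono) auto
qed

text \<open>The caps of \<open>w\<close> and \<open>- w\<close> are disjoint and equally heavy. So
  for a threshold below one half only the side away from the origin can count as small.\<close>

lemma measure_cap_le_half:
  fixes w :: "real ^ 'd::finite"
  shows "measure uniform_sphere {x. 1 \<le> w \<bullet> x} \<le> 1 / 2"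
proof -
  have eq: "measure uniform_sphere {x. 1 \<le> (- w) \<bullet> x} = measure uniform_sphere {x. 1 \<le> w \<bullet> x}"
    by (rule measure_cap_norm_cong) simp
  have "measure uniform_sphere ({x. 1 \<le> w \<bullet> x} \<union> {x. 1 \<le> (- w) \<bullet> x})
     = measure uniform_sphere {x. 1 \<le> w \<bullet> x} + measure uniform_sphere {x. 1 \<le> (- w) \<bullet> x}"
    by (rule sph1.finite_measure_Union) auto
  moreover have "measure uniform_sphere ({x. 1 \<le> w \<bullet> x} \<union> {x. 1 \<le> (- w) \<bullet> x}) \<le> 1"
    by (rule sph1.prob_le_1)
  ultimately show ?thesis using eq by linarith
qed

text \<open>The cap is placed so that the pole lies on its boundary, with normal
  \<open>e + \<rho> *\<^sub>R b\<close> for a second basis vector \<open>b\<close>. The chart then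
  turns it into a half-space; the inequality keeps its direction because
  \<open>1 - e \<bullet> x > 0\<close> almost everywhere on the sphere.\<close>

lemma cap_mass_stereo:
  fixes i j :: "'d::finite"
  assumes dim: "CARD('d) \<ge> 2" and ij: "i \<noteq> j" and \<rho>: "\<rho> > 0"
  shows "ennreal (cap_mass TYPE('d) \<rho>)
    = (\<integral>\<^sup>+x. indicator {v :: real ^ 'd. 1 \<le> axis j 1 \<bullet> v} (stereo (axis i 1) x /\<^sub>R (1 / \<rho>)) \<partial>uniform_sphere)"
proof -
  let ?e = "axis i 1 :: real ^ 'd" and ?b = "axis j 1 :: real ^ 'd"
  have be: "?b \<bullet> ?e = 0" using ij by (simp add: inner_axis_axis)
  have "norm (?e + \<rho> *\<^sub>R ?b) = sqrt (1 + \<rho>\<^sup>2)"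
  proof -
    have "(norm (1 *\<^sub>R ?e + \<rho> *\<^sub>R ?b))\<^sup>2 = 1\<^sup>2 + (norm (\<rho> *\<^sub>R ?b))\<^sup>2"
      by (rule norm_axis_add_perp) (simp_all add: be)
    then have "(norm (?e + \<rho> *\<^sub>R ?b))\<^sup>2 = 1 + \<rho>\<^sup>2" by (simp add: power_mult_distrib)
    then show ?thesis by (metis norm_ge_zero real_sqrt_unique)
  qed
  from cap_mass_eq[OF this]
  have "ennreal (cap_mass TYPE('d) \<rho>) = emeasure uniform_sphere {x. 1 \<le> (?e + \<rho> *\<^sub>R ?b) \<bullet> x}"
    by (simp add: sph1.emeasure_eq_measure)
  also have "\<dots> = (\<integral>\<^sup>+x. indicator {x. 1 \<le> (?e + \<rho> *\<^sub>R ?b) \<bullet> x} x \<partial>uniform_sphere)" by simp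
  also have "\<dots> = (\<integral>\<^sup>+x. indicator {v. 1 \<le> ?b \<bullet> v} (stereo ?e x /\<^sub>R (1 / \<rho>)) \<partial>uniform_sphere)"
  proof (rule nn_integral_cong_AE)
    have "AE x in uniform_sphere. ?e \<bullet> x \<noteq> 1"
      by (rule AE_uniform_sphere_not_hyperplane[OF dim]) (simp add: axis_eq_0_iff)
    then show "AE x in uniform_sphere. indicator {x. 1 \<le> (?e + \<rho> *\<^sub>R ?b) \<bullet> x} x
      = (indicator {v. 1 \<le> ?b \<bullet> v} (stereo ?e x /\<^sub>R (1 / \<rho>)) :: ennreal)"
      using AE_uniform_sphere
    proof eventually_elim
      fix x :: "real ^ 'd" assume ne: "?e \<bullet> x \<noteq> 1" and x: "x \<in> sphere 0 1"
      have "?e \<bullet> x \<le> 1" using norm_cauchy_schwarz[of ?e x] x by simp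
      then have pos: "1 - ?e \<bullet> x > 0" using ne by simp
      have "?b \<bullet> (stereo ?e x /\<^sub>R (1 / \<rho>)) = \<rho> * (?b \<bullet> x) / (1 - ?e \<bullet> x)"
        by (simp add: stereo_def inner_diff_right be inner_commute[of x])
      then have "1 \<le> ?b \<bullet> (stereo ?e x /\<^sub>R (1 / \<rho>)) \<longleftrightarrow> 1 - ?e \<bullet> x \<le> \<rho> * (?b \<bullet> x)"
        using pos by (simp only: pos_le_divide_eq mult_1)
      also have "\<dots> \<longleftrightarrow> 1 \<le> (?e + \<rho> *\<^sub>R ?b) \<bullet> x"
        unfolding inner_add_left inner_scaleR_left by linarith
      finally show "indicator {x. 1 \<le> (?e + \<rho> *\<^sub>R ?b) \<bullet> x} x
        = (indicator {v. 1 \<le> ?b \<bullet> v} (stereo ?e x /\<^sub>R (1 / \<rho>)) :: ennreal)"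
        by (simp only: indicator_def mem_Collect_eq)
    qed
  qed
  finally show ?thesis .
qed

text \<open>Again a quantity monotone in the scale of the chart, here with one point. It is bounded
  because a point of the half-space has chart norm at least \<open>1 / \<rho>\<close>, hence lies
  within \<open>2 * \<rho>\<close> of the pole.\<close>

lemma cap_mass_asymptotics:
  assumes dim: "CARD('d::finite) \<ge> 2"
  defines "n \<equiv> CARD('d) - 1"
  shows "\<exists>\<kappa>>0. ((\<lambda>\<rho>. cap_mass TYPE('d) \<rho> / \<rho> ^ n) \<longlongrightarrow> \<kappa>) (at_right 0) \<and>
    (\<forall>\<rho>>0. cap_mass TYPE('d) \<rho> / \<rho> ^ n \<le> \<kappa>)"
proof -
  define i :: 'd where "i = undefined"
  have "card (UNIV - {i}) \<noteq> 0" using dim by (simp add: card_Diff_singleton)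
  then have "UNIV - {i} \<noteq> {}" by (metis card.empty)
  then obtain j where "j \<in> UNIV - {i}" by (auto simp only: ex_in_conv[symmetric])
  then have ij: "i \<noteq> j" by auto
  let ?e = "axis i 1 :: real ^ 'd" and ?b = "axis j 1 :: real ^ 'd"
  have e1: "norm ?e = 1" by simp
  have mono: "cap_mass TYPE('d) \<rho>' / \<rho>' ^ n \<le> cap_mass TYPE('d) \<rho> / \<rho> ^ n" if \<rho>: "0 < \<rho>" "\<rho> \<le> \<rho>'" for \<rho> \<rho>'
  proof -
    have \<rho>': "\<rho>' > 0" using \<rho> by simp
    have eB: "?e \<in> Basis" by (simp add: axis_in_Basis_iff)
    have D: "DIM(real ^ 'd) \<ge> 2" using dim by simp
    have R: "0 < 1 / \<rho>'" "1 / \<rho>' \<le> 1 / \<rho>" using \<rho> \<rho>' by (auto intro: divide_left_mono)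
    have m: "indicator {v :: real ^ 'd. 1 \<le> ?b \<bullet> v} \<in> borel_measurable borel"
      by (rule borel_measurable_indicator) measurable
    have "ennreal ((1 / \<rho>') ^ n) * ennreal (cap_mass TYPE('d) \<rho>') \<le> ennreal ((1 / \<rho>) ^ n) * ennreal (cap_mass TYPE('d) \<rho>)"
      using stereo_scaling_mono[OF eB D m R]
      unfolding cap_mass_stereo[OF dim ij \<rho>(1)] cap_mass_stereo[OF dim ij \<rho>'] by (simp add: n_def)
    then have "ennreal ((1 / \<rho>') ^ n * cap_mass TYPE('d) \<rho>') \<le> ennreal ((1 / \<rho>) ^ n * cap_mass TYPE('d) \<rho>)"
      using \<rho> \<rho>' by (simp add: ennreal_mult cap_mass_def)
    then show ?thesis
      using \<rho> by (subst (asm) ennreal_le_iff) (auto simp: cap_mass_def power_one_over field_simps)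
  qed
  obtain C where C: "C > 0" "\<And>x r. norm (x :: real ^ 'd) = 1 \<Longrightarrow> 0 \<le> r \<Longrightarrow> measure uniform_sphere (cball x r) \<le> C * r ^ n"
    using uniform_sphere_cball_upper[where 'd='d] unfolding n_def by blast
  have bound: "cap_mass TYPE('d) \<rho> / \<rho> ^ n \<le> C * 2 ^ n" if \<rho>: "\<rho> > 0" for \<rho>
  proof -
    have "ennreal (cap_mass TYPE('d) \<rho>) \<le> (\<integral>\<^sup>+x. indicator (cball ?e (2 * \<rho>)) x \<partial>uniform_sphere)"
      unfolding cap_mass_stereo[OF dim ij \<rho>]
    proof (rule nn_integral_mono_AE)
      have "AE x in uniform_sphere. ?e \<bullet> x \<noteq> 1"
        by (rule AE_uniform_sphere_not_hyperplane[OF dim]) (simp add: axis_eq_0_iff)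
      then show "AE x in uniform_sphere. indicator {v. 1 \<le> ?b \<bullet> v} (stereo ?e x /\<^sub>R (1 / \<rho>))
         \<le> (indicator (cball ?e (2 * \<rho>)) x :: ennreal)"
        using AE_uniform_sphere
      proof eventually_elim
        fix x :: "real ^ 'd" assume ne: "?e \<bullet> x \<noteq> 1" and x: "x \<in> sphere 0 1"
        show "indicator {v. 1 \<le> ?b \<bullet> v} (stereo ?e x /\<^sub>R (1 / \<rho>)) \<le> (indicator (cball ?e (2 * \<rho>)) x :: ennreal)"
        proof (cases "1 \<le> ?b \<bullet> (stereo ?e x /\<^sub>R (1 / \<rho>))")
          case True
          then have "1 \<le> norm (stereo ?e x /\<^sub>R (1 / \<rho>))"
            using norm_cauchy_schwarz[of ?b "stereo ?e x /\<^sub>R (1 / \<rho>)"] by simp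
          then have "1 / \<rho> \<le> norm (stereo ?e x)" using \<rho> by (simp add: field_simps)
          then have "x \<in> cball ?e (2 / (1 / \<rho>))"
            using ne x \<rho> by (intro stereo_norm_ge_imp_near) (auto simp: inner_commute)
          then show ?thesis by (simp add: indicator_def)
        qed simp
      qed
    qed
    also have "\<dots> = ennreal (measure uniform_sphere (cball ?e (2 * \<rho>)))"
      by (simp add: sph1.emeasure_eq_measure)
    finally have "cap_mass TYPE('d) \<rho> \<le> measure uniform_sphere (cball ?e (2 * \<rho>))" by simp
    also have "\<dots> \<le> C * (2 * \<rho>) ^ n" using \<rho> by (intro C(2)) auto
    finally show ?thesis using \<rho> by (simp add: power_mult_distrib pos_divide_le_eq)
  qed
  obtain \<kappa> where \<kappa>: "((\<lambda>\<rho>. cap_mass TYPE('d) \<rho> / \<rho> ^ n) \<longlongrightarrow> \<kappa>) (at_right 0)"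
    "\<And>\<rho>. \<rho> > 0 \<Longrightarrow> cap_mass TYPE('d) \<rho> / \<rho> ^ n \<le> \<kappa>"
    using tendsto_at_right_0_antimono[of "\<lambda>\<rho>. cap_mass TYPE('d) \<rho> / \<rho> ^ n", OF mono bound] by blast
  \<comment> \<open>The cap with normal \<open>?e + ?b\<close> contains the two distinct basis
    vectors, so the lower bound for caps applies with them as the two points.\<close>
  have "cap_mass TYPE('d) 1 > 0"
  proof -
    obtain c where c: "c > 0" and cap: "\<And>(a :: real ^ 'd) b y z. a \<noteq> 0 \<Longrightarrow> norm y = 1 \<Longrightarrow> norm z = 1 \<Longrightarrow> b \<le> a \<bullet> y \<Longrightarrow> b \<le> a \<bullet> z \<Longrightarrow>
       c * dist y z ^ (CARD('d) - 1) \<le> measure uniform_sphere {x. b \<le> a \<bullet> x}"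
      using uniform_sphere_cap_lower[OF dim] by blast
    have ny: "norm (?e + ?b) = sqrt 2"
    proof -
      have "?b \<bullet> ?e = 0" using ij by (simp add: inner_axis_axis)
      then have "(norm (1 *\<^sub>R ?e + ?b))\<^sup>2 = 1\<^sup>2 + (norm ?b)\<^sup>2" by (intro norm_axis_add_perp) simp_all
      then have "(norm (?e + ?b))\<^sup>2 = 2" by simp
      then show ?thesis by (metis norm_ge_zero real_sqrt_unique)
    qed
    have eb: "(?e + ?b) \<bullet> ?e = 1" "(?e + ?b) \<bullet> ?b = 1"
      using ij by (simp_all add: inner_add_left inner_axis_axis)
    have "c * dist ?e ?b ^ (CARD('d) - 1) \<le> measure uniform_sphere {x. 1 \<le> (?e + ?b) \<bullet> x}"
      by (rule cap) (use ny eb in auto)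
    moreover have "dist ?e ?b > 0" using ij by (simp add: axis_eq_axis)
    then have "0 < c * dist ?e ?b ^ (CARD('d) - 1)" using c by simp
    moreover have "measure uniform_sphere {x. 1 \<le> (?e + ?b) \<bullet> x} = cap_mass TYPE('d) 1"
      by (rule cap_mass_eq) (simp add: ny)
    ultimately show ?thesis by linarith
  qed
  then have "\<kappa> > 0" using \<kappa>(2)[of 1] by simp
  with \<kappa> show ?thesis by blast
qed

text \<open>For \<open>\<epsilon> = 1\<close> and \<open>\<epsilon> = - 1\<close> these are the two open sides of the hyperplane through the \<open>p k\<close>.\<close>

definition side :: "'d \<Rightarrow> real \<Rightarrow> ('d \<Rightarrow> real ^ 'd::finite) \<Rightarrow> (real ^ 'd) set" where
  "side i \<epsilon> p = {y. 0 < \<epsilon> * (nrm i p \<bullet> (y - p i))}"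

definition side_mass :: "'d \<Rightarrow> real \<Rightarrow> ('d \<Rightarrow> real ^ 'd::finite) \<Rightarrow> real" where
  "side_mass i \<epsilon> p = measure uniform_sphere (side i \<epsilon> p)"

lemma sets_side [measurable]: "side i \<epsilon> p \<in> sets borel"
  unfolding side_def by measurable

lemma borel_measurable_side_mass:
  assumes P [measurable]: "\<And>k. (\<lambda>x. P x k) \<in> borel_measurable M"
  shows "(\<lambda>x. side_mass i \<epsilon> (P x)) \<in> borel_measurable M"
proof -
  have [measurable]: "(\<lambda>x. nrm i (P x)) \<in> borel_measurable M" by (rule borel_measurable_nrm) (rule P)
  have "(\<lambda>x. emeasure uniform_sphere (side i \<epsilon> (P x))) \<in> borel_measurable M"
  proof (rule sph1.measurable_emeasure)
    show "{x \<in> space (M \<Otimes>\<^sub>M uniform_sphere). snd x \<in> side i \<epsilon> (P (fst x))} \<in> sets (M \<Otimes>\<^sub>M uniform_sphere)"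
      unfolding side_def mem_Collect_eq by measurable
  qed auto
  then show ?thesis
    unfolding side_mass_def measure_def by simp
qed

lemma side_mass_nonneg: "0 \<le> side_mass i \<epsilon> p" and side_mass_le_1: "side_mass i \<epsilon> p \<le> 1"
  unfolding side_mass_def by auto

lemma uniform_sphere_open_halfspace:
  fixes a :: "real ^ 'd::finite"
  assumes dim: "CARD('d) \<ge> 2" and a: "a \<noteq> 0"
  shows "measure uniform_sphere {x. b < a \<bullet> x} = measure uniform_sphere {x. b \<le> a \<bullet> x}"
  by (rule sph1.finite_measure_eq_AE)
     (use AE_uniform_sphere_not_hyperplane[OF dim a, of b] in \<open>auto elim!: eventually_mono\<close>)

lemma one_minus_side_mass:
  "1 - side_mass i \<epsilon> p = measure uniform_sphere {y. 0 \<le> - \<epsilon> * (nrm i p \<bullet> (y - p i))}"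
proof -
  have "measure uniform_sphere (space uniform_sphere - side i \<epsilon> p) = 1 - side_mass i \<epsilon> p"
    unfolding side_mass_def by (rule sph1.prob_compl) simp
  moreover have "space uniform_sphere - side i \<epsilon> p = {y. 0 \<le> - \<epsilon> * (nrm i p \<bullet> (y - p i))}"
    by (auto simp: side_def not_less)
  ultimately show ?thesis by simp
qed

text \<open>The vectors \<open>nrm i p\<close> and \<open>w\<close> are parallel, but the sign of
  the factor is unknown. Summing over both sides removes this ambiguity: the complements have masses
  \<open>G\<close> and \<open>1 - G\<close> in some order.\<close>

lemma side_masses_of_hyperplane:
  fixes p :: "'d \<Rightarrow> real ^ 'd::finite"
  assumes dim: "CARD('d) \<ge> 2" and n: "nrm i p \<noteq> 0" and w: "\<And>k. w \<bullet> p k = 1"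
  defines "G \<equiv> measure uniform_sphere {x. 1 \<le> w \<bullet> x}"
  shows "(\<Sum>\<epsilon>\<in>{1, - 1}. indicator {..t} (1 - side_mass i \<epsilon> p)) = (indicator {..t} G + indicator {..t} (1 - G) :: real)"
proof -
  obtain c where c: "w = c *\<^sub>R nrm i p" "1 = c * (nrm i p \<bullet> p i)"
    using hyperplane_imp_multiple_nrm[OF n w] .
  have c0: "c \<noteq> 0" using c(2) by auto
  have w0: "w \<noteq> 0" using c0 n c(1) by simp
  have wy: "w \<bullet> y - 1 = c * (nrm i p \<bullet> (y - p i))" for y
    by (simp add: c inner_diff_right right_diff_distrib)
  have le: "measure uniform_sphere {x. w \<bullet> x \<le> 1} = 1 - G"
  proof -
    have "measure uniform_sphere (space uniform_sphere - {x. 1 < w \<bullet> x}) = 1 - measure uniform_sphere {x. 1 < w \<bullet> x}"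
      by (rule sph1.prob_compl) simp
    moreover have "space uniform_sphere - {x. 1 < w \<bullet> x} = {x. w \<bullet> x \<le> 1}" by auto
    ultimately show ?thesis using uniform_sphere_open_halfspace[OF dim w0, of 1] by (simp add: G_def)
  qed
  have eq: "{y. 0 \<le> s * (nrm i p \<bullet> (y - p i))} = (if s * c > 0 then {x. 1 \<le> w \<bullet> x} else {x. w \<bullet> x \<le> 1})"
    if s: "s \<noteq> 0" for s
  proof -
    have "0 \<le> s * (nrm i p \<bullet> (y - p i)) \<longleftrightarrow> (if s * c > 0 then 1 \<le> w \<bullet> y else w \<bullet> y \<le> 1)" for y
    proof -
      define q where "q = s / c"
      have q: "s * (nrm i p \<bullet> (y - p i)) = q * (w \<bullet> y - 1)" using c0 by (simp add: wy q_def)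
      have "q \<noteq> 0" "q > 0 \<longleftrightarrow> s * c > 0"
        using s c0 by (auto simp: q_def zero_less_divide_iff zero_less_mult_iff)
      then show ?thesis unfolding q by (auto simp: zero_le_mult_iff)
    qed
    then show ?thesis by auto
  qed
  have m: "1 - side_mass i \<epsilon> p = (if - \<epsilon> * c > 0 then G else 1 - G)" if "\<epsilon> \<noteq> 0" for \<epsilon>
    unfolding one_minus_side_mass using eq[of "- \<epsilon>"] that le by (auto simp: G_def)
  show ?thesis using m[of 1] m[of "- 1"] c0 by (cases "c > 0") auto
qed

text \<open>\<open>1 - side_mass\<close> is the mass of the closed side opposite to
  \<open>side\<close>, the cap that stays empty at a facet. The value is an expected number of sides
  rather than a probability, hence the bound 2.\<close>

definition small_cap_count :: "'d::finite itself \<Rightarrow> real \<Rightarrow> real" where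
  "small_cap_count _ t = (\<Sum>\<epsilon>\<in>{1, - 1}. measure (dtuple :: ('d \<Rightarrow> real ^ 'd) measure)
     {p \<in> space dtuple. 1 - side_mass undefined \<epsilon> p \<le> t})"

lemma measurable_side_mass_dtuple [measurable]:
  "side_mass i \<epsilon> \<in> borel_measurable (dtuple :: ('d \<Rightarrow> real ^ 'd::finite) measure)"
  using borel_measurable_side_mass[of "\<lambda>x. x" "dtuple :: ('d \<Rightarrow> real ^ 'd) measure" i \<epsilon>] by simp

text \<open>Let \<open>r\<close> be the tangent of the angular radius cut off by the hyperplane.
  Being far means \<open>r \<le> \<rho>\<close> and having a small side means
  \<open>cap_mass r \<le> t\<close>; as \<open>cap_mass\<close> is monotone, one event contains the
  other. Two one-sided comparisons replace an inversion of \<open>cap_mass\<close>.\<close>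

lemma small_cap_count_far_prob:
  assumes dim: "CARD('d::finite) \<ge> 2" and t: "0 < t" "t < 1 / 2" and \<rho>: "\<rho> > 0"
  shows "cap_mass TYPE('d) \<rho> \<le> t \<Longrightarrow> far_prob TYPE('d) \<rho> \<le> small_cap_count TYPE('d) t"
    and "t < cap_mass TYPE('d) \<rho> \<Longrightarrow> small_cap_count TYPE('d) t \<le> far_prob TYPE('d) \<rho>"
proof -
  interpret prob_space "dtuple :: ('d \<Rightarrow> real ^ 'd) measure" by (rule prob_space_PiM_uniform_sphere)
  let ?i = "undefined :: 'd"
  let ?f = "\<lambda>p :: 'd \<Rightarrow> real ^ 'd. indicator {p. far_hyperplane \<rho> p} p :: real"
  let ?g = "\<lambda>p :: 'd \<Rightarrow> real ^ 'd. \<Sum>\<epsilon>\<in>{1, - 1}. indicator {..t} (1 - side_mass ?i \<epsilon> p) :: real"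
  have int1: "integrable dtuple (\<lambda>p :: 'd \<Rightarrow> real ^ 'd. indicator {..t} (1 - side_mass ?i \<epsilon> p) :: real)" for \<epsilon>
    by (auto intro!: integrable_const_bound[where B=1] simp: indicator_def)
  have I: "integrable dtuple ?f" "integrable dtuple ?g"
  proof -
    show "integrable dtuple ?f"
    proof (rule integrable_const_bound[where B=1])
      show "?f \<in> borel_measurable dtuple"
        unfolding indicator_def mem_Collect_eq of_bool_def by measurable
    qed simp
    show "integrable dtuple ?g" by (rule Bochner_Integration.integrable_sum) (rule int1)
  qed
  have far: "far_prob TYPE('d) \<rho> = (\<integral>p. ?f p \<partial>dtuple)"
  proof -
    have "(\<integral>p. ?f p \<partial>dtuple) = (\<integral>p. indicat_real {p \<in> space dtuple. far_hyperplane \<rho> p} p \<partial>(dtuple :: ('d \<Rightarrow> real ^ 'd) measure))"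
      by (rule Bochner_Integration.integral_cong) (auto simp: indicator_def)
    then show ?thesis by (simp add: far_prob_def)
  qed
  have cnt: "small_cap_count TYPE('d) t = (\<integral>p. ?g p \<partial>dtuple)"
  proof -
    have "(\<integral>p. indicator {..t} (1 - side_mass ?i \<epsilon> p) \<partial>(dtuple :: ('d \<Rightarrow> real ^ 'd) measure))
       = measure dtuple {p \<in> space dtuple. 1 - side_mass ?i \<epsilon> p \<le> t}" for \<epsilon>
    proof -
      have "(\<integral>p. (indicator {..t} (1 - side_mass ?i \<epsilon> p) :: real) \<partial>(dtuple :: ('d \<Rightarrow> real ^ 'd) measure))
        = (\<integral>p. indicator {p \<in> space dtuple. 1 - side_mass ?i \<epsilon> p \<le> t} p \<partial>dtuple)"
        by (rule Bochner_Integration.integral_cong) (auto simp: indicator_def)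
      then show ?thesis by simp
    qed
    then show ?thesis unfolding small_cap_count_def
      by (subst Bochner_Integration.integral_sum) (auto intro: int1)
  qed
  have ae: "AE p in (dtuple :: ('d \<Rightarrow> real ^ 'd) measure). nrm ?i p \<noteq> 0 \<and> (\<exists>w. \<forall>k. w \<bullet> p k = 1) \<and> (\<forall>k. norm (p k) = 1)"
  proof -
    have "AE p in (dtuple :: ('d \<Rightarrow> real ^ 'd) measure). \<forall>k\<in>UNIV. p k \<in> sphere 0 1"
      by (rule AE_PiM_uniform_sphere_component[OF finite AE_uniform_sphere])
    with AE_nrm_nonzero[OF dim, of ?i] AE_hyperplane_not_through_origin[OF dim] show ?thesis
      by eventually_elim auto
  qed
  \<comment> \<open>Both integrands are functions of the single number \<open>r\<close>, because
    almost surely the normalised normal \<open>w\<close> is unique.\<close>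
  have key: "\<exists>r\<ge>0. (?f p = indicator {..\<rho>} r) \<and> (?g p = indicator {..t} (cap_mass TYPE('d) r))"
    if n: "nrm ?i p \<noteq> 0" and ex: "\<exists>w. \<forall>k. w \<bullet> p k = 1" and p1: "\<forall>k. norm (p k) = 1" for p :: "'d \<Rightarrow> real ^ 'd"
  proof -
    obtain w where w: "\<And>k. w \<bullet> p k = 1" using ex by blast
    have uniq: "v = w" if v: "\<And>k. v \<bullet> p k = 1" for v
    proof -
      obtain c where c: "w = c *\<^sub>R nrm ?i p" "1 = c * (nrm ?i p \<bullet> p ?i)" using hyperplane_imp_multiple_nrm[OF n w] .
      obtain c' where c': "v = c' *\<^sub>R nrm ?i p" "1 = c' * (nrm ?i p \<bullet> p ?i)" using hyperplane_imp_multiple_nrm[OF n v] .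
      have "(c - c') * (nrm ?i p \<bullet> p ?i) = 0" using c(2) c'(2) by (simp add: left_diff_distrib)
      moreover have "nrm ?i p \<bullet> p ?i \<noteq> 0" using c(2) by auto
      ultimately show ?thesis using c(1) c'(1) by simp
    qed
    have "1 \<le> norm w" using norm_cauchy_schwarz[of w "p ?i"] w[of ?i] p1 by simp
    then have w1: "1 \<le> (norm w)\<^sup>2" by (simp add: one_le_power)
    define r where "r = sqrt ((norm w)\<^sup>2 - 1)"
    have r: "r \<ge> 0" "norm w = sqrt (1 + r\<^sup>2)" using w1 by (simp_all add: r_def)
    have "far_hyperplane \<rho> p \<longleftrightarrow> norm w \<le> sqrt (1 + \<rho>\<^sup>2)"
      unfolding far_hyperplane_def using w uniq by metis
    also have "\<dots> \<longleftrightarrow> r \<le> \<rho>" using r \<rho> by (simp add: abs_le_square_iff[symmetric])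
    finally have f: "?f p = indicator {..\<rho>} r" by (simp add: indicator_def)
    have G: "measure uniform_sphere {x. 1 \<le> w \<bullet> x} = cap_mass TYPE('d) r" by (rule cap_mass_eq[OF r(2)])
    have "cap_mass TYPE('d) r \<le> 1 / 2" using measure_cap_le_half[of w] G by simp
    then have "indicator {..t} (1 - cap_mass TYPE('d) r) = (0::real)" using t by (simp add: indicator_def)
    moreover have "?g p = indicator {..t} (cap_mass TYPE('d) r) + indicator {..t} (1 - cap_mass TYPE('d) r)"
      using side_masses_of_hyperplane[OF dim n w, of t] unfolding G .
    ultimately have g: "?g p = indicator {..t} (cap_mass TYPE('d) r)" by simp
    show ?thesis using r(1) f g by blast
  qed
  {
    assume le: "cap_mass TYPE('d) \<rho> \<le> t"
    have "(\<integral>p. ?f p \<partial>dtuple) \<le> (\<integral>p. ?g p \<partial>dtuple)"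
    proof (rule integral_mono_AE[OF I], use ae in eventually_elim)
      fix p :: "'d \<Rightarrow> real ^ 'd"
      assume "nrm ?i p \<noteq> 0 \<and> (\<exists>w. \<forall>k. w \<bullet> p k = 1) \<and> (\<forall>k. norm (p k) = 1)"
      then obtain r where r: "r \<ge> 0" "?f p = indicator {..\<rho>} r" "?g p = indicator {..t} (cap_mass TYPE('d) r)"
        using key[of p] by blast
      show "?f p \<le> ?g p"
        unfolding r(2,3) using cap_mass_mono[OF r(1), of \<rho>, where 'd='d] le by (auto simp: indicator_def)
    qed
    then show "far_prob TYPE('d) \<rho> \<le> small_cap_count TYPE('d) t" unfolding far cnt .
  next
    assume gt: "t < cap_mass TYPE('d) \<rho>"
    have "(\<integral>p. ?g p \<partial>dtuple) \<le> (\<integral>p. ?f p \<partial>dtuple)"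
    proof (rule integral_mono_AE[OF I(2,1)], use ae in eventually_elim)
      fix p :: "'d \<Rightarrow> real ^ 'd"
      assume "nrm ?i p \<noteq> 0 \<and> (\<exists>w. \<forall>k. w \<bullet> p k = 1) \<and> (\<forall>k. norm (p k) = 1)"
      then obtain r where r: "r \<ge> 0" "?f p = indicator {..\<rho>} r" "?g p = indicator {..t} (cap_mass TYPE('d) r)"
        using key[of p] by blast
      show "?g p \<le> ?f p"
        unfolding r(2,3) using cap_mass_mono[of \<rho> r, where 'd='d] gt \<rho> by (cases "\<rho> \<le> r") (auto simp: indicator_def)
    qed
    then show "small_cap_count TYPE('d) t \<le> far_prob TYPE('d) \<rho>" unfolding far cnt .
  }
qed

text \<open>Sandwich with \<open>\<rho>\<close> defined by \<open>c * \<rho> ^ n = t\<close>. For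
  \<open>c = \<kappa>\<close> the global bound makes the cap at most \<open>t\<close>, which gives
  the lower estimate; for \<open>c < \<kappa>\<close> the cap eventually exceeds \<open>t\<close>,
  which gives the upper estimate \<open>K / c ^ n\<close>.\<close>

lemma small_cap_count_asymptotics:
  assumes dim: "CARD('d::finite) \<ge> 2"
  shows "\<exists>L>0. ((\<lambda>t. small_cap_count TYPE('d) t / t ^ (CARD('d) - 1)) \<longlongrightarrow> L) (at_right 0)"
proof -
  define n where "n = CARD('d) - 1"
  have n: "n > 0" using dim by (simp add: n_def)
  obtain K where K: "K > 0" and Klim: "((\<lambda>\<rho>. far_prob TYPE('d) \<rho> / \<rho> ^ (n * n)) \<longlongrightarrow> K) (at_right 0)"
    and Kle: "\<And>\<rho>. \<rho> > 0 \<Longrightarrow> far_prob TYPE('d) \<rho> / \<rho> ^ (n * n) \<le> K"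
    using far_prob_asymptotics[OF dim] unfolding n_def by blast
  obtain \<kappa> where \<kappa>: "\<kappa> > 0" and \<kappa>lim: "((\<lambda>\<rho>. cap_mass TYPE('d) \<rho> / \<rho> ^ n) \<longlongrightarrow> \<kappa>) (at_right 0)"
    and \<kappa>le: "\<And>\<rho>. \<rho> > 0 \<Longrightarrow> cap_mass TYPE('d) \<rho> / \<rho> ^ n \<le> \<kappa>"
    using cap_mass_asymptotics[OF dim] unfolding n_def by blast
  define L where "L = K / \<kappa> ^ n"
  \<comment> \<open>Solves \<open>c * \<rho> ^ n = t\<close>, so \<open>\<rho> ^ (n * n)\<close>
    equals \<open>(t / c) ^ n\<close>.\<close>
  define \<rho> where "\<rho> c t = root n (t / c)" for c t
  have \<rho>pos: "\<rho> c t > 0" and \<rho>pow: "\<rho> c t ^ n = t / c" if "c > 0" "t > 0" for c t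
    using that n by (simp_all add: \<rho>_def)
  have \<rho>lim: "filterlim (\<rho> c) (at_right 0) (at_right 0)" if c: "c > 0" for c
  proof -
    have "((\<lambda>t. root n (t / c)) \<longlongrightarrow> root n (0 / c)) (at_right 0)"
      using c by (intro tendsto_intros) auto
    then have "(\<rho> c \<longlongrightarrow> 0) (at_right 0)" by (simp add: \<rho>_def[abs_def])
    moreover have "\<forall>\<^sub>F t in at_right 0. \<rho> c t \<in> {0<..} \<and> \<rho> c t \<noteq> 0"
      using \<rho>pos[OF c] by (auto simp: eventually_at_right_field intro!: exI[of _ 1]) (metis less_irrefl)
    ultimately show ?thesis by (simp add: filterlim_at)
  qed
  have half: "\<forall>\<^sub>F t in at_right (0::real). 0 < t \<and> t < 1 / 2"
    by (auto simp: eventually_at_right_field intro!: exI[of _ "1/2"])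
  have "((\<lambda>t. small_cap_count TYPE('d) t / t ^ n) \<longlongrightarrow> L) (at_right 0)"
  proof (rule order_tendstoI)
    fix a assume a: "a < L"
    have "((\<lambda>t. far_prob TYPE('d) (\<rho> \<kappa> t) / \<rho> \<kappa> t ^ (n * n)) \<longlongrightarrow> K) (at_right 0)"
      by (rule filterlim_compose[OF Klim \<rho>lim[OF \<kappa>]])
    then have "((\<lambda>t. far_prob TYPE('d) (\<rho> \<kappa> t) / \<rho> \<kappa> t ^ (n * n) / \<kappa> ^ n) \<longlongrightarrow> L) (at_right 0)"
      unfolding L_def using \<kappa> by (intro tendsto_intros) auto
    then have "\<forall>\<^sub>F t in at_right 0. a < far_prob TYPE('d) (\<rho> \<kappa> t) / \<rho> \<kappa> t ^ (n * n) / \<kappa> ^ n"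
      using a by (rule order_tendstoD)
    then show "\<forall>\<^sub>F t in at_right 0. a < small_cap_count TYPE('d) t / t ^ n"
      using half
    proof eventually_elim
      fix t :: real assume A: "a < far_prob TYPE('d) (\<rho> \<kappa> t) / \<rho> \<kappa> t ^ (n * n) / \<kappa> ^ n" and t: "0 < t \<and> t < 1 / 2"
      have "cap_mass TYPE('d) (\<rho> \<kappa> t) / (t / \<kappa>) \<le> \<kappa>" using \<kappa>le[OF \<rho>pos[OF \<kappa>, of t]] t \<rho>pow[OF \<kappa>, of t] by simp
      then have "cap_mass TYPE('d) (\<rho> \<kappa> t) \<le> t" using t \<kappa> by (simp add: field_simps)
      then have le: "far_prob TYPE('d) (\<rho> \<kappa> t) \<le> small_cap_count TYPE('d) t"
        using small_cap_count_far_prob(1)[OF dim, of t "\<rho> \<kappa> t"] t \<rho>pos[OF \<kappa>, of t] by simp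
      have eq: "far_prob TYPE('d) (\<rho> \<kappa> t) / \<rho> \<kappa> t ^ (n * n) / \<kappa> ^ n = far_prob TYPE('d) (\<rho> \<kappa> t) / t ^ n"
        using \<rho>pow[OF \<kappa>, of t] t \<kappa> by (simp add: power_mult power_divide)
      have "far_prob TYPE('d) (\<rho> \<kappa> t) / \<rho> \<kappa> t ^ (n * n) / \<kappa> ^ n \<le> small_cap_count TYPE('d) t / t ^ n"
        unfolding eq using t by (intro divide_right_mono le) simp
      then show "a < small_cap_count TYPE('d) t / t ^ n" using A by linarith
    qed
  next
    fix a assume a: "L < a"
    \<comment> \<open>By continuity there is some \<open>c\<close> strictly below
      \<open>\<kappa>\<close> whose bound \<open>K / c ^ n\<close> is still below
      \<open>a\<close>.\<close>
    have "((\<lambda>c. K / c ^ n) \<longlongrightarrow> K / \<kappa> ^ n) (at_left \<kappa>)"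
      using \<kappa> by (intro tendsto_intros) auto
    then have "\<forall>\<^sub>F c in at_left \<kappa>. K / c ^ n < a" using a unfolding L_def by (rule order_tendstoD)
    moreover have "\<forall>\<^sub>F c in at_left \<kappa>. 0 < c \<and> c < \<kappa>"
      using \<kappa> by (auto simp: eventually_at_left_field intro!: exI[of _ 0])
    ultimately have "\<forall>\<^sub>F c in at_left \<kappa>. K / c ^ n < a \<and> 0 < c \<and> c < \<kappa>" by eventually_elim auto
    then obtain c where c: "K / c ^ n < a" "0 < c" "c < \<kappa>"
      using eventually_happens[of _ "at_left \<kappa>"] by (auto simp: trivial_limit_at_left_real)
    have "((\<lambda>t. cap_mass TYPE('d) (\<rho> c t) / \<rho> c t ^ n) \<longlongrightarrow> \<kappa>) (at_right 0)"
      by (rule filterlim_compose[OF \<kappa>lim \<rho>lim[OF c(2)]])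
    then have "\<forall>\<^sub>F t in at_right 0. c < cap_mass TYPE('d) (\<rho> c t) / \<rho> c t ^ n"
      using c(3) by (rule order_tendstoD)
    then show "\<forall>\<^sub>F t in at_right 0. small_cap_count TYPE('d) t / t ^ n < a"
      using half
    proof eventually_elim
      fix t :: real assume A: "c < cap_mass TYPE('d) (\<rho> c t) / \<rho> c t ^ n" and t: "0 < t \<and> t < 1 / 2"
      have \<rho>1: "\<rho> c t > 0" using \<rho>pos c t by blast
      have "c < cap_mass TYPE('d) (\<rho> c t) / (t / c)" using A \<rho>pow[OF c(2), of t] t by simp
      then have "t < cap_mass TYPE('d) (\<rho> c t)" using t c by (simp add: field_simps)
      then have "small_cap_count TYPE('d) t \<le> far_prob TYPE('d) (\<rho> c t)"
        using small_cap_count_far_prob(2)[OF dim, of t "\<rho> c t"] t \<rho>1 by simp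
      also have "\<dots> \<le> K * \<rho> c t ^ (n * n)" using Kle[OF \<rho>1] \<rho>1 by (simp add: pos_divide_le_eq)
      also have "\<dots> = K / c ^ n * t ^ n" using \<rho>pow[OF c(2), of t] t by (simp add: power_mult power_divide)
      finally have "small_cap_count TYPE('d) t / t ^ n \<le> K / c ^ n" using t by (simp add: pos_divide_le_eq)
      then show "small_cap_count TYPE('d) t / t ^ n < a" using c(1) by linarith
    qed
  qed
  moreover have "L > 0" using K \<kappa> by (simp add: L_def)
  ultimately show ?thesis unfolding n_def by blast
qed

section \<open>Moments of the side masses\<close>

text \<open>Integration by parts moves one power of \<open>t\<close> to \<open>1 - t\<close>, so the
  induction on \<open>j\<close> has to be general in \<open>k\<close>.\<close>

lemma has_integral_beta_nat:
  assumes "k > 0"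
  shows "((\<lambda>t::real. real k * (1 - t) ^ (k - 1) * t ^ j) has_integral (fact j * fact k / fact (j + k))) {0..1}"
  using assms
proof (induction j arbitrary: k)
  case 0
  have "((\<lambda>t::real. real k * (1 - t) ^ (k - 1)) has_integral (- ((1 - 1) ^ k) - - ((1 - 0) ^ k))) {0..1}"
    unfolding has_real_derivative_iff_has_vector_derivative[symmetric]
    by (rule fundamental_theorem_of_calculus)
       (auto simp: has_real_derivative_iff_has_vector_derivative[symmetric] intro!: derivative_eq_intros)
  then show ?case using 0 by (simp add: zero_power)
next
  case (Suc j)
  have "((\<lambda>t::real. real k * (1 - t) ^ (k - 1) * t ^ Suc j - (1 - t) ^ k * (real (Suc j) * t ^ j)) has_integral
      (- ((1 - 1) ^ k * 1 ^ Suc j) - - ((1 - 0) ^ k * 0 ^ Suc j))) {0..1}"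
  proof (rule fundamental_theorem_of_calculus)
    fix t :: real
    have "((\<lambda>t. - ((1 - t) ^ k * t ^ Suc j)) has_real_derivative
        (real k * (1 - t) ^ (k - 1) * t ^ Suc j - (1 - t) ^ k * (real (Suc j) * t ^ j))) (at t within {0..1})"
      by (rule derivative_eq_intros refl)+ (simp add: algebra_simps)
    then show "((\<lambda>t. - ((1 - t) ^ k * t ^ Suc j)) has_vector_derivative
        (real k * (1 - t) ^ (k - 1) * t ^ Suc j - (1 - t) ^ k * (real (Suc j) * t ^ j))) (at t within {0..1})"
      by (simp only: has_real_derivative_iff_has_vector_derivative)
  qed simp
  then have 1: "((\<lambda>t::real. real k * (1 - t) ^ (k - 1) * t ^ Suc j - (1 - t) ^ k * (real (Suc j) * t ^ j)) has_integral 0) {0..1}"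
    using Suc.prems by (simp add: zero_power)
  have "((\<lambda>t::real. (real (Suc j) / real (Suc k)) * (real (Suc k) * (1 - t) ^ (Suc k - 1) * t ^ j)) has_integral
     (real (Suc j) / real (Suc k)) * (fact j * fact (Suc k) / fact (j + Suc k))) {0..1}"
    by (rule has_integral_mult_right) (rule Suc.IH, simp)
  also have "(\<lambda>t::real. (real (Suc j) / real (Suc k)) * (real (Suc k) * (1 - t) ^ (Suc k - 1) * t ^ j))
    = (\<lambda>t. (1 - t) ^ k * (real (Suc j) * t ^ j))"
    by (simp add: fun_eq_iff)
  also have "(real (Suc j) / real (Suc k)) * (fact j * fact (Suc k) / fact (j + Suc k)) = (fact (Suc j) * fact k / fact (Suc j + k) :: real)"
    by (simp add: fact_Suc)
  finally have 2: "((\<lambda>t::real. (1 - t) ^ k * (real (Suc j) * t ^ j)) has_integral (fact (Suc j) * fact k / fact (Suc j + k))) {0..1}" .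
  show ?case using has_integral_add[OF 1 2] by simp
qed

lemma nn_integral_beta_nat:
  assumes "k > 0"
  shows "(\<integral>\<^sup>+t. ennreal (real k * (1 - t) ^ (k - 1) * t ^ j) * indicator {0..1} t \<partial>lborel) = ennreal (fact j * fact k / fact (j + k))"
proof -
  let ?f = "\<lambda>t::real. if t \<in> {0..1} then real k * (1 - t) ^ (k - 1) * t ^ j else 0"
  have "(?f has_integral (fact j * fact k / fact (j + k))) UNIV"
    unfolding has_integral_restrict_UNIV by (rule has_integral_beta_nat[OF assms])
  then have "(\<integral>\<^sup>+t. ennreal (?f t) \<partial>lborel) = ennreal (fact j * fact k / fact (j + k))"
    by (intro nn_integral_has_integral_lborel) auto
  also have "(\<integral>\<^sup>+t. ennreal (?f t) \<partial>lborel) = (\<integral>\<^sup>+t. ennreal (real k * (1 - t) ^ (k - 1) * t ^ j) * indicator {0..1} t \<partial>lborel)"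
    by (intro nn_integral_cong) (auto simp: indicator_def)
  finally show ?thesis .
qed

text \<open>Layer-cake form of a power; with \<open>x = 1 - side_mass\<close> it turns a moment of
  the side mass into an integral against \<open>small_cap_count\<close>.\<close>

lemma nn_integral_layer_power:
  assumes k: "k > 0" and x: "0 \<le> x" "x \<le> 1"
  shows "(\<integral>\<^sup>+t. ennreal (real k * (1 - t) ^ (k - 1)) * indicator {0..1} t * indicator {x..} t \<partial>lborel) = ennreal ((1 - x) ^ k)"
proof -
  have "(\<integral>\<^sup>+t. ennreal (real k * (1 - t) ^ (k - 1)) * indicator {0..1} t * indicator {x..} t \<partial>lborel)
    = (\<integral>\<^sup>+t. ennreal (real k * (1 - t) ^ (k - 1)) * indicator {x..1} t \<partial>lborel)"
    using x by (intro nn_integral_cong) (auto simp: indicator_def)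
  also have "\<dots> = ennreal (- ((1 - 1) ^ k) - - ((1 - x) ^ k))"
    by (rule nn_integral_FTC_Icc[where F="\<lambda>t. - ((1 - t) ^ k)"]) (use x in \<open>auto intro!: derivative_eq_intros\<close>)
  finally show ?thesis using k by (simp add: zero_power)
qed

text \<open>For \<open>k > 0\<close> this is the probability that \<open>CARD('d)\<close> given
  points out of \<open>CARD('d) + k\<close> random ones span a facet: the two sides of their
  hyperplane are disjoint, and each contains all \<open>k\<close> others with the given power as
  conditional probability.\<close>

definition facet_moment :: "'d::finite itself \<Rightarrow> nat \<Rightarrow> real" where
  "facet_moment _ k = (\<Sum>\<epsilon>\<in>{1, - 1}. \<integral>p. side_mass undefined \<epsilon> p ^ k \<partial>(dtuple :: ('d \<Rightarrow> real ^ 'd) measure))"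

lemma integrable_side_mass_power:
  "integrable (dtuple :: ('d::finite \<Rightarrow> real ^ 'd) measure) (\<lambda>p. side_mass i \<epsilon> p ^ k)"
proof -
  interpret prob_space "dtuple :: ('d \<Rightarrow> real ^ 'd) measure" by (rule prob_space_PiM_uniform_sphere)
  show ?thesis
    by (rule integrable_const_bound[where B=1]) (auto simp: side_mass_nonneg side_mass_le_1 power_le_one)
qed

lemma borel_measurable_small_cap_count [measurable]: "small_cap_count TYPE('d::finite) \<in> borel_measurable borel"
proof (rule borel_measurable_mono)
  interpret prob_space "dtuple :: ('d \<Rightarrow> real ^ 'd) measure" by (rule prob_space_PiM_uniform_sphere)
  show "mono (small_cap_count TYPE('d))"
    unfolding small_cap_count_def mono_def by (intro allI impI sum_mono finite_measure_mono) auto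
qed

lemma small_cap_count_nonneg: "small_cap_count TYPE('d::finite) t \<ge> 0"
  unfolding small_cap_count_def by (intro sum_nonneg) simp

lemma small_cap_count_le_2: "small_cap_count TYPE('d::finite) t \<le> 2"
proof -
  interpret prob_space "dtuple :: ('d \<Rightarrow> real ^ 'd) measure" by (rule prob_space_PiM_uniform_sphere)
  have "small_cap_count TYPE('d) t \<le> (\<Sum>\<epsilon>\<in>{1, - 1 :: real}. 1)"
    unfolding small_cap_count_def by (intro sum_mono) simp
  then show ?thesis by simp
qed

lemma facet_moment_layer:
  assumes k: "k > 0"
  shows "ennreal (facet_moment TYPE('d::finite) k)
    = (\<integral>\<^sup>+t. ennreal (real k * (1 - t) ^ (k - 1)) * indicator {0..1} t * ennreal (small_cap_count TYPE('d) t) \<partial>lborel)"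
proof -
  interpret prob_space "dtuple :: ('d \<Rightarrow> real ^ 'd) measure" by (rule prob_space_PiM_uniform_sphere)
  interpret P: pair_sigma_finite "dtuple :: ('d \<Rightarrow> real ^ 'd) measure" "lborel :: real measure" by standard
  let ?c = "\<lambda>t. ennreal (real k * (1 - t) ^ (k - 1)) * indicator {0..1} t"
  let ?s = "\<lambda>\<epsilon> p. side_mass (undefined :: 'd) \<epsilon> p"
  have one: "ennreal (\<integral>p. ?s \<epsilon> p ^ k \<partial>dtuple)
    = (\<integral>\<^sup>+t. ?c t * ennreal (measure (dtuple :: ('d \<Rightarrow> real ^ 'd) measure) {p \<in> space dtuple. 1 - ?s \<epsilon> p \<le> t}) \<partial>lborel)" for \<epsilon>
  proof -
    have m: "(\<lambda>(p, t). ?c t * indicator {x. 1 - ?s \<epsilon> (fst x) \<le> snd x} (p, t)) \<in> borel_measurable (dtuple \<Otimes>\<^sub>M lborel)"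
      by measurable
    have "ennreal (\<integral>p. ?s \<epsilon> p ^ k \<partial>dtuple) = (\<integral>\<^sup>+p. ennreal (?s \<epsilon> p ^ k) \<partial>dtuple)"
      by (rule nn_integral_eq_integral[symmetric, OF integrable_side_mass_power]) (simp add: side_mass_nonneg)
    also have "\<dots> = (\<integral>\<^sup>+p. (\<integral>\<^sup>+t. ?c t * indicator {x. 1 - ?s \<epsilon> (fst x) \<le> snd x} (p, t) \<partial>lborel) \<partial>dtuple)"
    proof (rule nn_integral_cong)
      fix p :: "'d \<Rightarrow> real ^ 'd"
      have "(\<integral>\<^sup>+t. ?c t * indicator {1 - ?s \<epsilon> p..} t \<partial>lborel) = ennreal ((1 - (1 - ?s \<epsilon> p)) ^ k)"
        by (rule nn_integral_layer_power[OF k]) (simp_all add: side_mass_nonneg side_mass_le_1)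
      moreover have "indicator {x. 1 - ?s \<epsilon> (fst x) \<le> snd x} (p, t) = (indicator {1 - ?s \<epsilon> p..} t :: ennreal)" for t
        by (simp add: indicator_def)
      ultimately show "ennreal (?s \<epsilon> p ^ k) = (\<integral>\<^sup>+t. ?c t * indicator {x. 1 - ?s \<epsilon> (fst x) \<le> snd x} (p, t) \<partial>lborel)"
        by simp
    qed
    also have "\<dots> = (\<integral>\<^sup>+t. (\<integral>\<^sup>+p. ?c t * indicator {x. 1 - ?s \<epsilon> (fst x) \<le> snd x} (p, t) \<partial>dtuple) \<partial>lborel)"
      by (rule P.Fubini'[symmetric]) (rule m)
    also have "\<dots> = (\<integral>\<^sup>+t. ?c t * ennreal (measure dtuple {p \<in> space (dtuple :: ('d \<Rightarrow> real ^ 'd) measure). 1 - ?s \<epsilon> p \<le> t}) \<partial>lborel)"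
    proof (rule nn_integral_cong)
      fix t :: real
      have "(\<integral>\<^sup>+p. ?c t * indicator {x. 1 - ?s \<epsilon> (fst x) \<le> snd x} (p, t) \<partial>dtuple)
         = (\<integral>\<^sup>+p. ?c t * indicator {p \<in> space dtuple. 1 - ?s \<epsilon> p \<le> t} p \<partial>(dtuple :: ('d \<Rightarrow> real ^ 'd) measure))"
        by (rule nn_integral_cong) (simp add: indicator_def)
      also have "\<dots> = ?c t * emeasure dtuple {p \<in> space (dtuple :: ('d \<Rightarrow> real ^ 'd) measure). 1 - ?s \<epsilon> p \<le> t}"
        by (subst nn_integral_cmult_indicator) auto
      finally show "(\<integral>\<^sup>+p. ?c t * indicator {x. 1 - ?s \<epsilon> (fst x) \<le> snd x} (p, t) \<partial>dtuple)
         = ?c t * ennreal (measure dtuple {p \<in> space (dtuple :: ('d \<Rightarrow> real ^ 'd) measure). 1 - ?s \<epsilon> p \<le> t})"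
        by (simp only: emeasure_eq_measure)
    qed
    finally show ?thesis .
  qed
  have bm: "(\<lambda>t. measure (dtuple :: ('d \<Rightarrow> real ^ 'd) measure) {p \<in> space dtuple. 1 - ?s \<epsilon> p \<le> t}) \<in> borel_measurable borel" for \<epsilon>
    by (rule borel_measurable_mono) (auto simp: mono_def intro!: finite_measure_mono)
  note [measurable] = bm
  have nn: "0 \<le> (\<integral>p. ?s \<epsilon> p ^ k \<partial>(dtuple :: ('d \<Rightarrow> real ^ 'd) measure))" for \<epsilon>
    by (intro Bochner_Integration.integral_nonneg) (simp add: side_mass_nonneg)
  have "ennreal (facet_moment TYPE('d) k) = ennreal (\<integral>p. ?s 1 p ^ k \<partial>dtuple) + ennreal (\<integral>p. ?s (- 1) p ^ k \<partial>dtuple)"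
    unfolding facet_moment_def using nn by simp
  also have "\<dots> = (\<integral>\<^sup>+t. ?c t * ennreal (measure (dtuple :: ('d \<Rightarrow> real ^ 'd) measure) {p \<in> space dtuple. 1 - ?s 1 p \<le> t})
      + ?c t * ennreal (measure (dtuple :: ('d \<Rightarrow> real ^ 'd) measure) {p \<in> space dtuple. 1 - ?s (- 1) p \<le> t}) \<partial>lborel)"
    unfolding one by (rule nn_integral_add[symmetric]) measurable
  also have "\<dots> = (\<integral>\<^sup>+t. ?c t * ennreal (small_cap_count TYPE('d) t) \<partial>lborel)"
    by (rule nn_integral_cong) (simp add: small_cap_count_def distrib_left)
  finally show ?thesis .
qed

lemma half_less: "0 < x \<Longrightarrow> x / 2 < (x::real)"
  by simp

lemma tendsto_power_fact_ratio:
  "(\<lambda>k. real k ^ n * (fact k / fact (n + k))) \<longlonglongrightarrow> 1"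
proof (induction n)
  case (Suc n)
  have "(\<lambda>k. real k / (real k + real (Suc n))) \<longlonglongrightarrow> 1"
  proof -
    have "(\<lambda>k. 1 - real (Suc n) * inverse (real (Suc (k + n)))) \<longlonglongrightarrow> 1 - real (Suc n) * 0"
      by (intro tendsto_intros LIMSEQ_ignore_initial_segment[OF LIMSEQ_inverse_real_of_nat, of n])
    moreover have "1 - real (Suc n) * inverse (real (Suc (k + n))) = real k / (real k + real (Suc n))" for k
      by (simp add: field_simps)
    ultimately show ?thesis by simp
  qed
  from tendsto_mult[OF Suc this]
  have "(\<lambda>k. real k ^ n * (fact k / fact (n + k)) * (real k / (real k + real (Suc n)))) \<longlonglongrightarrow> 1" by simp
  moreover have "real k ^ n * (fact k / fact (n + k)) * (real k / (real k + real (Suc n))) = real k ^ Suc n * (fact k / fact (Suc n + k))" for k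
    by (simp add: algebra_simps)
  ultimately show ?case by simp
qed simp

text \<open>An Abelian argument. For large \<open>k\<close> the weight
  \<open>k * (1 - t) ^ (k - 1)\<close> concentrates at 0, where the count behaves like
  \<open>L * t ^ n\<close>. The deviation is bounded for all \<open>t > 0\<close> by
  \<open>\<eta> * t ^ n + C * t ^ (n + 1)\<close>, and the last term integrates to a Beta value
  smaller by a factor of order \<open>1 / k\<close>.\<close>

lemma facet_moment_asymptotics:
  assumes dim: "CARD('d::finite) \<ge> 2"
  shows "\<exists>F>0. (\<lambda>k. real k ^ (CARD('d) - 1) * facet_moment TYPE('d) k) \<longlonglongrightarrow> F"
proof -
  define n where "n = CARD('d) - 1"
  define N where "N = small_cap_count TYPE('d)"
  have [measurable]: "N \<in> borel_measurable borel" unfolding N_def by measurable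
  obtain L where L: "L > 0" and lim: "((\<lambda>t. N t / t ^ n) \<longlongrightarrow> L) (at_right 0)"
    using small_cap_count_asymptotics[OF dim] unfolding n_def N_def by blast
  define B where "B k j = (fact j * fact k / fact (j + k) :: real)" for k j
  define \<pi> where "\<pi> = facet_moment TYPE('d)"
  have \<pi>0: "\<pi> k \<ge> 0" for k
    unfolding \<pi>_def facet_moment_def by (intro sum_nonneg Bochner_Integration.integral_nonneg) (simp add: side_mass_nonneg)
  have B0: "B k j \<ge> 0" for k j by (simp add: B_def)
  let ?c = "\<lambda>k t. ennreal (real k * (1 - t) ^ (k - 1)) * indicator {0..1} (t :: real)"
  have layer: "ennreal (\<pi> k) = (\<integral>\<^sup>+t. ?c k t * ennreal (N t) \<partial>lborel)" if "k > 0" for k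
    unfolding \<pi>_def N_def by (rule facet_moment_layer[OF that])
  have poly: "(\<integral>\<^sup>+t. ?c k t * ennreal (a * t ^ j) \<partial>lborel) = ennreal (a * B k j)" if "k > 0" "a \<ge> 0" for k j a
  proof -
    have "(\<integral>\<^sup>+t. ?c k t * ennreal (a * t ^ j) \<partial>lborel) = (\<integral>\<^sup>+t. ennreal a * (ennreal (real k * (1 - t) ^ (k - 1) * t ^ j) * indicator {0..1} t) \<partial>lborel)"
    proof (rule nn_integral_cong)
      fix t :: real
      show "?c k t * ennreal (a * t ^ j) = ennreal a * (ennreal (real k * (1 - t) ^ (k - 1) * t ^ j) * indicator {0..1} t)"
        using that(2) by (cases "t \<in> {0..1}") (auto simp: ennreal_mult[symmetric] mult_ac)
    qed
    also have "\<dots> = ennreal a * ennreal (B k j)"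
    proof -
      have "(\<integral>\<^sup>+t. ennreal a * (ennreal (real k * (1 - t) ^ (k - 1) * t ^ j) * indicator {0..1} t) \<partial>lborel)
        = ennreal a * (\<integral>\<^sup>+t. ennreal (real k * (1 - t) ^ (k - 1) * t ^ j) * indicator {0..1} t \<partial>lborel)"
        by (rule nn_integral_cmult) measurable
      then show ?thesis by (simp only: nn_integral_beta_nat[OF that(1)] B_def)
    qed
    finally show ?thesis using that B0 by (simp add: ennreal_mult)
  qed
  have bounds: "\<exists>C. \<forall>k>0. (L - \<eta>) * B k n \<le> \<pi> k + C * B k (n + 1) \<and> \<pi> k \<le> (L + \<eta>) * B k n + C * B k (n + 1)"
    if \<eta>: "0 < \<eta>" "\<eta> < L" for \<eta>
  proof -
    have "\<forall>\<^sub>F t in at_right 0. L - \<eta> < N t / t ^ n" "\<forall>\<^sub>F t in at_right 0. N t / t ^ n < L + \<eta>"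
      using \<eta> by (auto intro: order_tendstoD[OF lim])
    then have "\<forall>\<^sub>F t in at_right 0. L - \<eta> < N t / t ^ n \<and> N t / t ^ n < L + \<eta>" by eventually_elim auto
    then obtain \<delta> where \<delta>: "\<delta> > 0" "\<And>t. 0 < t \<Longrightarrow> t < \<delta> \<Longrightarrow> L - \<eta> < N t / t ^ n \<and> N t / t ^ n < L + \<eta>"
      by (auto simp: eventually_at_right_field)
    \<comment> \<open>From \<open>\<delta>\<close> on, the term \<open>C * t ^ (n + 1)\<close> alone
      has to do the work: \<open>L / \<delta> \<le> C\<close> lets it dominate
      \<open>L * t ^ n\<close>, and \<open>2 / \<delta> ^ (n + 1) \<le> C\<close> lets it dominate
      the bound 2 on the count.\<close>
    define C where "C = max (L / \<delta>) (2 / \<delta> ^ (n + 1))"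
    have C: "C \<ge> 0" "L / \<delta> \<le> C" "2 / \<delta> ^ (n + 1) \<le> C" using L \<delta>(1) by (auto simp: C_def le_max_iff_disj)
    have low: "(L - \<eta>) * t ^ n \<le> N t + C * t ^ (n + 1)" and up: "N t \<le> (L + \<eta>) * t ^ n + C * t ^ (n + 1)" if t: "0 < t" for t
    proof -
      have N: "0 \<le> N t" "N t \<le> 2" unfolding N_def by (rule small_cap_count_nonneg, rule small_cap_count_le_2)
      have tn: "t ^ n > 0" using t by simp
      show "(L - \<eta>) * t ^ n \<le> N t + C * t ^ (n + 1)"
      proof (cases "t < \<delta>")
        case True
        then have "(L - \<eta>) * t ^ n \<le> N t" using \<delta>(2)[OF t True] tn by (simp add: pos_less_divide_eq less_imp_le)
        then show ?thesis using C(1) t by (simp add: add_increasing2)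
      next
        case False
        have "L * t ^ n \<le> (C * \<delta>) * t ^ n"
          using C(2) \<delta>(1) tn by (intro mult_right_mono) (simp_all add: pos_divide_le_eq)
        also have "\<dots> \<le> (C * t) * t ^ n" using False C(1) tn by (intro mult_right_mono mult_left_mono) auto
        finally have "L * t ^ n \<le> C * t ^ (n + 1)" by (simp add: mult_ac)
        moreover have "(L - \<eta>) * t ^ n \<le> L * t ^ n" using \<eta> tn by (intro mult_right_mono) auto
        ultimately show ?thesis using N by linarith
      qed
      show "N t \<le> (L + \<eta>) * t ^ n + C * t ^ (n + 1)"
      proof (cases "t < \<delta>")
        case True
        then have "N t \<le> (L + \<eta>) * t ^ n" using \<delta>(2)[OF t True] tn by (simp add: pos_divide_less_eq less_imp_le)
        then show ?thesis using C(1) t by (simp add: add_increasing2)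
      next
        case False
        have "2 \<le> C * \<delta> ^ (n + 1)" using C(3) \<delta>(1) by (simp add: pos_divide_le_eq)
        also have "\<dots> \<le> C * t ^ (n + 1)" using False \<delta>(1) C(1) by (intro mult_left_mono power_mono) auto
        finally have "2 \<le> C * t ^ (n + 1)" .
        moreover have "0 \<le> (L + \<eta>) * t ^ n" using L \<eta> tn by simp
        ultimately show ?thesis using N by linarith
      qed
    qed
    have "(L - \<eta>) * B k n \<le> \<pi> k + C * B k (n + 1)" if k: "k > 0" for k
    proof -
      have "ennreal ((L - \<eta>) * B k n) = (\<integral>\<^sup>+t. ?c k t * ennreal ((L - \<eta>) * t ^ n) \<partial>lborel)"
        using poly[OF k, of "L - \<eta>" n] \<eta> by simp
      also have "\<dots> \<le> (\<integral>\<^sup>+t. ?c k t * ennreal (N t) + ?c k t * ennreal (C * t ^ (n + 1)) \<partial>lborel)"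
      proof (rule nn_integral_mono_AE, use AE_lborel_singleton[of 0] in eventually_elim)
        fix t :: real assume t0: "t \<noteq> 0"
        show "?c k t * ennreal ((L - \<eta>) * t ^ n) \<le> ?c k t * ennreal (N t) + ?c k t * ennreal (C * t ^ (n + 1))"
        proof (cases "t \<in> {0..1}")
          case True
          then have t: "0 < t" using t0 by auto
          have "ennreal ((L - \<eta>) * t ^ n) \<le> ennreal (N t + C * t ^ (n + 1))" by (rule ennreal_leI[OF low[OF t]])
          also have "\<dots> = ennreal (N t) + ennreal (C * t ^ (n + 1))"
            using C t by (intro ennreal_plus) (simp_all add: N_def small_cap_count_nonneg)
          finally show ?thesis unfolding distrib_left[symmetric] by (rule mult_left_mono) simp
        qed simp
      qed
      also have "\<dots> = ennreal (\<pi> k) + ennreal (C * B k (n + 1))"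
      proof -
        have "(\<integral>\<^sup>+t. ?c k t * ennreal (N t) + ?c k t * ennreal (C * t ^ (n + 1)) \<partial>lborel)
          = (\<integral>\<^sup>+t. ?c k t * ennreal (N t) \<partial>lborel) + (\<integral>\<^sup>+t. ?c k t * ennreal (C * t ^ (n + 1)) \<partial>lborel)"
          by (rule nn_integral_add) measurable
        then show ?thesis by (simp only: layer[OF k, symmetric] poly[OF k C(1)])
      qed
      also have "\<dots> = ennreal (\<pi> k + C * B k (n + 1))"
        using \<pi>0 B0 C by (intro ennreal_plus[symmetric]) simp_all
      finally show ?thesis
        using \<pi>0[of k] B0[of k "n + 1"] C by (subst (asm) ennreal_le_iff) simp_all
    qed
    moreover have "\<pi> k \<le> (L + \<eta>) * B k n + C * B k (n + 1)" if k: "k > 0" for k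
    proof -
      have "ennreal (\<pi> k) = (\<integral>\<^sup>+t. ?c k t * ennreal (N t) \<partial>lborel)" by (rule layer[OF k])
      also have "\<dots> \<le> (\<integral>\<^sup>+t. ?c k t * ennreal ((L + \<eta>) * t ^ n) + ?c k t * ennreal (C * t ^ (n + 1)) \<partial>lborel)"
      proof (rule nn_integral_mono_AE, use AE_lborel_singleton[of 0] in eventually_elim)
        fix t :: real assume t0: "t \<noteq> 0"
        show "?c k t * ennreal (N t) \<le> ?c k t * ennreal ((L + \<eta>) * t ^ n) + ?c k t * ennreal (C * t ^ (n + 1))"
        proof (cases "t \<in> {0..1}")
          case True
          then have t: "0 < t" using t0 by auto
          have "ennreal (N t) \<le> ennreal ((L + \<eta>) * t ^ n + C * t ^ (n + 1))" by (rule ennreal_leI[OF up[OF t]])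
          also have "\<dots> = ennreal ((L + \<eta>) * t ^ n) + ennreal (C * t ^ (n + 1))"
            using C t L \<eta> by (intro ennreal_plus) simp_all
          finally show ?thesis unfolding distrib_left[symmetric] by (rule mult_left_mono) simp
        qed simp
      qed
      also have "\<dots> = ennreal ((L + \<eta>) * B k n) + ennreal (C * B k (n + 1))"
      proof -
        have "(\<integral>\<^sup>+t. ?c k t * ennreal ((L + \<eta>) * t ^ n) + ?c k t * ennreal (C * t ^ (n + 1)) \<partial>lborel)
          = (\<integral>\<^sup>+t. ?c k t * ennreal ((L + \<eta>) * t ^ n) \<partial>lborel) + (\<integral>\<^sup>+t. ?c k t * ennreal (C * t ^ (n + 1)) \<partial>lborel)"
          by (rule nn_integral_add) measurable
        moreover have "L + \<eta> \<ge> 0" using L \<eta> by simp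
        ultimately show ?thesis by (simp only: poly[OF k] C(1))
      qed
      also have "\<dots> = ennreal ((L + \<eta>) * B k n + C * B k (n + 1))"
        using L \<eta> B0 C by (intro ennreal_plus[symmetric]) simp_all
      finally show ?thesis
        using L \<eta> B0[of k "n + 1"] B0[of k n] C by (subst (asm) ennreal_le_iff) simp_all
    qed
    ultimately show ?thesis by blast
  qed
  have u: "(\<lambda>k. real k ^ n * B k n) \<longlonglongrightarrow> fact n"
    using tendsto_mult[OF tendsto_const[of "fact n"] tendsto_power_fact_ratio[of n]] by (simp add: B_def mult_ac)
  have v: "(\<lambda>k. real k ^ n * B k (n + 1)) \<longlonglongrightarrow> 0"
  proof -
    have "(\<lambda>k. fact (n + 1) * (real k ^ (n + 1) * (fact k / fact (n + 1 + k))) * (1 / real k)) \<longlonglongrightarrow> fact (n + 1) * 1 * 0"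
      by (intro tendsto_mult tendsto_const tendsto_power_fact_ratio lim_1_over_n)
    moreover have "\<forall>\<^sub>F k in sequentially. fact (n + 1) * (real k ^ (n + 1) * (fact k / fact (n + 1 + k))) * (1 / real k) = real k ^ n * B k (n + 1)"
      using eventually_gt_at_top[of 0] by eventually_elim (simp add: B_def)
    ultimately show ?thesis by (simp add: tendsto_cong)
  qed
  have "(\<lambda>k. real k ^ n * \<pi> k) \<longlonglongrightarrow> L * fact n"
  proof (rule order_tendstoI)
    fix a assume a: "a < L * fact n"
    \<comment> \<open>Half of the gap between \<open>a / fact n\<close> and \<open>L\<close>, capped
      by \<open>L / 2\<close> to keep \<open>L - \<eta>\<close> positive.\<close>
    define \<eta> where "\<eta> = min (L / 2) ((L - a / fact n) / 2)"
    have af: "a / fact n < L" using a by (simp add: pos_divide_less_eq)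
    have \<eta>: "0 < \<eta>" "\<eta> < L" using L af by (auto simp: \<eta>_def min_less_iff_disj)
    have "\<eta> < L - a / fact n" using af by (auto simp: \<eta>_def min_less_iff_disj)
    then have "a / fact n < L - \<eta>" by simp
    then have a\<eta>: "a < (L - \<eta>) * fact n" by (simp add: pos_divide_less_eq)
    obtain C where C: "\<And>k. k > 0 \<Longrightarrow> (L - \<eta>) * B k n \<le> \<pi> k + C * B k (n + 1)" using bounds[OF \<eta>] by blast
    have "(\<lambda>k. (L - \<eta>) * (real k ^ n * B k n) - C * (real k ^ n * B k (n + 1))) \<longlonglongrightarrow> (L - \<eta>) * fact n - C * 0"
      by (intro tendsto_intros u v)
    then have "\<forall>\<^sub>F k in sequentially. a < (L - \<eta>) * (real k ^ n * B k n) - C * (real k ^ n * B k (n + 1))"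
      using a\<eta> by (intro order_tendstoD) simp_all
    then show "\<forall>\<^sub>F k in sequentially. a < real k ^ n * \<pi> k"
      using eventually_gt_at_top[of 0]
    proof eventually_elim
      fix k :: nat assume A: "a < (L - \<eta>) * (real k ^ n * B k n) - C * (real k ^ n * B k (n + 1))" and k: "0 < k"
      have "real k ^ n * ((L - \<eta>) * B k n) \<le> real k ^ n * (\<pi> k + C * B k (n + 1))" by (intro mult_left_mono C k) simp
      then show "a < real k ^ n * \<pi> k" using A by (simp add: algebra_simps)
    qed
  next
    fix a assume a: "L * fact n < a"
    define \<eta> where "\<eta> = min (L / 2) ((a / fact n - L) / 2)"
    have af: "L < a / fact n" using a by (simp add: pos_less_divide_eq)
    have \<eta>: "0 < \<eta>" "\<eta> < L" using L af by (auto simp: \<eta>_def min_less_iff_disj)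
    have "\<eta> \<le> (a / fact n - L) / 2" unfolding \<eta>_def by (rule min.cobounded2)
    also have "\<dots> < a / fact n - L" by (rule half_less) (use af in linarith)
    finally have "\<eta> < a / fact n - L" .
    then have "L + \<eta> < a / fact n" by simp
    then have a\<eta>: "(L + \<eta>) * fact n < a" by (simp add: pos_less_divide_eq)
    obtain C where C: "\<And>k. k > 0 \<Longrightarrow> \<pi> k \<le> (L + \<eta>) * B k n + C * B k (n + 1)" using bounds[OF \<eta>] by blast
    have "(\<lambda>k. (L + \<eta>) * (real k ^ n * B k n) + C * (real k ^ n * B k (n + 1))) \<longlonglongrightarrow> (L + \<eta>) * fact n + C * 0"
      by (intro tendsto_intros u v)
    then have "\<forall>\<^sub>F k in sequentially. (L + \<eta>) * (real k ^ n * B k n) + C * (real k ^ n * B k (n + 1)) < a"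
      using a\<eta> by (intro order_tendstoD) simp_all
    then show "\<forall>\<^sub>F k in sequentially. real k ^ n * \<pi> k < a"
      using eventually_gt_at_top[of 0]
    proof eventually_elim
      fix k :: nat assume A: "(L + \<eta>) * (real k ^ n * B k n) + C * (real k ^ n * B k (n + 1)) < a" and k: "0 < k"
      have "real k ^ n * \<pi> k \<le> real k ^ n * ((L + \<eta>) * B k n + C * B k (n + 1))" by (intro mult_left_mono C k) simp
      then show "real k ^ n * \<pi> k < a" using A by (simp add: algebra_simps)
    qed
  qed
  moreover have "L * fact n > 0" using L by simp
  ultimately show ?thesis unfolding n_def \<pi>_def by blast
qed

section \<open>Facets as index sets\<close>

text \<open>The index sets of the proper nonempty faces of the hull, as vertex sets cut out by a
  supporting hyperplane.\<close>

definition face_pattern :: "nat \<Rightarrow> (nat \<Rightarrow> 'a::euclidean_space) \<Rightarrow> nat set \<Rightarrow> bool" where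
  "face_pattern m x J \<longleftrightarrow> J \<noteq> {} \<and> J \<subset> {..<m} \<and>
     (\<exists>a b. (\<forall>j\<in>J. a \<bullet> x j = b) \<and> (\<forall>j\<in>{..<m} - J. a \<bullet> x j < b))"

text \<open>Maximality among face patterns replaces the condition on dimension. Only finitely many
  index sets are compared, so measurability passes from faces to facets.\<close>

definition facet_pattern :: "nat \<Rightarrow> (nat \<Rightarrow> 'a::euclidean_space) \<Rightarrow> nat set \<Rightarrow> bool" where
  "facet_pattern m x J \<longleftrightarrow> face_pattern m x J \<and> (\<forall>K\<in>Pow {..<m}. face_pattern m x K \<longrightarrow> J \<subseteq> K \<longrightarrow> K = J)"

lemma polytope_hull_of: "polytope (hull_of m x)"
  unfolding hull_of_def polytope_def by (intro exI[of _ "x ` {..<m}"]) simp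

lemma face_of_hull_of:
  assumes F: "F face_of hull_of m x"
  shows "F = convex hull (x ` {j \<in> {..<m}. x j \<in> F})"
proof
  let ?S = "x ` {..<m}"
  obtain s' where s': "s' \<subseteq> ?S" "F = convex hull s'"
    using face_of_convex_hull_subset[of ?S F] F unfolding hull_of_def by (auto simp: finite_imp_compact)
  have "s' \<subseteq> x ` {j \<in> {..<m}. x j \<in> F}" using s' hull_subset[of s' convex] by blast
  then show "F \<subseteq> convex hull (x ` {j \<in> {..<m}. x j \<in> F})" using s'(2) hull_mono by blast
  have "convex F" using F by (rule face_of_imp_convex) 
  then show "convex hull (x ` {j \<in> {..<m}. x j \<in> F}) \<subseteq> F" by (intro hull_minimal) auto
qed

text \<open>The last claim recovers the index set from the face, which makes the correspondence
  between patterns and faces injective, coinciding points included.\<close>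

lemma face_pattern_face:
  assumes J: "face_pattern m x J"
  defines "H \<equiv> convex hull (x ` J)"
  shows "H face_of hull_of m x" "H \<noteq> {}" "H \<noteq> hull_of m x" "{j \<in> {..<m}. x j \<in> H} = J"
proof -
  let ?P = "hull_of m x"
  obtain a b where J0: "J \<noteq> {}" "J \<subset> {..<m}" and eq: "\<And>j. j \<in> J \<Longrightarrow> a \<bullet> x j = b"
    and lt: "\<And>j. j \<in> {..<m} - J \<Longrightarrow> a \<bullet> x j < b"
    using J unfolding face_pattern_def by blast
  have le: "a \<bullet> x j \<le> b" if "j < m" for j using eq[of j] lt[of j] that by (cases "j \<in> J") auto
  have "?P \<subseteq> {y. a \<bullet> y \<le> b}"
    unfolding hull_of_def by (rule hull_minimal) (use le in \<open>auto simp: convex_halfspace_le\<close>)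
  then have face: "(?P \<inter> {y. a \<bullet> y = b}) face_of ?P"
    by (intro face_of_Int_supporting_hyperplane_le) (auto simp: hull_of_def convex_convex_hull)
  have inP: "x j \<in> ?P" if "j < m" for j using that unfolding hull_of_def by (auto intro: hull_inc)
  have idx: "{j \<in> {..<m}. x j \<in> ?P \<inter> {y. a \<bullet> y = b}} = J"
    using J0(2) inP eq lt by (auto dest: less_imp_neq)
  have H: "H = ?P \<inter> {y. a \<bullet> y = b}" using face_of_hull_of[OF face] unfolding idx H_def by simp
  show "H face_of ?P" unfolding H by (rule face)
  show "{j \<in> {..<m}. x j \<in> H} = J" unfolding H by (rule idx)
  show "H \<noteq> {}" using J0(1) by (simp add: H_def)
  obtain j where "j \<in> {..<m} - J" using J0(2) by blast
  then show "H \<noteq> ?P" using lt[of j] inP[of j] unfolding H by force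
qed

text \<open>Faces of a polytope are exposed, which supplies the supporting hyperplane.\<close>

lemma face_face_pattern:
  assumes F: "F face_of hull_of m x" "F \<noteq> {}" "F \<noteq> hull_of m x"
  shows "face_pattern m x {j \<in> {..<m}. x j \<in> F}"
proof -
  let ?P = "hull_of m x" and ?J = "{j \<in> {..<m}. x j \<in> F}"
  have "F exposed_face_of ?P"
    using F(1) exposed_face_of_polyhedron[OF polytope_imp_polyhedron[OF polytope_hull_of]] by blast
  then obtain a b where ab: "?P \<subseteq> {y. a \<bullet> y \<le> b}" "F = ?P \<inter> {y. a \<bullet> y = b}"
    unfolding exposed_face_of_def by blast
  have inP: "x j \<in> ?P" if "j < m" for j using that unfolding hull_of_def by (auto intro: hull_inc)
  have "?J \<noteq> {}" using face_of_hull_of[OF F(1)] F(2) by (metis convex_hull_empty image_empty)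
  moreover have "?J \<noteq> {..<m}" using face_of_hull_of[OF F(1)] F(3) unfolding hull_of_def by metis
  then have "?J \<subset> {..<m}" by blast
  moreover have "\<forall>j\<in>?J. a \<bullet> x j = b" using ab(2) by blast
  moreover have "\<forall>j\<in>{..<m} - ?J. a \<bullet> x j < b"
  proof
    fix j assume "j \<in> {..<m} - ?J"
    then have j: "j < m" "x j \<notin> F" by auto
    then show "a \<bullet> x j < b" using ab inP[OF j(1)] by (force simp: order_less_le)
  qed
  ultimately show ?thesis unfolding face_pattern_def by blast
qed

text \<open>A proper face strictly containing a facet would have a dimension strictly between two
  consecutive integers; conversely every proper nonempty face of a polyhedron lies in a
  facet.\<close>

lemma facet_of_hull_iff:
  "F facet_of hull_of m x \<longleftrightarrow> F face_of hull_of m x \<and> F \<noteq> {} \<and> F \<noteq> hull_of m x \<and>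
    (\<forall>G. G face_of hull_of m x \<longrightarrow> G \<noteq> hull_of m x \<longrightarrow> F \<subseteq> G \<longrightarrow> G = F)"
proof
  let ?P = "hull_of m x"
  have conv: "convex ?P" by (simp add: hull_of_def)
  {
    assume F: "F facet_of ?P"
    have F1: "F face_of ?P" "F \<noteq> {}" "aff_dim F = aff_dim ?P - 1" using F by (auto simp: facet_of_def)
    have "G = F" if G: "G face_of ?P" "G \<noteq> ?P" "F \<subseteq> G" for G
    proof (rule ccontr)
      assume ne: "G \<noteq> F"
      have "F face_of G" using face_of_subset[OF F1(1) G(3)] face_of_imp_subset[OF G(1)] by blast
      then have "aff_dim F < aff_dim G" using face_of_aff_dim_lt[of G F] face_of_imp_convex[OF G(1)] ne by blast
      moreover have "aff_dim G < aff_dim ?P" using face_of_aff_dim_lt[OF conv G(1) G(2)] .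
      ultimately show False using F1(3) by linarith
    qed
    then show "F face_of ?P \<and> F \<noteq> {} \<and> F \<noteq> ?P \<and> (\<forall>G. G face_of ?P \<longrightarrow> G \<noteq> ?P \<longrightarrow> F \<subseteq> G \<longrightarrow> G = F)"
      using F1 by auto
  next
    assume F: "F face_of ?P \<and> F \<noteq> {} \<and> F \<noteq> ?P \<and> (\<forall>G. G face_of ?P \<longrightarrow> G \<noteq> ?P \<longrightarrow> F \<subseteq> G \<longrightarrow> G = F)"
    then obtain G where G: "G facet_of ?P" "F \<subseteq> G"
      using face_of_polyhedron_subset_facet[OF polytope_imp_polyhedron[OF polytope_hull_of], of F m x] by blast
    then have "G face_of ?P" "G \<noteq> ?P" by (auto simp: facet_of_def)
    then have "G = F" using F G(2) by blast
    then show "F facet_of ?P" using G(1) by simp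
  }
qed

lemma facet_pattern_facet: "facet_pattern m x J \<Longrightarrow> (convex hull (x ` J)) facet_of hull_of m x"
  unfolding facet_of_hull_iff
proof (intro conjI allI impI)
  assume J: "facet_pattern m x J"
  then have p: "face_pattern m x J" by (simp add: facet_pattern_def)
  note pf = face_pattern_face[OF p]
  show "convex hull (x ` J) face_of hull_of m x" "convex hull (x ` J) \<noteq> {}" "convex hull (x ` J) \<noteq> hull_of m x"
    by (rule pf)+
  fix G assume G: "G face_of hull_of m x" "G \<noteq> hull_of m x" "convex hull (x ` J) \<subseteq> G"
  let ?K = "{j \<in> {..<m}. x j \<in> G}"
  have "G \<noteq> {}" using G(3) pf(2) by blast
  then have "face_pattern m x ?K" using G by (intro face_face_pattern) auto
  moreover have "J \<subseteq> ?K" using pf(4) G(3) by blast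
  ultimately have "?K = J" using J unfolding facet_pattern_def by blast
  then show "G = convex hull (x ` J)" using face_of_hull_of[OF G(1)] by simp
qed

lemma num_facets_hull_of: "num_facets (hull_of m x) = card {J \<in> Pow {..<m}. facet_pattern m x J}"
proof -
  have "bij_betw (\<lambda>J. convex hull (x ` J)) {J \<in> Pow {..<m}. facet_pattern m x J} {F. F facet_of hull_of m x}"
    unfolding bij_betw_def
  proof
    show "inj_on (\<lambda>J. convex hull (x ` J)) {J \<in> Pow {..<m}. facet_pattern m x J}"
    proof (rule inj_on_inverseI[where g="\<lambda>F. {j \<in> {..<m}. x j \<in> F}"])
      fix J assume "J \<in> {J \<in> Pow {..<m}. facet_pattern m x J}"
      then have "face_pattern m x J" by (simp add: facet_pattern_def)
      then show "{j \<in> {..<m}. x j \<in> convex hull (x ` J)} = J" by (rule face_pattern_face(4))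
    qed
    have "F \<in> (\<lambda>J. convex hull (x ` J)) ` {J \<in> Pow {..<m}. facet_pattern m x J}" if F: "F facet_of hull_of m x" for F
    proof -
      let ?J = "{j \<in> {..<m}. x j \<in> F}"
      have F1: "F face_of hull_of m x" "F \<noteq> {}" "F \<noteq> hull_of m x"
        and max: "\<And>G. G face_of hull_of m x \<Longrightarrow> G \<noteq> hull_of m x \<Longrightarrow> F \<subseteq> G \<Longrightarrow> G = F"
        using F[unfolded facet_of_hull_iff] by simp_all
      have eq: "F = convex hull (x ` ?J)" by (rule face_of_hull_of[OF F1(1)])
      have "facet_pattern m x ?J"
        unfolding facet_pattern_def
      proof (intro conjI ballI impI)
        show "face_pattern m x ?J" by (rule face_face_pattern[OF F1])
        fix K assume K: "face_pattern m x K" "?J \<subseteq> K"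
        note pf = face_pattern_face[OF K(1)]
        have "F \<subseteq> convex hull (x ` K)" by (subst eq) (rule hull_mono[OF image_mono[OF K(2)]])
        then have "convex hull (x ` K) = F" by (intro max pf)
        then show "K = ?J" using pf(4) by simp
      qed
      then have "?J \<in> {J \<in> Pow {..<m}. facet_pattern m x J}" by auto
      then show ?thesis by (rule image_eqI[of F "\<lambda>J. convex hull (x ` J)" ?J, OF eq])
    qed
    then show "(\<lambda>J. convex hull (x ` J)) ` {J \<in> Pow {..<m}. facet_pattern m x J} = {F. F facet_of hull_of m x}"
      using facet_pattern_facet by (intro equalityI subsetI) (auto simp only: mem_Collect_eq)
  qed
  from bij_betw_same_card[OF this] show ?thesis unfolding num_facets_def by (rule sym)
qed

text \<open>Strict inequalities and the unbounded range of \<open>(a, b)\<close> stand in the way of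
  \<open>sets_ex_compact\<close>. Scaling \<open>(a, b)\<close> turns the strict inequalities into a
  gap of at least 1, which the terms \<open>max 0\<close> encode, and the parameters are exhausted
  by balls of integer radius.\<close>

lemma pred_face_pattern:
  assumes J: "J \<in> Pow {..<m}"
  shows "Measurable.pred (random_points m :: (nat \<Rightarrow> 'a::euclidean_space) measure) (\<lambda>x. face_pattern m x J)"
proof (cases "J \<noteq> {} \<and> J \<subset> {..<m}")
  case False
  then have "\<not> face_pattern m x J" for x :: "nat \<Rightarrow> 'a" unfolding face_pattern_def by blast
  then show ?thesis by simp
next
  case True
  let ?M = "random_points m :: (nat \<Rightarrow> 'a) measure"
  define g where "g x c = (\<Sum>j\<in>J. \<bar>fst c \<bullet> x j - snd c\<bar>) + (\<Sum>j\<in>{..<m} - J. max 0 (fst c \<bullet> x j - snd c + 1))"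
    for x :: "nat \<Rightarrow> 'a" and c :: "'a \<times> real"
  have fin: "finite J" using J by (auto intro: finite_subset)
  have g0: "g x c \<le> 0 \<longleftrightarrow> (\<forall>j\<in>J. fst c \<bullet> x j = snd c) \<and> (\<forall>j\<in>{..<m} - J. fst c \<bullet> x j + 1 \<le> snd c)" for x c
  proof -
    have "g x c \<le> 0 \<longleftrightarrow> (\<Sum>j\<in>J. \<bar>fst c \<bullet> x j - snd c\<bar>) = 0 \<and> (\<Sum>j\<in>{..<m} - J. max 0 (fst c \<bullet> x j - snd c + 1)) = 0"
    proof -
      have "u + v \<le> 0 \<longleftrightarrow> u = 0 \<and> v = 0" if "u \<ge> 0" "v \<ge> 0" for u v :: real using that by auto
      then show ?thesis unfolding g_def by (simp add: sum_nonneg)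
    qed
    also have "\<dots> \<longleftrightarrow> (\<forall>j\<in>J. \<bar>fst c \<bullet> x j - snd c\<bar> = 0) \<and> (\<forall>j\<in>{..<m} - J. max 0 (fst c \<bullet> x j - snd c + 1) = 0)"
      using fin by (simp add: sum_nonneg_eq_0_iff)
    finally have "g x c \<le> 0 \<longleftrightarrow> (\<forall>j\<in>J. \<bar>fst c \<bullet> x j - snd c\<bar> = 0) \<and> (\<forall>j\<in>{..<m} - J. max 0 (fst c \<bullet> x j - snd c + 1) = 0)" .
    moreover have "max 0 (u - v + 1) = 0 \<longleftrightarrow> u + 1 \<le> v" for u v :: real by (auto simp: max_def)
    ultimately show ?thesis by simp
  qed
  have "face_pattern m x J \<longleftrightarrow> (\<exists>N::nat. \<exists>c\<in>cball 0 (real N). g x c \<le> 0)" for x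
  proof
    assume "face_pattern m x J"
    then obtain a b where ab: "\<forall>j\<in>J. a \<bullet> x j = b" "\<forall>j\<in>{..<m} - J. a \<bullet> x j < b"
      unfolding face_pattern_def by blast
    \<comment> \<open>The smallest gap, positive since \<open>J\<close> is a proper subset and the
      minimum is over a finite nonempty set. Dividing by it normalises the gap to 1.\<close>
    define \<delta> where "\<delta> = Min ((\<lambda>j. b - a \<bullet> x j) ` ({..<m} - J))"
    have ne: "{..<m} - J \<noteq> {}" using True by blast
    have "\<delta> \<in> (\<lambda>j. b - a \<bullet> x j) ` ({..<m} - J)" unfolding \<delta>_def using ne by (intro Min_in) auto
    then have \<delta>: "\<delta> > 0" using ab(2) by auto
    have \<delta>le: "\<delta> \<le> b - a \<bullet> x j" if "j \<in> {..<m} - J" for j unfolding \<delta>_def using that by (intro Min_le) auto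
    let ?c = "((1 / \<delta>) *\<^sub>R a, b / \<delta>)"
    have "fst ?c \<bullet> x j + 1 \<le> snd ?c" if "j \<in> {..<m} - J" for j
    proof -
      have "\<delta> / \<delta> \<le> (b - a \<bullet> x j) / \<delta>" using \<delta> \<delta>le[OF that] by (intro divide_right_mono) auto
      then show ?thesis using \<delta> by (simp add: diff_divide_distrib)
    qed
    moreover have "fst ?c \<bullet> x j = snd ?c" if "j \<in> J" for j using ab(1) that by simp
    ultimately have "g x ?c \<le> 0" unfolding g0 by blast
    moreover obtain N :: nat where "norm ?c \<le> real N" using real_arch_simple by blast
    ultimately show "\<exists>N::nat. \<exists>c\<in>cball 0 (real N). g x c \<le> 0" by (intro exI[of _ N] bexI[of _ ?c]) auto
  next
    assume "\<exists>N::nat. \<exists>c\<in>cball 0 (real N). g x c \<le> 0"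
    then obtain c where "g x c \<le> 0" by blast
    then have A: "\<forall>j\<in>J. fst c \<bullet> x j = snd c" and B: "\<forall>j\<in>{..<m} - J. fst c \<bullet> x j + 1 \<le> snd c"
      unfolding g0 by blast+
    have "fst c \<bullet> x j < snd c" if "j \<in> {..<m} - J" for j using bspec[OF B that] by linarith
    then show "face_pattern m x J" using True A unfolding face_pattern_def by blast
  qed
  then have "{x \<in> space ?M. face_pattern m x J} = (\<Union>N::nat. {x \<in> space ?M. \<exists>c\<in>cball 0 (real N). g x c \<le> 0})"
    by auto
  also have "\<dots> \<in> sets ?M"
  proof (intro sets.countable_UN image_subsetI)
    fix N :: nat
    show "{x \<in> space ?M. \<exists>c\<in>cball 0 (real N). g x c \<le> 0} \<in> sets ?M"
    proof (rule sets_ex_compact)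
      show "continuous_on (cball 0 (real N)) (g x)" for x
        unfolding g_def [abs_def] by (intro continuous_intros)
      fix c :: "'a \<times> real"
      have "(\<lambda>x. x j) \<in> borel_measurable ?M" if "j < m" for j
        using measurable_component_singleton[of j "{..<m}" "\<lambda>_. uniform_sphere :: 'a measure"] that
        by (simp add: random_points_def)
      then have [measurable]: "j \<in> J \<Longrightarrow> (\<lambda>x. x j) \<in> borel_measurable ?M" "j \<in> {..<m} - J \<Longrightarrow> (\<lambda>x. x j) \<in> borel_measurable ?M" for j
        using J by auto
      show "(\<lambda>x. g x c) \<in> borel_measurable ?M" unfolding g_def by measurable
    qed simp
  qed
  finally show ?thesis by (simp add: pred_def)
qed

lemma measurable_num_facets [measurable]:
  "(\<lambda>x. real (num_facets (hull_of m x))) \<in> borel_measurable (random_points m :: (nat \<Rightarrow> 'a::euclidean_space) measure)"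
proof -
  have [measurable]: "Measurable.pred (random_points m :: (nat \<Rightarrow> 'a) measure) (\<lambda>x. facet_pattern m x J)" if "J \<in> Pow {..<m}" for J
    unfolding facet_pattern_def
  proof (intro pred_intros_logic pred_intros_finite)
    show "Measurable.pred (random_points m :: (nat \<Rightarrow> 'a) measure) (\<lambda>x. face_pattern m x J)" by (rule pred_face_pattern[OF that])
    show "K \<in> Pow {..<m} \<Longrightarrow> Measurable.pred (random_points m :: (nat \<Rightarrow> 'a) measure) (\<lambda>x. face_pattern m x K)" for K by (rule pred_face_pattern)
  qed simp_all
  have "real (num_facets (hull_of m x)) = (\<Sum>J\<in>Pow {..<m}. if facet_pattern m x J then 1 else 0)" for x :: "nat \<Rightarrow> 'a"
    unfolding num_facets_hull_of by (simp add: sum.If_cases Int_def)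
  then show ?thesis by simp
qed

section \<open>Facets of points in general position\<close>

definition idx :: "nat set \<Rightarrow> 'd::finite \<Rightarrow> nat" where
  "idx I = (SOME f. bij_betw f UNIV I)"

lemma bij_betw_idx:
  assumes "finite I" "card I = CARD('d::finite)"
  shows "bij_betw (idx I :: 'd \<Rightarrow> nat) UNIV I"
proof -
  have "\<exists>f. bij_betw f (UNIV :: 'd set) I" using assms by (intro finite_same_card_bij) auto
  then show ?thesis unfolding idx_def by (rule someI_ex)
qed

lemma idx_eqD: "finite I \<Longrightarrow> card I = CARD('d::finite) \<Longrightarrow> range (idx I :: 'd \<Rightarrow> nat) = I"
  using bij_betw_idx by (rule bij_betw_imp_surj_on)

text \<open>As soon as a further point exists, a nonzero inner product also forces
  \<open>nrm\<close> to be nonzero, so the affine independence of any \<open>CARD('d)\<close> of the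
  points is included.\<close>

definition points_generic :: "nat \<Rightarrow> (nat \<Rightarrow> real ^ 'd::finite) \<Rightarrow> bool" where
  "points_generic m x \<longleftrightarrow> (\<forall>I\<in>Pow {..<m}. card I = CARD('d) \<longrightarrow> (\<forall>j\<in>{..<m} - I.
     nrm undefined (\<lambda>k. x (idx I k)) \<bullet> (x j - x (idx I (undefined :: 'd))) \<noteq> 0))"

text \<open>The hull has full dimension, so a facet has affine dimension \<open>CARD('d) - 1\<close>
  and carries at least \<open>CARD('d)\<close> of the points; genericity forbids more. Conversely, a
  face pattern strictly containing \<open>J\<close> would put a further point on the hyperplane
  through the points of \<open>J\<close>.\<close>

lemma facet_pattern_iff:
  fixes x :: "nat \<Rightarrow> real ^ 'd::finite"
  assumes gp: "points_generic m x" and m: "CARD('d) < m" and J: "J \<in> Pow {..<m}"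
  shows "facet_pattern m x J \<longleftrightarrow> card J = CARD('d) \<and>
    (\<exists>\<epsilon>\<in>{1, - 1}. \<forall>j\<in>{..<m} - J. x j \<in> side undefined \<epsilon> (\<lambda>k. x (idx J k)))"
proof -
  let ?i = "undefined :: 'd"
  let ?w = "\<lambda>I. nrm ?i (\<lambda>k. x (idx I k))"
  have gpD: "?w I \<bullet> (x j - x (idx I ?i)) \<noteq> 0" if "I \<subseteq> {..<m}" "card I = CARD('d)" "j \<in> {..<m} - I" for I j
    using gp that unfolding points_generic_def by blast
  have w0: "?w I \<noteq> 0" and out: "\<exists>j. j \<in> {..<m} - I" if I: "I \<subseteq> {..<m}" "card I = CARD('d)" for I
  proof -
    show "\<exists>j. j \<in> {..<m} - I" using I m by (metis Diff_eq_empty_iff all_not_in_conv card_lessThan less_irrefl subset_antisym)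
    then obtain j where "j \<in> {..<m} - I" by blast
    from gpD[OF I this] show "?w I \<noteq> 0" by auto
  qed
  text \<open>A hyperplane through the points of \<open>I\<close> contains no further point.\<close>
  have only: "a = 0 \<and> b = 0" if I: "I \<subseteq> {..<m}" "card I = CARD('d)" and on: "\<And>j. j \<in> I \<Longrightarrow> a \<bullet> x j = b"
    and j: "j \<in> {..<m} - I" "a \<bullet> x j = b" for I a b j
  proof -
    have r: "range (idx I :: 'd \<Rightarrow> nat) = I" using I by (intro idx_eqD) (auto intro: finite_subset)
    have "a \<bullet> x (idx I k) = b" for k :: 'd using r by (intro on) auto
    then obtain c where c: "a = c *\<^sub>R ?w I" "b = c * (?w I \<bullet> x (idx I ?i))"
      by (rule hyperplane_imp_multiple_nrm[OF w0[OF I]])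
    have "c * (?w I \<bullet> (x j - x (idx I ?i))) = 0" using j(2) c by (simp add: inner_diff_right right_diff_distrib)
    then have "c = 0" using gpD[OF I j(1)] by simp
    then show ?thesis using c by simp
  qed
  show ?thesis
  proof
    assume F: "facet_pattern m x J"
    then have "face_pattern m x J" by (simp add: facet_pattern_def)
    then obtain a b where J0: "J \<noteq> {}" "J \<subset> {..<m}" and eq: "\<And>j. j \<in> J \<Longrightarrow> a \<bullet> x j = b"
      and lt: "\<And>j. j \<in> {..<m} - J \<Longrightarrow> a \<bullet> x j < b"
      unfolding face_pattern_def by blast
    have finJ: "finite J" using J by (auto intro: finite_subset)
    \<comment> \<open>A lower dimension would put all points on one hyperplane, against
      \<open>only\<close> for any \<open>CARD('d)\<close> of them and one further point.\<close>
    have "aff_dim (hull_of m x) = int (CARD('d))"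
    proof (rule ccontr)
      assume "aff_dim (hull_of m x) \<noteq> int (CARD('d))"
      then have "aff_dim (hull_of m x) < DIM(real ^ 'd)" using aff_dim_le_DIM[of "hull_of m x"] by simp
      then obtain a' b' where ab': "a' \<noteq> 0" "hull_of m x \<subseteq> {y. a' \<bullet> y = b'}"
        using aff_lowdim_subset_hyperplane by metis
      obtain I where I: "I \<subseteq> {..<m}" "card I = CARD('d)" using m obtain_subset_with_card_n[of "CARD('d)" "{..<m}"] by auto
      obtain j where j: "j \<in> {..<m} - I" using out[OF I] by blast
      have "x k \<in> hull_of m x" if "k < m" for k using that unfolding hull_of_def by (auto intro: hull_inc)
      then have ab: "a' \<bullet> x k = b'" if "k < m" for k using that ab'(2) by blast
      have "a' = 0 \<and> b' = 0"
      proof (rule only[OF I _ j])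
        show "a' \<bullet> x k = b'" if "k \<in> I" for k using that I(1) by (intro ab) auto
        show "a' \<bullet> x j = b'" using j by (intro ab) auto
      qed
      then show False using ab'(1) by blast
    qed
    moreover have "aff_dim (convex hull (x ` J)) = aff_dim (hull_of m x) - 1"
      using facet_pattern_facet[OF F] by (simp add: facet_of_def)
    ultimately have "aff_dim (x ` J) = int (CARD('d)) - 1" using aff_dim_convex_hull[of "x ` J"] by linarith
    moreover have "aff_dim (x ` J) \<le> int (card (x ` J)) - 1" using finJ by (intro aff_dim_le_card) auto
    moreover have "card (x ` J) \<le> card J" by (rule card_image_le[OF finJ])
    ultimately have "CARD('d) \<le> card J" by linarith
    then obtain I where I: "I \<subseteq> J" "card I = CARD('d)" using obtain_subset_with_card_n by metis
    have Im: "I \<subseteq> {..<m}" using I J by blast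
    have "I = J"
    proof (rule ccontr)
      assume "I \<noteq> J"
      then obtain j where j: "j \<in> J" "j \<notin> I" using I(1) by blast
      have "a = 0 \<and> b = 0"
      proof (rule only[OF Im I(2)])
        show "a \<bullet> x k = b" if "k \<in> I" for k using that I(1) by (intro eq) auto
        show "j \<in> {..<m} - I" using j J by auto
        show "a \<bullet> x j = b" using j(1) by (rule eq)
      qed
      moreover obtain k where "k \<in> {..<m} - J" using J0(2) by blast
      ultimately show False using lt[of k] by simp
    qed
    then have cJ: "card J = CARD('d)" and JJ: "J \<subseteq> {..<m}" using I Im by auto
    have r: "range (idx J :: 'd \<Rightarrow> nat) = J" using cJ finJ by (intro idx_eqD)
    have "a \<bullet> x (idx J k) = b" for k :: 'd using r by (intro eq) auto
    then obtain c where c: "a = c *\<^sub>R ?w J" "b = c * (?w J \<bullet> x (idx J ?i))"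
      by (rule hyperplane_imp_multiple_nrm[OF w0[OF JJ cJ]])
    have neg: "c * (?w J \<bullet> (x j - x (idx J ?i))) < 0" if "j \<in> {..<m} - J" for j
      using lt[OF that] c by (simp add: inner_diff_right right_diff_distrib)
    have "\<exists>\<epsilon>\<in>{1, - 1}. \<forall>j\<in>{..<m} - J. x j \<in> side ?i \<epsilon> (\<lambda>k. x (idx J k))"
    proof (cases "c > 0")
      case True
      then show ?thesis using neg by (intro bexI[of _ "- 1"]) (auto simp: side_def mult_less_0_iff)
    next
      case False
      then show ?thesis using neg by (intro bexI[of _ 1]) (auto simp: side_def mult_less_0_iff)
    qed
    with cJ show "card J = CARD('d) \<and> (\<exists>\<epsilon>\<in>{1, - 1}. \<forall>j\<in>{..<m} - J. x j \<in> side ?i \<epsilon> (\<lambda>k. x (idx J k)))" by blast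
  next
    assume "card J = CARD('d) \<and> (\<exists>\<epsilon>\<in>{1, - 1}. \<forall>j\<in>{..<m} - J. x j \<in> side ?i \<epsilon> (\<lambda>k. x (idx J k)))"
    then obtain \<epsilon> where cJ: "card J = CARD('d)" and \<epsilon>: "\<epsilon> \<in> {1, - 1}" and
      s: "\<And>j. j \<in> {..<m} - J \<Longrightarrow> 0 < \<epsilon> * (?w J \<bullet> (x j - x (idx J ?i)))"
      unfolding side_def by blast
    have JJ: "J \<subseteq> {..<m}" and finJ: "finite J" using J by (auto intro: finite_subset)
    have r: "range (idx J :: 'd \<Rightarrow> nat) = J" using cJ finJ by (intro idx_eqD)
    \<comment> \<open>A face pattern has the other points strictly below the supporting hyperplane,
      \<open>side\<close> has them strictly above; hence the sign.\<close>
    define a where "a = (- \<epsilon>) *\<^sub>R ?w J"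
    define b where "b = a \<bullet> x (idx J ?i)"
    have on: "a \<bullet> x j = b" if j: "j \<in> J" for j
    proof -
      obtain k where k: "j = idx J (k :: 'd)" using r j by blast
      have "?w J \<bullet> (x (idx J k) - x (idx J ?i)) = 0" by (rule nrm_orthogonal)
      then show ?thesis unfolding k a_def b_def by (simp add: inner_diff_right)
    qed
    have below: "a \<bullet> x j < b" if "j \<in> {..<m} - J" for j
      using s[OF that] unfolding a_def b_def by (simp add: inner_diff_right right_diff_distrib)
    have "J \<noteq> {}" using cJ by auto
    moreover have "J \<subset> {..<m}" using JJ out[OF JJ cJ] by blast
    ultimately have pat: "face_pattern m x J" unfolding face_pattern_def using on below by blast
    show "facet_pattern m x J"
      unfolding facet_pattern_def
    proof (intro conjI pat ballI impI)
      fix K assume K: "face_pattern m x K" "J \<subseteq> K"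
      from K(1) obtain a' b' where K0: "K \<subset> {..<m}" and eq: "\<And>j. j \<in> K \<Longrightarrow> a' \<bullet> x j = b'"
        and lt: "\<And>j. j \<in> {..<m} - K \<Longrightarrow> a' \<bullet> x j < b'"
        unfolding face_pattern_def by blast
      show "K = J"
      proof (rule ccontr)
        assume "K \<noteq> J"
        then obtain j where j: "j \<in> K" "j \<notin> J" using K(2) by blast
        have "a' = 0 \<and> b' = 0"
        proof (rule only[OF JJ cJ])
          show "a' \<bullet> x k = b'" if "k \<in> J" for k using that K(2) by (intro eq) auto
          show "j \<in> {..<m} - J" using j K0 by auto
          show "a' \<bullet> x j = b'" using j(1) by (rule eq)
        qed
        moreover obtain k where "k \<in> {..<m} - K" using K0 by blast
        ultimately show False using lt[of k] by simp
      qed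
    qed
  qed
qed

section \<open>The expected number of facets\<close>

lemma PiM_uniform_sphere_reindex:
  assumes "inj_on f I" "f \<in> I \<rightarrow> K"
  shows "distr (PiM K (\<lambda>_. uniform_sphere :: 'a::euclidean_space measure)) (PiM I (\<lambda>_. uniform_sphere)) (\<lambda>x. \<lambda>k\<in>I. x (f k))
    = PiM I (\<lambda>_. uniform_sphere)"
  using distr_PiM_reindex[of K "\<lambda>_. uniform_sphere", OF prob_space_uniform_sphere assms] .

lemma measurable_reindex:
  assumes "f \<in> I \<rightarrow> K"
  shows "(\<lambda>x. \<lambda>k\<in>I. x (f k)) \<in> PiM K (\<lambda>_. M) \<rightarrow>\<^sub>M PiM I (\<lambda>_. M)"
  using assms by (intro measurable_restrict measurable_component_singleton) auto

lemma AE_PiM_uniform_sphere_reindex: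
  assumes f: "inj_on f I" "f \<in> I \<rightarrow> K"
    and ae: "AE p in PiM I (\<lambda>_. uniform_sphere :: 'a::euclidean_space measure). P p"
  shows "AE x in PiM K (\<lambda>_. uniform_sphere). P (\<lambda>k\<in>I. x (f k))"
proof -
  have "AE p in distr (PiM K (\<lambda>_. uniform_sphere)) (PiM I (\<lambda>_. uniform_sphere :: 'a measure)) (\<lambda>x. \<lambda>k\<in>I. x (f k)). P p"
    unfolding PiM_uniform_sphere_reindex[OF f] by (rule ae)
  then show ?thesis by (rule AE_distrD[OF measurable_reindex[OF f(2)]])
qed

lemma idx_facts:
  assumes "finite I" "card I = CARD('d::finite)"
  shows "inj (idx I :: 'd \<Rightarrow> nat)" "idx I (k :: 'd) \<in> I"
  using bij_betw_idx[OF assms] by (auto simp: bij_betw_def)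

lemma measurable_tuple_nrm:
  fixes I V :: "nat set"
  assumes "finite I" "card I = CARD('d::finite)" "I \<subseteq> V"
  shows "(\<lambda>x. nrm i (\<lambda>k. x (idx I k))) \<in> borel_measurable (PiM V (\<lambda>_. uniform_sphere :: (real ^ 'd) measure))"
proof (rule borel_measurable_nrm)
  fix k :: 'd
  have "idx I k \<in> V" using idx_facts(2)[OF assms(1,2)] assms(3) by blast
  then show "(\<lambda>x. x (idx I k)) \<in> borel_measurable (PiM V (\<lambda>_. uniform_sphere :: (real ^ 'd) measure))"
    using measurable_component_singleton[of "idx I k" V "\<lambda>_. uniform_sphere :: (real ^ 'd) measure"] by simp
qed

lemma measurable_coordinate:
  "k \<in> V \<Longrightarrow> (\<lambda>x. x k) \<in> borel_measurable (PiM V (\<lambda>_. uniform_sphere :: 'a::euclidean_space measure))"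
  using measurable_component_singleton[of k V "\<lambda>_. uniform_sphere :: 'a measure"] by simp

text \<open>Freeze the base point of the tuple at \<open>y\<close>. The inner product is then a
  determinant with rows \<open>x k - y\<close>, in which the further point \<open>x j\<close> has
  taken the row of the base point, so \<open>AE_det_nonzero\<close> applies to
  \<open>CARD('d)\<close> independent points.\<close>

lemma AE_points_generic:
  assumes dim: "CARD('d::finite) \<ge> 2"
  shows "AE x in (random_points m :: (nat \<Rightarrow> real ^ 'd) measure). points_generic m x"
proof -
  have "AE x in (random_points m :: (nat \<Rightarrow> real ^ 'd) measure).
      nrm undefined (\<lambda>k. x (idx I k)) \<bullet> (x j - x (idx I (undefined :: 'd))) \<noteq> 0"
    if I: "I \<in> Pow {..<m}" "card I = CARD('d)" and j: "j \<in> {..<m} - I" for I j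
  proof -
    have finI: "finite I" using I(1) by (auto intro: finite_subset)
    note idx = idx_facts[OF finI I(2)]
    let ?u = "undefined :: 'd"
    define i0 where "i0 = idx I ?u"
    have i0: "i0 \<in> I" unfolding i0_def by (rule idx)
    let ?M = "{..<m} - {i0}"
    have ins: "insert i0 ?M = {..<m}" using i0 I(1) by auto
    \<comment> \<open>Enumerates the rows of that determinant: \<open>j\<close> replaces the base
      index, and the remaining vertices keep their places.\<close>
    define f where "f k = (if k = ?u then j else idx I k)" for k :: 'd
    have finj: "inj f"
    proof (rule injI)
      fix k l :: 'd assume "f k = f l"
      then show "k = l" using idx(2)[of k] idx(2)[of l] j injD[OF idx(1), of k l]
        by (auto simp: f_def split: if_splits)
    qed
    have fM: "f \<in> UNIV \<rightarrow> ?M"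
    proof
      fix k :: 'd
      have "idx I k \<noteq> i0" if "k \<noteq> ?u" using that injD[OF idx(1), of k ?u] by (auto simp: i0_def)
      then show "f k \<in> ?M" using j i0 I(1) idx(2)[of k] by (auto simp: f_def)
    qed
    have "AE x in PiM (insert i0 ?M) (\<lambda>_. uniform_sphere :: (real ^ 'd) measure).
        nrm ?u (\<lambda>k. x (idx I k)) \<bullet> (x j - x (idx I ?u)) \<noteq> 0"
    proof (rule AE_PiM_insert_revI)
      have [measurable]: "(\<lambda>x. nrm ?u (\<lambda>k. x (idx I k))) \<in> borel_measurable (PiM {..<m} (\<lambda>_. uniform_sphere :: (real ^ 'd) measure))"
        using I finI by (intro measurable_tuple_nrm) auto
      have [measurable]: "(\<lambda>x. x j) \<in> borel_measurable (PiM {..<m} (\<lambda>_. uniform_sphere :: (real ^ 'd) measure))"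
        "(\<lambda>x. x (idx I ?u)) \<in> borel_measurable (PiM {..<m} (\<lambda>_. uniform_sphere :: (real ^ 'd) measure))"
        using j i0 I(1) by (auto intro!: measurable_coordinate simp: i0_def)
      show "Measurable.pred (PiM (insert i0 ?M) (\<lambda>_. uniform_sphere :: (real ^ 'd) measure))
          (\<lambda>x. nrm ?u (\<lambda>k. x (idx I k)) \<bullet> (x j - x (idx I ?u)) \<noteq> 0)"
        unfolding ins by measurable
      fix y :: "real ^ 'd"
      have "AE p in PiM UNIV (\<lambda>_. uniform_sphere). det (\<chi> k. if k \<in> UNIV then p k - y else axis k 1) \<noteq> 0"
        by (rule AE_det_nonzero[OF dim]) (simp add: det_axis_rows)
      from AE_PiM_uniform_sphere_reindex[OF finj fM this]
      show "AE x in PiM ?M (\<lambda>_. uniform_sphere). nrm ?u (\<lambda>k. (x(i0 := y)) (idx I k)) \<bullet> ((x(i0 := y)) j - (x(i0 := y)) (idx I ?u)) \<noteq> 0"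
      proof eventually_elim
        fix x :: "nat \<Rightarrow> real ^ 'd"
        assume A: "det (\<chi> k. if k \<in> UNIV then (\<lambda>k\<in>UNIV. x (f k)) k - y else axis k 1) \<noteq> 0"
        have "(\<chi> k. if k = ?u then (x(i0 := y)) j - (x(i0 := y)) (idx I ?u) else (x(i0 := y)) (idx I k) - (x(i0 := y)) (idx I ?u))
            = (\<chi> k. if k \<in> UNIV then (\<lambda>k\<in>UNIV. x (f k)) k - y else axis k 1)"
        proof (rule Cart_lambda_cong)
          fix k :: 'd
          have "j \<noteq> i0" using j i0 by auto
          moreover have "idx I k \<noteq> i0" if "k \<noteq> ?u" using that injD[OF idx(1), of k ?u] by (auto simp: i0_def)
          ultimately show "(if k = ?u then (x(i0 := y)) j - (x(i0 := y)) (idx I ?u) else (x(i0 := y)) (idx I k) - (x(i0 := y)) (idx I ?u))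
            = (if k \<in> UNIV then (\<lambda>k\<in>UNIV. x (f k)) k - y else axis k 1)"
            by (auto simp: f_def i0_def)
        qed
        then show "nrm ?u (\<lambda>k. (x(i0 := y)) (idx I k)) \<bullet> ((x(i0 := y)) j - (x(i0 := y)) (idx I ?u)) \<noteq> 0"
          using A unfolding nrm_inner by simp
      qed
    qed auto
    then show ?thesis unfolding ins random_points_def .
  qed
  then have "AE x in (random_points m :: (nat \<Rightarrow> real ^ 'd) measure). \<forall>I\<in>{I \<in> Pow {..<m}. card I = CARD('d)}. \<forall>j\<in>{..<m} - I.
      nrm undefined (\<lambda>k. x (idx I k)) \<bullet> (x j - x (idx I (undefined :: 'd))) \<noteq> 0"
    by (intro AE_finite_allI) auto
  then show ?thesis unfolding points_generic_def by eventually_elim blast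
qed

definition side_of :: "nat set \<Rightarrow> real \<Rightarrow> (nat \<Rightarrow> real ^ 'd::finite) \<Rightarrow> (real ^ 'd) set" where
  "side_of I \<epsilon> x = side undefined \<epsilon> (\<lambda>k. x (idx I k))"

text \<open>The product form makes the indicator, for fixed vertices, a product of independent
  factors, one for each remaining point.\<close>

definition facet_ind :: "nat \<Rightarrow> nat set \<Rightarrow> real \<Rightarrow> (nat \<Rightarrow> real ^ 'd::finite) \<Rightarrow> real" where
  "facet_ind m I \<epsilon> x = (\<Prod>j\<in>{..<m} - I. indicator (side_of I \<epsilon> x) (x j))"

lemma facet_ind_eq: "facet_ind m I \<epsilon> x = (if \<forall>j\<in>{..<m} - I. x j \<in> side_of I \<epsilon> x then 1 else 0)"
proof (cases "\<forall>j\<in>{..<m} - I. x j \<in> side_of I \<epsilon> x")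
  case True
  then show ?thesis unfolding facet_ind_def by (simp add: prod.neutral)
next
  case False
  then obtain j where j: "j \<in> {..<m} - I" "x j \<notin> side_of I \<epsilon> x" by blast
  have "facet_ind m I \<epsilon> x = 0"
    unfolding facet_ind_def by (rule prod_zero) (use j in \<open>auto intro!: bexI[of _ j]\<close>)
  then show ?thesis using False by (simp only: if_False)
qed

lemma facet_ind_bounds: "0 \<le> facet_ind m I \<epsilon> x" "facet_ind m I \<epsilon> x \<le> 1"
  by (simp_all add: facet_ind_eq)

lemma side_of_disjoint: "side_of I 1 x \<inter> side_of I (- 1) x = {}"
  by (auto simp: side_of_def side_def)

lemma sets_side_of [measurable]: "side_of I \<epsilon> x \<in> sets borel"
  by (simp add: side_of_def)

definition tuples :: "'d::finite itself \<Rightarrow> nat \<Rightarrow> nat set set" where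
  "tuples _ m = {I \<in> Pow {..<m}. card I = CARD('d)}"

lemma finite_tuples [simp]: "finite (tuples T m)"
  by (simp add: tuples_def)

lemma tuplesD:
  assumes "I \<in> tuples TYPE('d::finite) m"
  shows "I \<subseteq> {..<m}" "finite I" "card I = CARD('d)"
  using assms by (auto simp: tuples_def intro: finite_subset)

lemma card_tuples: "card (tuples TYPE('d::finite) m) = m choose CARD('d)"
  unfolding tuples_def using n_subsets[of "{..<m}" "CARD('d)"] by (simp add: Pow_def)

lemma sign_sum:
  fixes P :: "real \<Rightarrow> bool"
  assumes "\<not> (P 1 \<and> P (- 1))"
  shows "(if \<exists>\<epsilon>\<in>{1, - 1}. P \<epsilon> then 1 else 0) = (\<Sum>\<epsilon>\<in>{1, - 1}. if P \<epsilon> then 1 else 0 :: real)"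
  using assms by (cases "P 1"; cases "P (- 1)") auto

text \<open>Summing over the two signs counts each facet once: the two sides are disjoint, and by
  \<open>CARD('d) < m\<close> some further point has to lie in one of them.\<close>

lemma num_facets_eq_sum:
  fixes x :: "nat \<Rightarrow> real ^ 'd::finite"
  assumes gp: "points_generic m x" and m: "CARD('d) < m"
  shows "real (num_facets (hull_of m x)) = (\<Sum>I\<in>tuples TYPE('d) m. \<Sum>\<epsilon>\<in>{1, - 1}. facet_ind m I \<epsilon> x)"
proof -
  let ?Q = "\<lambda>I. \<exists>\<epsilon>\<in>{1, - 1}. \<forall>j\<in>{..<m} - I. x j \<in> side_of I \<epsilon> x"
  have "{J \<in> Pow {..<m}. facet_pattern m x J} = {I \<in> tuples TYPE('d) m. ?Q I}"
    using facet_pattern_iff[OF gp m] unfolding tuples_def side_of_def by blast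
  then have "real (num_facets (hull_of m x)) = (\<Sum>I\<in>tuples TYPE('d) m. if ?Q I then 1 else 0)"
    unfolding num_facets_hull_of by (simp add: sum.If_cases Int_def del: bex_simps ball_simps)
  also have "\<dots> = (\<Sum>I\<in>tuples TYPE('d) m. \<Sum>\<epsilon>\<in>{1, - 1}. facet_ind m I \<epsilon> x)"
  proof (rule sum.cong[OF refl])
    fix I assume I: "I \<in> tuples TYPE('d) m"
    have "{..<m} - I \<noteq> {}"
    proof
      assume "{..<m} - I = {}"
      then have "I = {..<m}" using tuplesD(1)[OF I] by auto
      then show False using tuplesD(3)[OF I] m by simp
    qed
    then obtain j where j: "j \<in> {..<m} - I" by (auto simp only: ex_in_conv[symmetric])
    have "\<not> ((\<forall>j\<in>{..<m} - I. x j \<in> side_of I 1 x) \<and> (\<forall>j\<in>{..<m} - I. x j \<in> side_of I (- 1) x))"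
      using side_of_disjoint[of I x] j by auto
    then show "(if ?Q I then 1 else 0) = (\<Sum>\<epsilon>\<in>{1, - 1}. facet_ind m I \<epsilon> x)"
      unfolding facet_ind_eq by (rule sign_sum[of "\<lambda>\<epsilon>. \<forall>j\<in>{..<m} - I. x j \<in> side_of I \<epsilon> x"])
  qed
  finally show ?thesis .
qed

lemma pred_side_of:
  assumes I: "finite I" "card I = CARD('d::finite)" "I \<subseteq> V" and j: "j \<in> V"
  shows "Measurable.pred (PiM V (\<lambda>_. uniform_sphere :: (real ^ 'd) measure)) (\<lambda>x. x j \<in> side_of I \<epsilon> x)"
proof -
  note [measurable] = measurable_tuple_nrm[OF I] measurable_coordinate[OF j]
  have [measurable]: "(\<lambda>x. x (idx I (undefined :: 'd))) \<in> borel_measurable (PiM V (\<lambda>_. uniform_sphere :: (real ^ 'd) measure))"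
    using idx_facts(2)[OF I(1,2)] I(3) by (intro measurable_coordinate) blast
  show ?thesis unfolding side_of_def side_def mem_Collect_eq by measurable
qed

lemma measurable_facet_ind:
  assumes "I \<in> tuples TYPE('d::finite) m"
  shows "facet_ind m I \<epsilon> \<in> borel_measurable (random_points m :: (nat \<Rightarrow> real ^ 'd) measure)"
proof -
  note I = tuplesD[OF assms]
  have "Measurable.pred (random_points m :: (nat \<Rightarrow> real ^ 'd) measure) (\<lambda>x. x j \<in> side_of I \<epsilon> x)" if "j \<in> {..<m} - I" for j
    unfolding random_points_def using I that by (intro pred_side_of) auto
  then have [measurable]: "Measurable.pred (random_points m :: (nat \<Rightarrow> real ^ 'd) measure) (\<lambda>x. \<forall>j\<in>{..<m} - I. x j \<in> side_of I \<epsilon> x)"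
    by (intro pred_intros_finite) auto
  show ?thesis unfolding facet_ind_eq [abs_def] by measurable
qed

lemma side_of_cong:
  assumes "finite I" "card I = CARD('d::finite)" "\<And>k. k \<in> I \<Longrightarrow> x k = y k"
  shows "side_of I \<epsilon> (x :: nat \<Rightarrow> real ^ 'd) = side_of I \<epsilon> y"
proof -
  have "(\<lambda>k :: 'd. x (idx I k)) = (\<lambda>k. y (idx I k))"
    using assms(3) idx_facts(2)[OF assms(1,2)] by auto
  then show ?thesis by (simp add: side_of_def)
qed

text \<open>Given the points with index in \<open>U\<close>, the others are independent of the set
  \<open>A x\<close> and of each other. The set is kept general because it is one side for a single
  facet and the intersection of two sides for a pair.\<close>

lemma nn_integral_remaining_points:
  fixes A :: "(nat \<Rightarrow> 'a::euclidean_space) \<Rightarrow> 'a set"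
  assumes U: "U \<subseteq> {..<m}"
    and dep: "\<And>x y. (\<And>k. k \<in> U \<Longrightarrow> x k = y k) \<Longrightarrow> A x = A y" and A: "\<And>x. A x \<in> sets borel"
    and meas: "\<And>j. j \<in> {..<m} - U \<Longrightarrow> Measurable.pred (random_points m) (\<lambda>x. x j \<in> A x)"
  shows "(\<integral>\<^sup>+x. (\<Prod>j\<in>{..<m} - U. indicator (A x) (x j)) \<partial>random_points m)
    = (\<integral>\<^sup>+x. ennreal (measure uniform_sphere (A x) ^ (m - card U)) \<partial>PiM U (\<lambda>_. uniform_sphere))"
proof -
  let ?J = "{..<m} - U"
  have fin: "finite U" using U by (auto intro: finite_subset)
  have un: "U \<union> ?J = {..<m}" using U by auto
  have m': "(\<lambda>x. indicator (A x) (x j) :: ennreal) \<in> borel_measurable (random_points m)" if "j \<in> ?J" for j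
  proof -
    note [measurable] = meas[OF that]
    have "(\<lambda>x. if x j \<in> A x then 1 else 0 :: ennreal) \<in> borel_measurable (random_points m)" by measurable
    then show ?thesis by (simp add: indicator_def of_bool_def)
  qed
  have f: "(\<lambda>x. \<Prod>j\<in>?J. indicator (A x) (x j) :: ennreal) \<in> borel_measurable (random_points m)"
    by (intro borel_measurable_prod_ennreal m')
  have "(\<integral>\<^sup>+x. (\<Prod>j\<in>?J. indicator (A x) (x j)) \<partial>random_points m)
    = (\<integral>\<^sup>+x. (\<integral>\<^sup>+y. (\<Prod>j\<in>?J. indicator (A (merge U ?J (x, y))) (merge U ?J (x, y) j)) \<partial>PiM ?J (\<lambda>_. uniform_sphere)) \<partial>PiM U (\<lambda>_. uniform_sphere))"
    using sph.product_nn_integral_fold[of U ?J "\<lambda>x. \<Prod>j\<in>?J. indicator (A x) (x j)"] f fin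
    unfolding random_points_def un by auto
  also have "\<dots> = (\<integral>\<^sup>+x. ennreal (measure uniform_sphere (A x) ^ (m - card U)) \<partial>PiM U (\<lambda>_. uniform_sphere))"
  proof (rule nn_integral_cong)
    fix x :: "nat \<Rightarrow> 'a"
    have "(\<integral>\<^sup>+y. (\<Prod>j\<in>?J. indicator (A (merge U ?J (x, y))) (merge U ?J (x, y) j)) \<partial>PiM ?J (\<lambda>_. uniform_sphere))
      = (\<integral>\<^sup>+y. (\<Prod>j\<in>?J. indicator (A x) (y j)) \<partial>PiM ?J (\<lambda>_. uniform_sphere))"
    proof (rule nn_integral_cong, rule prod.cong[OF refl])
      fix y j assume "j \<in> ?J"
      moreover have "A (merge U ?J (x, y)) = A x" by (rule dep) (simp add: merge_def)
      ultimately show "indicator (A (merge U ?J (x, y))) (merge U ?J (x, y) j) = (indicator (A x) (y j) :: ennreal)"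
        by (simp add: merge_def)
    qed
    also have "\<dots> = (\<Prod>j\<in>?J. \<integral>\<^sup>+z. indicator (A x) z \<partial>uniform_sphere)"
      by (rule sph.product_nn_integral_prod) (auto intro!: borel_measurable_indicator A)
    also have "\<dots> = ennreal (measure uniform_sphere (A x) ^ (m - card U))"
      using A card_Diff_subset[OF fin U] by (simp add: sph1.emeasure_eq_measure ennreal_power)
    finally show "(\<integral>\<^sup>+y. (\<Prod>j\<in>?J. indicator (A (merge U ?J (x, y))) (merge U ?J (x, y) j)) \<partial>PiM ?J (\<lambda>_. uniform_sphere))
      = ennreal (measure uniform_sphere (A x) ^ (m - card U))" .
  qed
  finally show ?thesis .
qed

lemma nn_integral_tuple:
  fixes h :: "('d::finite \<Rightarrow> real ^ 'd) \<Rightarrow> ennreal"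
  assumes I: "finite I" "card I = CARD('d)" "I \<subseteq> V" and [measurable]: "h \<in> borel_measurable dtuple"
  shows "(\<integral>\<^sup>+x. h (\<lambda>k. x (idx I k)) \<partial>PiM V (\<lambda>_. uniform_sphere)) = (\<integral>\<^sup>+p. h p \<partial>dtuple)"
proof -
  have f: "inj (idx I :: 'd \<Rightarrow> nat)" "(idx I :: 'd \<Rightarrow> nat) \<in> UNIV \<rightarrow> V" using idx_facts[OF I(1,2)] I(3) by auto
  have "(\<integral>\<^sup>+p. h p \<partial>dtuple) = (\<integral>\<^sup>+p. h p \<partial>distr (PiM V (\<lambda>_. uniform_sphere)) dtuple (\<lambda>x. \<lambda>k\<in>UNIV. x (idx I k)))"
    unfolding PiM_uniform_sphere_reindex[OF f] ..
  also have "\<dots> = (\<integral>\<^sup>+x. h (\<lambda>k\<in>UNIV. x (idx I k)) \<partial>PiM V (\<lambda>_. uniform_sphere))"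
    by (rule nn_integral_distr[OF measurable_reindex[OF f(2)]]) simp
  finally show ?thesis by (simp add: restrict_UNIV)
qed

lemma prob_space_random_points: "prob_space (random_points m :: (nat \<Rightarrow> 'a::euclidean_space) measure)"
  unfolding random_points_def by (rule prob_space_PiM_uniform_sphere)

lemma integrable_facet_ind:
  assumes "I \<in> tuples TYPE('d::finite) m"
  shows "integrable (random_points m :: (nat \<Rightarrow> real ^ 'd) measure) (facet_ind m I \<epsilon>)"
proof -
  interpret prob_space "random_points m :: (nat \<Rightarrow> real ^ 'd) measure" by (rule prob_space_random_points)
  show ?thesis
    by (rule integrable_const_bound[where B=1]) (auto simp: facet_ind_bounds measurable_facet_ind[OF assms])
qed

lemma integral_facet_ind:
  assumes T: "I \<in> tuples TYPE('d::finite) m"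
  shows "(\<integral>x. facet_ind m I \<epsilon> x \<partial>(random_points m :: (nat \<Rightarrow> real ^ 'd) measure))
    = (\<integral>p. side_mass undefined \<epsilon> p ^ (m - CARD('d)) \<partial>(dtuple :: ('d \<Rightarrow> real ^ 'd) measure))"
proof -
  note I = tuplesD[OF T]
  have "ennreal (\<integral>x. facet_ind m I \<epsilon> x \<partial>(random_points m :: (nat \<Rightarrow> real ^ 'd) measure)) = (\<integral>\<^sup>+x. ennreal (facet_ind m I \<epsilon> x) \<partial>(random_points m :: (nat \<Rightarrow> real ^ 'd) measure))"
    by (rule nn_integral_eq_integral[symmetric, OF integrable_facet_ind[OF T]]) (simp add: facet_ind_bounds)
  also have "\<dots> = (\<integral>\<^sup>+x. (\<Prod>j\<in>{..<m} - I. indicator (side_of I \<epsilon> x) (x j)) \<partial>(random_points m :: (nat \<Rightarrow> real ^ 'd) measure))"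
    unfolding facet_ind_def by (simp add: prod_ennreal[symmetric] ennreal_indicator)
  also have "\<dots> = (\<integral>\<^sup>+x. ennreal (measure uniform_sphere (side_of I \<epsilon> x) ^ (m - card I)) \<partial>PiM I (\<lambda>_. uniform_sphere :: (real ^ 'd) measure))"
  proof (rule nn_integral_remaining_points[OF I(1)])
    show "side_of I \<epsilon> x = side_of I \<epsilon> y" if "\<And>k. k \<in> I \<Longrightarrow> x k = y k" for x y :: "nat \<Rightarrow> real ^ 'd"
      by (rule side_of_cong[OF I(2,3) that])
    show "j \<in> {..<m} - I \<Longrightarrow> Measurable.pred (random_points m) (\<lambda>x :: nat \<Rightarrow> real ^ 'd. x j \<in> side_of I \<epsilon> x)" for j
      unfolding random_points_def using I by (intro pred_side_of) auto
  qed simp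
  also have "\<dots> = (\<integral>\<^sup>+x. ennreal (side_mass undefined \<epsilon> (\<lambda>k :: 'd. x (idx I k)) ^ (m - CARD('d))) \<partial>PiM I (\<lambda>_. uniform_sphere))"
    by (simp add: side_of_def side_mass_def I(3))
  also have "\<dots> = (\<integral>\<^sup>+p. ennreal (side_mass undefined \<epsilon> p ^ (m - CARD('d))) \<partial>(dtuple :: ('d \<Rightarrow> real ^ 'd) measure))"
    by (rule nn_integral_tuple[OF I(2,3) subset_refl]) measurable
  also have "\<dots> = ennreal (\<integral>p. side_mass undefined \<epsilon> p ^ (m - CARD('d)) \<partial>(dtuple :: ('d \<Rightarrow> real ^ 'd) measure))"
    by (rule nn_integral_eq_integral[OF integrable_side_mass_power]) (simp add: side_mass_nonneg)
  finally show ?thesis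
    by (subst (asm) ennreal_inj) (auto intro!: Bochner_Integration.integral_nonneg simp: facet_ind_bounds side_mass_nonneg)
qed

lemma expected_facets_eq:
  assumes dim: "CARD('d::finite) \<ge> 2" and m: "CARD('d) < m"
  shows "expected_facets TYPE(real ^ 'd) m = real (m choose CARD('d)) * facet_moment TYPE('d) (m - CARD('d))"
proof -
  have "expected_facets TYPE(real ^ 'd) m = (\<integral>x. (\<Sum>I\<in>tuples TYPE('d) m. \<Sum>\<epsilon>\<in>{1, - 1}. facet_ind m I \<epsilon> x) \<partial>(random_points m :: (nat \<Rightarrow> real ^ 'd) measure))"
    unfolding expected_facets_def
  proof (rule Bochner_Integration.integral_cong_AE)
    show "(\<lambda>x. \<Sum>I\<in>tuples TYPE('d) m. \<Sum>\<epsilon>\<in>{1, - 1}. facet_ind m I \<epsilon> x) \<in> borel_measurable (random_points m :: (nat \<Rightarrow> real ^ 'd) measure)"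
      by (intro borel_measurable_sum measurable_facet_ind)
    show "AE x in (random_points m :: (nat \<Rightarrow> real ^ 'd) measure). real (num_facets (hull_of m x)) = (\<Sum>I\<in>tuples TYPE('d) m. \<Sum>\<epsilon>\<in>{1, - 1}. facet_ind m I \<epsilon> x)"
      using AE_points_generic[OF dim, of m] by eventually_elim (rule num_facets_eq_sum[OF _ m])
  qed measurable
  also have "\<dots> = (\<Sum>I\<in>tuples TYPE('d) m. \<Sum>\<epsilon>\<in>{1, - 1}. \<integral>x. facet_ind m I \<epsilon> x \<partial>(random_points m :: (nat \<Rightarrow> real ^ 'd) measure))"
    by (subst Bochner_Integration.integral_sum, intro Bochner_Integration.integrable_sum integrable_facet_ind, assumption)
       (intro sum.cong refl Bochner_Integration.integral_sum integrable_facet_ind)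
  also have "\<dots> = (\<Sum>I\<in>tuples TYPE('d) m. facet_moment TYPE('d) (m - CARD('d)))"
    unfolding facet_moment_def by (intro sum.cong refl integral_facet_ind)
  also have "\<dots> = real (m choose CARD('d)) * facet_moment TYPE('d) (m - CARD('d))"
    by (simp add: card_tuples)
  finally show ?thesis .
qed

section \<open>Pairs of facets\<close>

text \<open>Cut into layers by the integer part \<open>j\<close> of \<open>\<theta> * T\<close>. On
  a layer the integrand is at most \<open>exp (- 1) ^ j\<close>, and the layer has measure at most
  \<open>C * (j + 1) / \<theta>\<close>; the sum of \<open>(j + 1) * z ^ j\<close> is
  \<open>1 / (1 - z)\<^sup>2\<close>.\<close>

lemma nn_integral_exp_le_of_cdf:
  fixes T :: "'a \<Rightarrow> real"
  assumes [measurable]: "T \<in> borel_measurable M" and T0: "\<And>x. 0 \<le> T x" and C: "C \<ge> 0"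
    and cdf: "\<And>s. 0 \<le> s \<Longrightarrow> emeasure M {x \<in> space M. T x \<le> s} \<le> ennreal (C * s)" and \<theta>: "\<theta> > 0"
  shows "(\<integral>\<^sup>+x. ennreal (exp (- (\<theta> * T x))) \<partial>M) \<le> ennreal (C / \<theta> * (1 / (1 - exp (- 1))\<^sup>2))"
proof -
  let ?z = "exp (- 1) :: real"
  let ?A = "\<lambda>j. {x \<in> space M. T x \<le> real (Suc j) / \<theta>}"
  have "(\<integral>\<^sup>+x. ennreal (exp (- (\<theta> * T x))) \<partial>M) \<le> (\<integral>\<^sup>+x. (\<Sum>j. ennreal (?z ^ j) * indicator (?A j) x) \<partial>M)"
  proof (rule nn_integral_mono)
    fix x assume x: "x \<in> space M"
    define j where "j = nat \<lfloor>\<theta> * T x\<rfloor>"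
    have nn: "0 \<le> \<theta> * T x" using \<theta> T0[of x] by simp
    have j: "real j \<le> \<theta> * T x" "\<theta> * T x \<le> real (Suc j)"
      using nn unfolding j_def by (auto simp: of_nat_nat) linarith+
    have "exp (- (\<theta> * T x)) \<le> exp (- real j)" using j(1) by simp
    also have "exp (- real j) = ?z ^ j" using exp_of_nat_mult[of j "- 1 :: real"] by simp
    finally have "ennreal (exp (- (\<theta> * T x))) \<le> ennreal (?z ^ j) * indicator (?A j) x"
      using x j(2) \<theta> by (simp add: indicator_def pos_le_divide_eq mult.commute)
    also have "\<dots> \<le> (\<Sum>j. ennreal (?z ^ j) * indicator (?A j) x)"
    proof -
      have "F j \<le> (\<Sum>j. F j)" for F :: "nat \<Rightarrow> ennreal" using sum_le_suminf[of F "{j}"] by simp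
      then show ?thesis .
    qed
    finally show "ennreal (exp (- (\<theta> * T x))) \<le> (\<Sum>j. ennreal (?z ^ j) * indicator (?A j) x)" .
  qed
  also have "\<dots> = (\<Sum>j. \<integral>\<^sup>+x. ennreal (?z ^ j) * indicator (?A j) x \<partial>M)"
    by (rule nn_integral_suminf) measurable
  also have "\<dots> \<le> (\<Sum>j. ennreal (C / \<theta> * (real (Suc j) * ?z ^ j)))"
  proof (rule suminf_le)
    fix j
    have "(\<integral>\<^sup>+x. ennreal (?z ^ j) * indicator (?A j) x \<partial>M) = ennreal (?z ^ j) * emeasure M (?A j)"
      by (rule nn_integral_cmult_indicator) measurable
    also have "\<dots> \<le> ennreal (?z ^ j) * ennreal (C * (real (Suc j) / \<theta>))"
      using \<theta> by (intro mult_left_mono cdf) auto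
    also have "\<dots> = ennreal (C / \<theta> * (real (Suc j) * ?z ^ j))"
      using C \<theta> by (subst ennreal_mult'[symmetric]) (auto simp: mult_ac)
    finally show "(\<integral>\<^sup>+x. ennreal (?z ^ j) * indicator (?A j) x \<partial>M) \<le> ennreal (C / \<theta> * (real (Suc j) * ?z ^ j))" .
  qed auto
  also have "\<dots> = ennreal (C / \<theta> * (1 / (1 - ?z)\<^sup>2))"
  proof -
    have "(\<lambda>j. real (Suc j) * ?z ^ j) sums (1 / (1 - ?z)\<^sup>2)"
      using geometric_deriv_sums[of ?z] by simp
    then have "(\<lambda>j. C / \<theta> * (real (Suc j) * ?z ^ j)) sums (C / \<theta> * (1 / (1 - ?z)\<^sup>2))" by (rule sums_mult)
    then show ?thesis using C \<theta> by (intro suminf_ennreal_eq) auto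
  qed
  finally show ?thesis .
qed

text \<open>The power of the distance is chosen to match the dimension of the sphere:
  \<open>dist x y ^ (CARD('d) - 1) \<le> s\<close> has probability at most linear in
  \<open>s\<close>, by the upper bound for balls.\<close>

lemma uniform_sphere_exp_dist_bound:
  assumes dim: "CARD('d::finite) \<ge> 2"
  shows "\<exists>C>0. \<forall>(y :: real ^ 'd) \<theta>. norm y = 1 \<longrightarrow> \<theta> > 0 \<longrightarrow>
    (\<integral>\<^sup>+x. ennreal (exp (- (\<theta> * dist x y ^ (CARD('d) - 1)))) \<partial>uniform_sphere) \<le> ennreal (C / \<theta>)"
proof -
  let ?n = "CARD('d) - 1"
  have n: "?n > 0" using dim by simp
  obtain C where C: "C > 0" "\<And>x r. norm (x :: real ^ 'd) = 1 \<Longrightarrow> 0 \<le> r \<Longrightarrow> measure uniform_sphere (cball x r) \<le> C * r ^ ?n"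
    using uniform_sphere_cball_upper[where 'd='d] by blast
  let ?K = "1 / (1 - exp (- 1) :: real)\<^sup>2"
  have K: "?K > 0" by simp
  have "(\<integral>\<^sup>+x. ennreal (exp (- (\<theta> * dist x y ^ ?n))) \<partial>uniform_sphere) \<le> ennreal (C * ?K / \<theta>)"
    if y: "norm y = 1" and \<theta>: "\<theta> > 0" for y :: "real ^ 'd" and \<theta>
  proof -
    have "(\<integral>\<^sup>+x. ennreal (exp (- (\<theta> * dist x y ^ ?n))) \<partial>uniform_sphere) \<le> ennreal (C / \<theta> * ?K)"
    proof (rule nn_integral_exp_le_of_cdf[OF _ _ _ _ \<theta>])
      fix s :: real assume s: "0 \<le> s"
      have "{x \<in> space uniform_sphere. dist x y ^ ?n \<le> s} \<subseteq> cball y (root ?n s)"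
      proof
        fix x assume "x \<in> {x \<in> space uniform_sphere. dist x y ^ ?n \<le> s}"
        then have "root ?n (dist x y ^ ?n) \<le> root ?n s" using n by simp
        then show "x \<in> cball y (root ?n s)" using n by (simp add: real_root_power_cancel dist_commute)
      qed
      then have "emeasure uniform_sphere {x \<in> space uniform_sphere. dist x y ^ ?n \<le> s} \<le> emeasure uniform_sphere (cball y (root ?n s))"
        by (rule emeasure_mono) simp
      also have "\<dots> \<le> ennreal (C * root ?n s ^ ?n)"
        unfolding sph1.emeasure_eq_measure using s by (intro ennreal_leI C(2) y real_root_ge_zero)
      finally show "emeasure uniform_sphere {x \<in> space uniform_sphere. dist x y ^ ?n \<le> s} \<le> ennreal (C * s)"
        using n s by simp
    qed (use C in auto)
    then show ?thesis by (simp add: mult_ac)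
  qed
  moreover have "C * ?K > 0" using C(1) K by simp
  ultimately show ?thesis by blast
qed

text \<open>Once the point \<open>k1\<close> is fixed, the factors are independent and each costs
  \<open>C / \<theta>\<close>. The free position of \<open>k1\<close> is the reason for the exponent
  \<open>card U - 1\<close>.\<close>

lemma nn_integral_cluster:
  assumes dim: "CARD('d::finite) \<ge> 2"
  shows "\<exists>C>0. \<forall>(U :: nat set) k1 \<theta>. finite U \<longrightarrow> k1 \<in> U \<longrightarrow> \<theta> > 0 \<longrightarrow>
    (\<integral>\<^sup>+x. ennreal (\<Prod>k\<in>U - {k1}. exp (- (\<theta> * dist (x k) (x k1) ^ (CARD('d) - 1)))) \<partial>PiM U (\<lambda>_. uniform_sphere :: (real ^ 'd) measure))
      \<le> ennreal ((C / \<theta>) ^ (card U - 1))"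
proof -
  let ?n = "CARD('d) - 1"
  obtain C where C: "C > 0" and bd: "\<And>(y :: real ^ 'd) \<theta>. norm y = 1 \<Longrightarrow> \<theta> > 0 \<Longrightarrow>
    (\<integral>\<^sup>+x. ennreal (exp (- (\<theta> * dist x y ^ ?n))) \<partial>uniform_sphere) \<le> ennreal (C / \<theta>)"
    using uniform_sphere_exp_dist_bound[OF dim] by blast
  have "(\<integral>\<^sup>+x. ennreal (\<Prod>k\<in>U - {k1}. exp (- (\<theta> * dist (x k) (x k1) ^ ?n))) \<partial>PiM U (\<lambda>_. uniform_sphere :: (real ^ 'd) measure))
      \<le> ennreal ((C / \<theta>) ^ (card U - 1))" if U: "finite U" "k1 \<in> U" and \<theta>: "\<theta> > 0" for U :: "nat set" and k1 \<theta>
  proof -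
    let ?V = "U - {k1}"
    let ?f = "\<lambda>x :: nat \<Rightarrow> real ^ 'd. \<Prod>k\<in>?V. ennreal (exp (- (\<theta> * dist (x k) (x k1) ^ ?n)))"
    have ins: "insert k1 ?V = U" using U by auto
    have fm: "?f \<in> borel_measurable (PiM (insert k1 ?V) (\<lambda>_. uniform_sphere :: (real ^ 'd) measure))"
    proof (intro borel_measurable_prod_ennreal)
      fix k assume "k \<in> ?V"
      then have [measurable]: "(\<lambda>x. x k) \<in> borel_measurable (PiM U (\<lambda>_. uniform_sphere :: (real ^ 'd) measure))"
        "(\<lambda>x. x k1) \<in> borel_measurable (PiM U (\<lambda>_. uniform_sphere :: (real ^ 'd) measure))"
        using U by (auto intro: measurable_coordinate)
      show "(\<lambda>x. ennreal (exp (- (\<theta> * dist (x k) (x k1) ^ ?n)))) \<in> borel_measurable (PiM (insert k1 ?V) (\<lambda>_. uniform_sphere :: (real ^ 'd) measure))"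
        unfolding ins by measurable
    qed
    have "(\<integral>\<^sup>+x. ennreal (\<Prod>k\<in>?V. exp (- (\<theta> * dist (x k) (x k1) ^ ?n))) \<partial>PiM U (\<lambda>_. uniform_sphere :: (real ^ 'd) measure))
      = (\<integral>\<^sup>+x. ?f x \<partial>PiM (insert k1 ?V) (\<lambda>_. uniform_sphere))"
      unfolding ins by (simp add: prod_ennreal)
    also have "\<dots> = (\<integral>\<^sup>+y. (\<integral>\<^sup>+x. ?f (x(k1 := y)) \<partial>PiM ?V (\<lambda>_. uniform_sphere)) \<partial>(uniform_sphere :: (real ^ 'd) measure))"
      by (rule sph.product_nn_integral_insert_rev) (use U fm in auto)
    also have "\<dots> \<le> (\<integral>\<^sup>+y. ennreal ((C / \<theta>) ^ (card U - 1)) \<partial>(uniform_sphere :: (real ^ 'd) measure))"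
    proof (rule nn_integral_mono_AE, use AE_uniform_sphere in eventually_elim)
      fix y :: "real ^ 'd" assume "y \<in> sphere 0 1"
      then have y: "norm y = 1" by simp
      have "(\<integral>\<^sup>+x. ?f (x(k1 := y)) \<partial>PiM ?V (\<lambda>_. uniform_sphere))
         = (\<integral>\<^sup>+x. (\<Prod>k\<in>?V. ennreal (exp (- (\<theta> * dist (x k) y ^ ?n)))) \<partial>PiM ?V (\<lambda>_. uniform_sphere))"
        by (intro nn_integral_cong prod.cong) auto
      also have "\<dots> = (\<Prod>k\<in>?V. \<integral>\<^sup>+z. ennreal (exp (- (\<theta> * dist z y ^ ?n))) \<partial>uniform_sphere)"
        by (rule sph.product_nn_integral_prod[where f="\<lambda>_ z. ennreal (exp (- (\<theta> * dist z y ^ ?n)))"]) (use U in auto)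
      also have "\<dots> \<le> (\<Prod>k\<in>?V. ennreal (C / \<theta>))"
        by (intro prod_mono_ennreal bd y \<theta>)
      also have "\<dots> = ennreal ((C / \<theta>) ^ (card U - 1))"
        using U C \<theta> by (simp add: ennreal_power card_Diff_singleton)
      finally show "(\<integral>\<^sup>+x. ?f (x(k1 := y)) \<partial>PiM ?V (\<lambda>_. uniform_sphere)) \<le> ennreal ((C / \<theta>) ^ (card U - 1))" .
    qed
    also have "\<dots> = ennreal ((C / \<theta>) ^ (card U - 1))"
      using prob_space.emeasure_space_1[OF prob_space_uniform_sphere[where 'a="real ^ 'd"]] by simp
    finally show ?thesis .
  qed
  with C show ?thesis by blast
qed

lemma compl_side_of:
  fixes x :: "nat \<Rightarrow> real ^ 'd::finite"
  shows "- side_of I \<epsilon> x = {y. - \<epsilon> * (nrm undefined (\<lambda>k. x (idx I k)) \<bullet> x (idx I (undefined :: 'd))) \<le> (- \<epsilon> *\<^sub>R nrm undefined (\<lambda>k. x (idx I k))) \<bullet> y}"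
  by (auto simp: side_of_def side_def not_less inner_diff_right right_diff_distrib)

lemma vertices_in_compl_side_of:
  assumes "finite I" "card I = CARD('d::finite)" "k \<in> I"
  shows "(x :: nat \<Rightarrow> real ^ 'd) k \<in> - side_of I \<epsilon> x"
proof -
  obtain l :: 'd where "k = idx I l" using idx_eqD[OF assms(1,2)] assms(3) by blast
  then show ?thesis
    using nrm_orthogonal[of undefined "\<lambda>k. x (idx I k)" l] by (simp add: side_of_def side_def)
qed

text \<open>Two empty caps either are disjoint, and then the joint probability is at most the product,
  or they meet, and then all the points lie within a distance controlled by the larger cap.\<close>

lemma joint_side_mass_le:
  fixes x :: "nat \<Rightarrow> real ^ 'd::finite"
  assumes c: "c > 0" and cap: "\<And>(a :: real ^ 'd) b y z. a \<noteq> 0 \<Longrightarrow> norm y = 1 \<Longrightarrow> norm z = 1 \<Longrightarrow> b \<le> a \<bullet> y \<Longrightarrow> b \<le> a \<bullet> z \<Longrightarrow>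
     c * dist y z ^ n \<le> measure uniform_sphere {x. b \<le> a \<bullet> x}"
    and n: "n > 0"
    and I: "finite I" "card I = CARD('d)" and J: "finite J" "card J = CARD('d)"
    and eps: "\<epsilon> \<in> {1, - 1}" "\<delta> \<in> {1, - 1}"
    and nI: "nrm undefined (\<lambda>k :: 'd. x (idx I k)) \<noteq> 0" and nJ: "nrm undefined (\<lambda>k :: 'd. x (idx J k)) \<noteq> 0"
    and x1: "\<And>k. k \<in> I \<union> J \<Longrightarrow> norm (x k) = 1" and k1: "k1 \<in> I \<union> J"
    and \<theta>: "\<theta> = real q * (c / 2 ^ n / (2 * CARD('d)))"
  shows "measure uniform_sphere (side_of I \<epsilon> x \<inter> side_of J \<delta> x) ^ q
    \<le> (if I \<inter> J = {} then (measure uniform_sphere (side_of I \<epsilon> x) * measure uniform_sphere (side_of J \<delta> x)) ^ q else 0)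
      + (\<Prod>k\<in>I \<union> J - {k1}. exp (- (\<theta> * dist (x k) (x k1) ^ n)))"
proof -
  let ?\<mu> = "measure (uniform_sphere :: (real ^ 'd) measure)"
  define A where "A = - side_of I \<epsilon> x"
  define B where "B = - side_of J \<delta> x"
  have mA [measurable]: "A \<in> sets borel" and mB [measurable]: "B \<in> sets borel" by (simp_all add: A_def B_def)
  have compl: "?\<mu> (- D) = 1 - ?\<mu> D" if "D \<in> sets borel" for D
    using sph1.prob_compl[of D] that by (simp add: Compl_eq_Diff_UNIV)
  have sI: "?\<mu> (side_of I \<epsilon> x) = 1 - ?\<mu> A" and sJ: "?\<mu> (side_of J \<delta> x) = 1 - ?\<mu> B"
    unfolding A_def B_def by (simp_all add: compl)
  have sIJ: "?\<mu> (side_of I \<epsilon> x \<inter> side_of J \<delta> x) = 1 - ?\<mu> (A \<union> B)"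
  proof -
    have "side_of I \<epsilon> x \<inter> side_of J \<delta> x = - (A \<union> B)" by (auto simp: A_def B_def)
    then show ?thesis using compl[of "A \<union> B"] mA mB by (simp only: sets.Un)
  qed
  let ?S = "sphere 0 1 :: (real ^ 'd) set"
  have Acap: "c * dist y z ^ n \<le> ?\<mu> A" if "y \<in> A \<inter> ?S" "z \<in> A \<inter> ?S" for y z
    using that eps nI unfolding A_def compl_side_of by (intro cap) auto
  have Bcap: "c * dist y z ^ n \<le> ?\<mu> B" if "y \<in> B \<inter> ?S" "z \<in> B \<inter> ?S" for y z
    using that eps nJ unfolding B_def compl_side_of by (intro cap) auto
  have inA: "x k \<in> A \<inter> ?S" if "k \<in> I" for k using vertices_in_compl_side_of[OF I that] x1 that by (simp add: A_def)
  have inB: "x k \<in> B \<inter> ?S" if "k \<in> J" for k using vertices_in_compl_side_of[OF J that] x1 that by (simp add: B_def)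
  have prod0: "0 \<le> (\<Prod>k\<in>I \<union> J - {k1}. exp (- (\<theta> * dist (x k) (x k1) ^ n)))" by (intro prod_nonneg) auto
  show ?thesis
  proof (cases "A \<inter> B \<inter> ?S = {}")
    case True
    \<comment> \<open>The vertices of a facet belong to its closed cap, so a shared vertex would lie
      in both caps.\<close>
    have "I \<inter> J = {}" using True inA inB by blast
    have "?\<mu> (A \<union> B) = ?\<mu> (A \<inter> ?S \<union> B \<inter> ?S)"
      by (rule sph1.finite_measure_eq_AE) (use AE_uniform_sphere in \<open>auto elim!: eventually_mono\<close>)
    also have "\<dots> = ?\<mu> (A \<inter> ?S) + ?\<mu> (B \<inter> ?S)"
      using True by (intro sph1.finite_measure_Union) auto
    also have "?\<mu> (A \<inter> ?S) = ?\<mu> A"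
      by (rule sph1.finite_measure_eq_AE) (use AE_uniform_sphere in \<open>auto elim!: eventually_mono\<close>)
    also have "?\<mu> (B \<inter> ?S) = ?\<mu> B"
      by (rule sph1.finite_measure_eq_AE) (use AE_uniform_sphere in \<open>auto elim!: eventually_mono\<close>)
    finally have AB: "?\<mu> (A \<union> B) = ?\<mu> A + ?\<mu> B" .
    have "1 - ?\<mu> (A \<union> B) \<le> (1 - ?\<mu> A) * (1 - ?\<mu> B)" unfolding AB by (simp add: algebra_simps)
    then have "(1 - ?\<mu> (A \<union> B)) ^ q \<le> ((1 - ?\<mu> A) * (1 - ?\<mu> B)) ^ q" by (intro power_mono) auto
    then show ?thesis unfolding sI sJ sIJ using \<open>I \<inter> J = {}\<close> prod0 by simp
  next
    case False
    then obtain y where y: "y \<in> A \<inter> ?S" "y \<in> B \<inter> ?S" by blast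
    define \<tau> where "\<tau> = ?\<mu> (A \<union> B)"
    have \<tau>: "0 \<le> \<tau>" "\<tau> \<le> 1" by (simp_all add: \<tau>_def)
    have AB: "?\<mu> A \<le> \<tau>" "?\<mu> B \<le> \<tau>" unfolding \<tau>_def by (auto intro!: sph1.finite_measure_mono)
    have near: "c * dist (x k) y ^ n \<le> \<tau>" if "k \<in> I \<union> J" for k
      using that Acap[OF inA y(1), of k] Bcap[OF inB y(2), of k] AB by fastforce
    \<comment> \<open>The common point \<open>y\<close> of the two caps links any two vertices by
      the triangle inequality, at the cost of the factor \<open>2 ^ n\<close>.\<close>
    have pair: "c / 2 ^ n * dist (x k) (x k1) ^ n \<le> \<tau>" if k: "k \<in> I \<union> J" for k
    proof -
      define M where "M = max (dist (x k) y) (dist (x k1) y)"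
      have "dist (x k) (x k1) \<le> dist (x k) y + dist (x k1) y" by (rule dist_triangle2)
      also have "\<dots> \<le> 2 * M" by (simp add: M_def)
      finally have "dist (x k) (x k1) ^ n \<le> (2 * M) ^ n" by (intro power_mono) auto
      then have "c / 2 ^ n * dist (x k) (x k1) ^ n \<le> c / 2 ^ n * (2 * M) ^ n" using c by (intro mult_left_mono) auto
      also have "\<dots> = c * M ^ n" by (simp add: power_mult_distrib)
      also have "\<dots> \<le> \<tau>" using near[OF k] near[OF k1] by (simp add: M_def max_def)
      finally show ?thesis .
    qed
    \<comment> \<open>Dividing by \<open>2 * CARD('d)\<close>, an upper bound for the number of
      vertices, shares \<open>\<tau>\<close> among them. Thus the single bound
      \<open>exp (- (q * \<tau>))\<close> is at most a product over all vertices other than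
      \<open>k1\<close>.\<close>
    let ?c0 = "c / 2 ^ n / (2 * CARD('d))"
    have cU: "card (I \<union> J) \<le> 2 * CARD('d)" using card_Un_le[of I J] I(2) J(2) by simp
    have "(\<Sum>k\<in>I \<union> J - {k1}. ?c0 * dist (x k) (x k1) ^ n) \<le> (\<Sum>k\<in>I \<union> J - {k1}. \<tau> / (2 * CARD('d)))"
    proof (rule sum_mono)
      fix k assume "k \<in> I \<union> J - {k1}"
      then have "c / 2 ^ n * dist (x k) (x k1) ^ n / (2 * CARD('d)) \<le> \<tau> / (2 * CARD('d))"
        by (intro divide_right_mono pair) auto
      then show "?c0 * dist (x k) (x k1) ^ n \<le> \<tau> / (2 * CARD('d))" by simp
    qed
    also have "\<dots> = real (card (I \<union> J - {k1})) * (\<tau> / (2 * CARD('d)))" by simp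
    also have "\<dots> \<le> (2 * CARD('d)) * (\<tau> / (2 * CARD('d)))"
    proof (rule mult_right_mono)
      have "card (I \<union> J - {k1}) \<le> 2 * CARD('d)" using cU card_Diff1_le[of "I \<union> J" k1] by linarith
      then show "real (card (I \<union> J - {k1})) \<le> real (2 * CARD('d))" by (rule of_nat_mono)
    qed (use \<tau> in auto)
    also have "\<dots> = \<tau>" by simp
    finally have s: "(\<Sum>k\<in>I \<union> J - {k1}. ?c0 * dist (x k) (x k1) ^ n) \<le> \<tau>" .
    have "1 - \<tau> \<le> exp (- \<tau>)" using exp_ge_add_one_self[of "- \<tau>"] by simp
    then have "(1 - \<tau>) ^ q \<le> exp (- \<tau>) ^ q" using \<tau> by (intro power_mono) auto
    also have "\<dots> = exp (- (real q * \<tau>))" using exp_of_nat_mult[of q "- \<tau>"] by simp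
    also have "\<dots> \<le> exp (- (real q * (\<Sum>k\<in>I \<union> J - {k1}. ?c0 * dist (x k) (x k1) ^ n)))"
      using s by (simp add: mult_left_mono)
    also have "- (real q * (\<Sum>k\<in>I \<union> J - {k1}. ?c0 * dist (x k) (x k1) ^ n)) = (\<Sum>k\<in>I \<union> J - {k1}. - (\<theta> * dist (x k) (x k1) ^ n))"
      unfolding \<theta> by (simp add: sum_distrib_left sum_negf mult.assoc)
    also have "exp (\<Sum>k\<in>I \<union> J - {k1}. - (\<theta> * dist (x k) (x k1) ^ n)) = (\<Prod>k\<in>I \<union> J - {k1}. exp (- (\<theta> * dist (x k) (x k1) ^ n)))"
      using I(1) J(1) by (intro exp_sum) auto
    finally have "?\<mu> (side_of I \<epsilon> x \<inter> side_of J \<delta> x) ^ q \<le> (\<Prod>k\<in>I \<union> J - {k1}. exp (- (\<theta> * dist (x k) (x k1) ^ n)))"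
      unfolding sIJ \<tau>_def .
    then show ?thesis by (rule order_trans) simp
  qed
qed

section \<open>Variance and the main theorem\<close>

text \<open>Disjoint tuples leave exactly \<open>m - 2 * CARD('d)\<close> points, whence the
  exponent in the product. Meeting tuples have no product term, and there it is added only as a
  nonnegative quantity to keep the statement uniform.\<close>

lemma facet_ind_joint_bound:
  assumes dim: "CARD('d::finite) \<ge> 2"
  shows "\<exists>D\<ge>1. \<forall>m I J \<epsilon> \<delta>. 4 * CARD('d) \<le> m \<longrightarrow> I \<in> tuples TYPE('d) m \<longrightarrow> J \<in> tuples TYPE('d) m \<longrightarrow>
     \<epsilon> \<in> {1, - 1} \<longrightarrow> \<delta> \<in> {1, - 1} \<longrightarrow>
    (\<integral>x. facet_ind m I \<epsilon> x * facet_ind m J \<delta> x \<partial>(random_points m :: (nat \<Rightarrow> real ^ 'd) measure))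
    \<le> (\<integral>p. side_mass undefined \<epsilon> p ^ (m - 2 * CARD('d)) \<partial>(dtuple :: ('d \<Rightarrow> real ^ 'd) measure))
       * (\<integral>p. side_mass undefined \<delta> p ^ (m - 2 * CARD('d)) \<partial>(dtuple :: ('d \<Rightarrow> real ^ 'd) measure))
      + (D / real m) ^ (card (I \<union> J) - 1)"
proof -
  let ?d = "CARD('d)" and ?n = "CARD('d) - 1" and ?u = "undefined :: 'd"
  let ?\<mu> = "measure (uniform_sphere :: (real ^ 'd) measure)"
  have n: "?n > 0" using dim by simp
  obtain c where c: "c > 0" and cap: "\<And>(a :: real ^ 'd) b y z. a \<noteq> 0 \<Longrightarrow> norm y = 1 \<Longrightarrow> norm z = 1 \<Longrightarrow> b \<le> a \<bullet> y \<Longrightarrow> b \<le> a \<bullet> z \<Longrightarrow>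
     c * dist y z ^ ?n \<le> measure uniform_sphere {x. b \<le> a \<bullet> x}"
    using uniform_sphere_cap_lower[OF dim] by blast
  obtain C where C: "C > 0" and cluster: "\<And>(U :: nat set) k1 \<theta>. finite U \<Longrightarrow> k1 \<in> U \<Longrightarrow> \<theta> > 0 \<Longrightarrow>
    (\<integral>\<^sup>+x. ennreal (\<Prod>k\<in>U - {k1}. exp (- (\<theta> * dist (x k) (x k1) ^ ?n))) \<partial>PiM U (\<lambda>_. uniform_sphere :: (real ^ 'd) measure))
      \<le> ennreal ((C / \<theta>) ^ (card U - 1))"
    using nn_integral_cluster[OF dim] by blast
  define c0 where "c0 = c / 2 ^ ?n / (2 * real ?d)"
  have c0: "c0 > 0" using c by (simp add: c0_def)
  \<comment> \<open>From \<open>m \<ge> 4 * CARD('d)\<close> at least \<open>m / 2\<close> points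
    lie outside the two tuples, so \<open>\<theta> \<ge> c0 * m / 2\<close> and
    \<open>C / \<theta> \<le> (2 * C / c0) / m\<close>.\<close>
  define D where "D = max 1 (2 * C / c0)"
  have main: "(\<integral>x. facet_ind m I \<epsilon> x * facet_ind m J \<delta> x \<partial>(random_points m :: (nat \<Rightarrow> real ^ 'd) measure))
    \<le> (\<integral>p. side_mass ?u \<epsilon> p ^ (m - 2 * ?d) \<partial>dtuple) * (\<integral>p. side_mass ?u \<delta> p ^ (m - 2 * ?d) \<partial>dtuple) + (D / real m) ^ (card (I \<union> J) - 1)"
    if m: "4 * ?d \<le> m" and TI: "I \<in> tuples TYPE('d) m" and TJ: "J \<in> tuples TYPE('d) m"
      and eps: "\<epsilon> \<in> {1, - 1}" "\<delta> \<in> {1, - 1}" for m I J \<epsilon> \<delta>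
  proof -
    note I = tuplesD[OF TI] and J = tuplesD[OF TJ]
    let ?R = "random_points m :: (nat \<Rightarrow> real ^ 'd) measure"
    define U where "U = I \<union> J"
    let ?P = "PiM U (\<lambda>_. uniform_sphere :: (real ^ 'd) measure)"
    have finU: "finite U" and U: "U \<subseteq> {..<m}" using I J by (auto simp: U_def)
    have cU: "card U \<le> 2 * ?d" using card_Un_le[of I J] I(3) J(3) by (simp add: U_def)
    define q where "q = m - card U"
    have q2: "real m \<le> 2 * real q" and qpos: "q > 0" and mpos: "m > 0" using cU m dim by (auto simp: q_def)
    define \<theta> where "\<theta> = real q * c0"
    have \<theta>: "\<theta> > 0" using qpos c0 by (simp add: \<theta>_def)
    define k1 where "k1 = idx I ?u"
    have k1: "k1 \<in> U" using idx_facts(2)[OF I(2,3), of ?u] by (simp add: k1_def U_def)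
    let ?a = "\<lambda>\<epsilon> I x. measure uniform_sphere (side_of I \<epsilon> (x :: nat \<Rightarrow> real ^ 'd))"
    let ?prod = "\<lambda>x :: nat \<Rightarrow> real ^ 'd. \<Prod>k\<in>U - {k1}. exp (- (\<theta> * dist (x k) (x k1) ^ ?n))"
    define s where "s \<epsilon> = (\<integral>p. side_mass ?u \<epsilon> p ^ (m - 2 * ?d) \<partial>(dtuple :: ('d \<Rightarrow> real ^ 'd) measure))" for \<epsilon>
    have s0: "s \<epsilon> \<ge> 0" for \<epsilon> unfolding s_def by (intro Bochner_Integration.integral_nonneg) (simp add: side_mass_nonneg)
    have amass: "?a \<epsilon> I x = side_mass ?u \<epsilon> (\<lambda>k. x (idx I k))" for \<epsilon> I x by (simp add: side_of_def side_mass_def)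
    have am: "(\<lambda>x. ?a \<epsilon> I' x) \<in> borel_measurable (PiM V (\<lambda>_. uniform_sphere))"
      if "I' \<in> tuples TYPE('d) m" "I' \<subseteq> V" for I' V \<epsilon>
      unfolding amass
    proof (rule borel_measurable_side_mass)
      fix k :: 'd
      have "idx I' k \<in> V" using idx_facts(2)[OF tuplesD(2,3)[OF that(1)], of k] that(2) by blast
      then show "(\<lambda>x. x (idx I' k)) \<in> borel_measurable (PiM V (\<lambda>_. uniform_sphere :: (real ^ 'd) measure))" by (rule measurable_coordinate)
    qed
    have "integrable ?R (\<lambda>x. facet_ind m I \<epsilon> x * facet_ind m J \<delta> x)"
    proof -
      interpret prob_space ?R by (rule prob_space_random_points)
      show ?thesis
        by (rule integrable_const_bound[where B=1])
          (auto simp: facet_ind_bounds mult_le_one intro!: borel_measurable_times measurable_facet_ind TI TJ)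
    qed
    then have "ennreal (\<integral>x. facet_ind m I \<epsilon> x * facet_ind m J \<delta> x \<partial>?R) = (\<integral>\<^sup>+x. ennreal (facet_ind m I \<epsilon> x * facet_ind m J \<delta> x) \<partial>?R)"
      by (rule nn_integral_eq_integral[symmetric]) (simp add: facet_ind_bounds)
    \<comment> \<open>The conditions on the vertices themselves, that those of one facet lie on the
      right side of the other, are dropped; only the points outside \<open>U\<close> are
      kept.\<close>
    also have "\<dots> \<le> (\<integral>\<^sup>+x. (\<Prod>j\<in>{..<m} - U. indicator (side_of I \<epsilon> x \<inter> side_of J \<delta> x) (x j)) \<partial>?R)"
    proof (rule nn_integral_mono)
      fix x :: "nat \<Rightarrow> real ^ 'd"
      show "ennreal (facet_ind m I \<epsilon> x * facet_ind m J \<delta> x) \<le> (\<Prod>j\<in>{..<m} - U. indicator (side_of I \<epsilon> x \<inter> side_of J \<delta> x) (x j))"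
      proof (cases "(\<forall>j\<in>{..<m} - I. x j \<in> side_of I \<epsilon> x) \<and> (\<forall>j\<in>{..<m} - J. x j \<in> side_of J \<delta> x)")
        case True
        then have "(\<Prod>j\<in>{..<m} - U. indicator (side_of I \<epsilon> x \<inter> side_of J \<delta> x) (x j)) = (1 :: ennreal)"
          by (intro prod.neutral) (auto simp: U_def)
        moreover have "facet_ind m I \<epsilon> x * facet_ind m J \<delta> x \<le> 1" by (intro mult_le_one facet_ind_bounds)
        ultimately show ?thesis by simp
      next
        case False
        then have "facet_ind m I \<epsilon> x = 0 \<or> facet_ind m J \<delta> x = 0" unfolding facet_ind_eq by auto
        then have "facet_ind m I \<epsilon> x * facet_ind m J \<delta> x = 0" by simp
        then show ?thesis by (simp only: ennreal_0 zero_le)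
      qed
    qed
    also have "\<dots> = (\<integral>\<^sup>+x. ennreal (?\<mu> (side_of I \<epsilon> x \<inter> side_of J \<delta> x) ^ (m - card U)) \<partial>?P)"
    proof (rule nn_integral_remaining_points[OF U])
      show "side_of I \<epsilon> x \<inter> side_of J \<delta> x = side_of I \<epsilon> y \<inter> side_of J \<delta> y" if "\<And>k. k \<in> U \<Longrightarrow> x k = y k" for x y :: "nat \<Rightarrow> real ^ 'd"
        using side_of_cong[OF I(2,3), of x y \<epsilon>] side_of_cong[OF J(2,3), of x y \<delta>] that by (simp add: U_def)
      fix j assume j: "j \<in> {..<m} - U"
      have [measurable]: "Measurable.pred ?R (\<lambda>x. x j \<in> side_of I \<epsilon> x)" "Measurable.pred ?R (\<lambda>x. x j \<in> side_of J \<delta> x)"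
        unfolding random_points_def using I J j by (auto intro!: pred_side_of)
      show "Measurable.pred ?R (\<lambda>x. x j \<in> side_of I \<epsilon> x \<inter> side_of J \<delta> x)"
        unfolding Int_iff by measurable
    qed simp
    also have "\<dots> \<le> (\<integral>\<^sup>+x. ennreal (if I \<inter> J = {} then (?a \<epsilon> I x * ?a \<delta> J x) ^ q else 0) + ennreal (?prod x) \<partial>?P)"
    proof (rule nn_integral_mono_AE)
      have fI: "inj (idx I :: 'd \<Rightarrow> nat)" "(idx I :: 'd \<Rightarrow> nat) \<in> UNIV \<rightarrow> U" using idx_facts[OF I(2,3)] by (auto simp: U_def)
      have fJ: "inj (idx J :: 'd \<Rightarrow> nat)" "(idx J :: 'd \<Rightarrow> nat) \<in> UNIV \<rightarrow> U" using idx_facts[OF J(2,3)] by (auto simp: U_def)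
      note aI = AE_PiM_uniform_sphere_reindex[OF fI AE_nrm_nonzero[OF dim, of ?u]]
      note aJ = AE_PiM_uniform_sphere_reindex[OF fJ AE_nrm_nonzero[OF dim, of ?u]]
      show "AE x in ?P. ennreal (?\<mu> (side_of I \<epsilon> x \<inter> side_of J \<delta> x) ^ (m - card U))
         \<le> ennreal (if I \<inter> J = {} then (?a \<epsilon> I x * ?a \<delta> J x) ^ q else 0) + ennreal (?prod x)"
        using AE_PiM_uniform_sphere_component[OF finU AE_uniform_sphere] aI aJ
      proof eventually_elim
        fix x :: "nat \<Rightarrow> real ^ 'd"
        assume x1: "\<forall>k\<in>U. x k \<in> sphere 0 1" and nI: "nrm ?u (\<lambda>k\<in>UNIV. x (idx I k)) \<noteq> 0" and nJ: "nrm ?u (\<lambda>k\<in>UNIV. x (idx J k)) \<noteq> 0"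
        have "?\<mu> (side_of I \<epsilon> x \<inter> side_of J \<delta> x) ^ q \<le> (if I \<inter> J = {} then (?a \<epsilon> I x * ?a \<delta> J x) ^ q else 0)
          + (\<Prod>k\<in>I \<union> J - {k1}. exp (- (\<theta> * dist (x k) (x k1) ^ ?n)))"
        proof (rule joint_side_mass_le[OF c cap n I(2,3) J(2,3) eps])
          show "nrm ?u (\<lambda>k. x (idx I k)) \<noteq> 0" "nrm ?u (\<lambda>k. x (idx J k)) \<noteq> 0" using nI nJ by (simp_all add: restrict_UNIV)
          show "norm (x k) = 1" if "k \<in> I \<union> J" for k using x1 that by (simp add: U_def)
          show "k1 \<in> I \<union> J" using k1 by (simp add: U_def)
          show "\<theta> = real q * (c / 2 ^ ?n / real (2 * ?d))" by (simp add: \<theta>_def c0_def)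
        qed
        then have "ennreal (?\<mu> (side_of I \<epsilon> x \<inter> side_of J \<delta> x) ^ q)
          \<le> ennreal ((if I \<inter> J = {} then (?a \<epsilon> I x * ?a \<delta> J x) ^ q else 0) + ?prod x)"
          unfolding U_def by (rule ennreal_leI)
        also have "\<dots> = ennreal (if I \<inter> J = {} then (?a \<epsilon> I x * ?a \<delta> J x) ^ q else 0) + ennreal (?prod x)"
          by (rule ennreal_plus) (auto intro!: prod_nonneg)
        finally show "ennreal (?\<mu> (side_of I \<epsilon> x \<inter> side_of J \<delta> x) ^ (m - card U))
         \<le> ennreal (if I \<inter> J = {} then (?a \<epsilon> I x * ?a \<delta> J x) ^ q else 0) + ennreal (?prod x)" unfolding q_def .
      qed
    qed
    also have "\<dots> = (\<integral>\<^sup>+x. ennreal (if I \<inter> J = {} then (?a \<epsilon> I x * ?a \<delta> J x) ^ q else 0) \<partial>?P) + (\<integral>\<^sup>+x. ennreal (?prod x) \<partial>?P)"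
    proof (rule nn_integral_add)
      have [measurable]: "(\<lambda>x. ?a \<epsilon> I x) \<in> borel_measurable ?P" "(\<lambda>x. ?a \<delta> J x) \<in> borel_measurable ?P"
        by (auto intro!: am TI TJ simp: U_def)
      show "(\<lambda>x. ennreal (if I \<inter> J = {} then (?a \<epsilon> I x * ?a \<delta> J x) ^ q else 0)) \<in> borel_measurable ?P"
        by (cases "I \<inter> J = {}") simp_all
      have "(\<lambda>x. exp (- (\<theta> * dist (x k) (x k1) ^ ?n))) \<in> borel_measurable ?P" if "k \<in> U" for k
      proof -
        note [measurable] = measurable_coordinate[OF that] measurable_coordinate[OF k1]
        show ?thesis by measurable
      qed
      then have "?prod \<in> borel_measurable ?P" by (intro borel_measurable_prod) auto
      then show "(\<lambda>x. ennreal (?prod x)) \<in> borel_measurable ?P" by simp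
    qed
    also have "\<dots> \<le> ennreal (s \<epsilon> * s \<delta>) + ennreal ((D / real m) ^ (card U - 1))"
    proof (rule add_mono)
      show "(\<integral>\<^sup>+x. ennreal (if I \<inter> J = {} then (?a \<epsilon> I x * ?a \<delta> J x) ^ q else 0) \<partial>?P) \<le> ennreal (s \<epsilon> * s \<delta>)"
      proof (cases "I \<inter> J = {}")
        case True
        have q: "q = m - 2 * ?d" using card_Un_disjoint[OF I(2) J(2) True] I(3) J(3) by (simp add: q_def U_def)
        have one: "(\<integral>\<^sup>+x. ennreal (?a \<epsilon> I' x ^ q) \<partial>PiM I' (\<lambda>_. uniform_sphere)) = ennreal (s \<epsilon>)" if T: "I' \<in> tuples TYPE('d) m" for I' \<epsilon>
        proof -
          have "(\<integral>\<^sup>+x. ennreal (?a \<epsilon> I' x ^ q) \<partial>PiM I' (\<lambda>_. uniform_sphere)) = (\<integral>\<^sup>+p. ennreal (side_mass ?u \<epsilon> p ^ q) \<partial>(dtuple :: ('d \<Rightarrow> real ^ 'd) measure))"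
            unfolding amass by (rule nn_integral_tuple[OF tuplesD(2,3)[OF T] subset_refl]) measurable
          also have "\<dots> = ennreal (s \<epsilon>)"
            unfolding s_def q by (rule nn_integral_eq_integral[OF integrable_side_mass_power]) (simp add: side_mass_nonneg)
          finally show ?thesis .
        qed
        have mm [measurable]: "(\<lambda>x. ennreal ((?a \<epsilon> I x * ?a \<delta> J x) ^ q)) \<in> borel_measurable (PiM (I \<union> J) (\<lambda>_. uniform_sphere))"
        proof -
          have [measurable]: "(\<lambda>x. ?a \<epsilon> I x) \<in> borel_measurable (PiM (I \<union> J) (\<lambda>_. uniform_sphere))" "(\<lambda>x. ?a \<delta> J x) \<in> borel_measurable (PiM (I \<union> J) (\<lambda>_. uniform_sphere))"
            by (auto intro!: am TI TJ)
          show ?thesis by measurable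
        qed
        have "(\<integral>\<^sup>+x. ennreal ((?a \<epsilon> I x * ?a \<delta> J x) ^ q) \<partial>PiM (I \<union> J) (\<lambda>_. uniform_sphere))
          = (\<integral>\<^sup>+x. (\<integral>\<^sup>+y. ennreal ((?a \<epsilon> I (merge I J (x, y)) * ?a \<delta> J (merge I J (x, y))) ^ q) \<partial>PiM J (\<lambda>_. uniform_sphere)) \<partial>PiM I (\<lambda>_. uniform_sphere))"
          by (rule sph.product_nn_integral_fold[OF True I(2) J(2) mm])
        also have "\<dots> = (\<integral>\<^sup>+x. (\<integral>\<^sup>+y. ennreal (?a \<epsilon> I x ^ q) * ennreal (?a \<delta> J y ^ q) \<partial>PiM J (\<lambda>_. uniform_sphere)) \<partial>PiM I (\<lambda>_. uniform_sphere))"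
        proof (rule nn_integral_cong, rule nn_integral_cong)
          fix x y :: "nat \<Rightarrow> real ^ 'd"
          have "side_of I \<epsilon> (merge I J (x, y)) = side_of I \<epsilon> x" by (rule side_of_cong[OF I(2,3)]) (simp add: merge_def)
          moreover have "side_of J \<delta> (merge I J (x, y)) = side_of J \<delta> y"
            using True by (intro side_of_cong[OF J(2,3)]) (auto simp: merge_def)
          ultimately show "ennreal ((?a \<epsilon> I (merge I J (x, y)) * ?a \<delta> J (merge I J (x, y))) ^ q) = ennreal (?a \<epsilon> I x ^ q) * ennreal (?a \<delta> J y ^ q)"
            by (simp add: power_mult_distrib ennreal_mult)
        qed
        also have "\<dots> = (\<integral>\<^sup>+x. ennreal (?a \<epsilon> I x ^ q) * ennreal (s \<delta>) \<partial>PiM I (\<lambda>_. uniform_sphere))"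
        proof (rule nn_integral_cong)
          fix x :: "nat \<Rightarrow> real ^ 'd"
          note [measurable] = am[OF TJ subset_refl, of \<delta>]
          have "(\<integral>\<^sup>+y. ennreal (?a \<epsilon> I x ^ q) * ennreal (?a \<delta> J y ^ q) \<partial>PiM J (\<lambda>_. uniform_sphere))
            = ennreal (?a \<epsilon> I x ^ q) * (\<integral>\<^sup>+y. ennreal (?a \<delta> J y ^ q) \<partial>PiM J (\<lambda>_. uniform_sphere))"
            by (rule nn_integral_cmult) measurable
          then show "(\<integral>\<^sup>+y. ennreal (?a \<epsilon> I x ^ q) * ennreal (?a \<delta> J y ^ q) \<partial>PiM J (\<lambda>_. uniform_sphere)) = ennreal (?a \<epsilon> I x ^ q) * ennreal (s \<delta>)"
            unfolding one[OF TJ] .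
        qed
        also have "\<dots> = (\<integral>\<^sup>+x. ennreal (?a \<epsilon> I x ^ q) \<partial>PiM I (\<lambda>_. uniform_sphere)) * ennreal (s \<delta>)"
        proof (rule nn_integral_multc)
          note [measurable] = am[OF TI subset_refl, of \<epsilon>]
          show "(\<lambda>x. ennreal (?a \<epsilon> I x ^ q)) \<in> borel_measurable (PiM I (\<lambda>_. uniform_sphere))" by measurable
        qed
        also have "\<dots> = ennreal (s \<epsilon> * s \<delta>)" unfolding one[OF TI] using s0 by (simp add: ennreal_mult)
        finally show ?thesis using True by (simp add: U_def)
      qed simp
      have "(\<integral>\<^sup>+x. ennreal (?prod x) \<partial>?P) \<le> ennreal ((C / \<theta>) ^ (card U - 1))" by (rule cluster[OF finU k1 \<theta>])
      also have "C / \<theta> \<le> D / real m"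
      proof -
        have "C / \<theta> = (C / c0) / real q" by (simp add: \<theta>_def)
        also have "\<dots> \<le> (C / c0) / (real m / 2)"
          using q2 mpos C c0 by (intro divide_left_mono) auto
        also have "\<dots> = (2 * C / c0) / real m" by simp
        also have "\<dots> \<le> D / real m" by (intro divide_right_mono) (simp_all add: D_def)
        finally show ?thesis .
      qed
      then have "ennreal ((C / \<theta>) ^ (card U - 1)) \<le> ennreal ((D / real m) ^ (card U - 1))"
        using C \<theta> by (intro ennreal_leI power_mono) auto
      finally show "(\<integral>\<^sup>+x. ennreal (?prod x) \<partial>?P) \<le> ennreal ((D / real m) ^ (card U - 1))" .
    qed
    also have "\<dots> = ennreal (s \<epsilon> * s \<delta> + (D / real m) ^ (card U - 1))"
      using s0 by (intro ennreal_plus[symmetric]) (auto simp: D_def)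
    finally show ?thesis
      using s0 by (subst (asm) ennreal_le_iff) (auto simp: s_def U_def D_def intro!: add_nonneg_nonneg)
  qed
  have "D \<ge> 1" by (simp add: D_def)
  with main show ?thesis by blast
qed

text \<open>Group the pairs by their union. A set of size \<open>l\<close> has at most
  \<open>2 ^ l * 2 ^ l = 4 ^ l\<close> pairs of subsets, a crude count that suffices because
  \<open>l\<close> is at most \<open>2 * CARD('d)\<close>.\<close>

lemma sum_pairs_by_union:
  fixes g :: "nat \<Rightarrow> real"
  assumes g: "\<And>l. 0 \<le> g l"
  shows "(\<Sum>I\<in>tuples TYPE('d::finite) m. \<Sum>J\<in>tuples TYPE('d) m. g (card (I \<union> J)))
    \<le> (\<Sum>l\<in>{CARD('d)..2 * CARD('d)}. real (m choose l) * 4 ^ l * g l)"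
proof -
  let ?T = "tuples TYPE('d) m" and ?L = "{CARD('d)..2 * CARD('d)}"
  define \<U> where "\<U> l = {U. U \<subseteq> {..<m} \<and> card U = l}" for l
  have fin\<U>: "finite (\<U> l)" for l
    unfolding \<U>_def by (rule finite_subset[of _ "Pow {..<m}"]) auto
  let ?S = "Sigma ?L (\<lambda>l. Sigma (\<U> l) (\<lambda>U. Pow U \<times> Pow U))"
  let ?f = "\<lambda>(I, J). (card (I \<union> J), I \<union> J, I, J :: nat set)"
  have finS: "finite ?S"
    by (intro finite_SigmaI fin\<U>) (auto simp: \<U>_def intro: finite_subset)
  have "(\<Sum>I\<in>?T. \<Sum>J\<in>?T. g (card (I \<union> J))) = (\<Sum>p\<in>?T \<times> ?T. g (fst (?f p)))"
    by (simp add: sum.cartesian_product split_beta)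
  also have "\<dots> = (\<Sum>z\<in>?f ` (?T \<times> ?T). g (fst z))"
    by (rule sum.reindex_cong[symmetric, of ?f]) (auto simp: inj_on_def)
  also have "\<dots> \<le> (\<Sum>z\<in>?S. g (fst z))"
  proof (rule sum_mono2[OF finS])
    show "?f ` (?T \<times> ?T) \<subseteq> ?S"
    proof
      fix z assume "z \<in> ?f ` (?T \<times> ?T)"
      then obtain I J where z: "z = (card (I \<union> J), I \<union> J, I, J)" and T: "I \<in> ?T" "J \<in> ?T" by auto
      note I = tuplesD[OF T(1)] and J = tuplesD[OF T(2)]
      have "card I \<le> card (I \<union> J)" using I(2) J(2) by (intro card_mono) auto
      moreover have "card (I \<union> J) \<le> card I + card J" by (rule card_Un_le)
      ultimately show "z \<in> ?S" using I J by (auto simp: z \<U>_def)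
    qed
  qed (use g in auto)
  also have "\<dots> = (\<Sum>l\<in>?L. \<Sum>w\<in>Sigma (\<U> l) (\<lambda>U. Pow U \<times> Pow U). g l)"
    by (subst sum.Sigma) (auto intro!: finite_SigmaI fin\<U> simp: \<U>_def split_beta intro: finite_subset)
  also have "\<dots> = (\<Sum>l\<in>?L. real (m choose l) * 4 ^ l * g l)"
  proof (rule sum.cong[OF refl])
    fix l
    have "card (Sigma (\<U> l) (\<lambda>U. Pow U \<times> Pow U)) = (\<Sum>U\<in>\<U> l. card (Pow U \<times> Pow U))"
      by (rule card_SigmaI) (auto simp: fin\<U> \<U>_def intro: finite_subset)
    also have "\<dots> = (\<Sum>U\<in>\<U> l. 4 ^ l)"
    proof (rule sum.cong[OF refl])
      fix U assume "U \<in> \<U> l"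
      then have "finite U" "card U = l" by (auto simp: \<U>_def intro: finite_subset)
      then show "card (Pow U \<times> Pow U) = 4 ^ l"
        by (simp add: card_Pow card_cartesian_product power_mult_distrib[symmetric])
    qed
    also have "\<dots> = (m choose l) * 4 ^ l"
      using n_subsets[of "{..<m}" l] by (simp add: \<U>_def)
    finally show "(\<Sum>w\<in>Sigma (\<U> l) (\<lambda>U. Pow U \<times> Pow U). g l) = real (m choose l) * 4 ^ l * g l"
      by simp
  qed
  finally show ?thesis .
qed

lemma second_moment_bound:
  assumes dim: "CARD('d::finite) \<ge> 2"
  shows "\<exists>K. \<forall>m\<ge>4 * CARD('d). (\<integral>x. (real (num_facets (hull_of m x)))\<^sup>2 \<partial>(random_points m :: (nat \<Rightarrow> real ^ 'd) measure))
    \<le> (real (m choose CARD('d)) * facet_moment TYPE('d) (m - 2 * CARD('d)))\<^sup>2 + K * real m"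
proof -
  let ?d = "CARD('d)" and ?T = "\<lambda>m. tuples TYPE('d) m"
  obtain D where D: "D \<ge> 1" and joint: "\<And>m I J \<epsilon> \<delta>. 4 * ?d \<le> m \<Longrightarrow> I \<in> ?T m \<Longrightarrow> J \<in> ?T m \<Longrightarrow> \<epsilon> \<in> {1, - 1} \<Longrightarrow> \<delta> \<in> {1, - 1} \<Longrightarrow>
    (\<integral>x. facet_ind m I \<epsilon> x * facet_ind m J \<delta> x \<partial>(random_points m :: (nat \<Rightarrow> real ^ 'd) measure))
    \<le> (\<integral>p. side_mass undefined \<epsilon> p ^ (m - 2 * ?d) \<partial>(dtuple :: ('d \<Rightarrow> real ^ 'd) measure))
       * (\<integral>p. side_mass undefined \<delta> p ^ (m - 2 * ?d) \<partial>(dtuple :: ('d \<Rightarrow> real ^ 'd) measure))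
      + (D / real m) ^ (card (I \<union> J) - 1)"
    using facet_ind_joint_bound[OF dim] by blast
  \<comment> \<open>The factor 4 counts the pairs of signs and \<open>4 ^ l\<close> the pairs of
    tuples with a given union.\<close>
  define K where "K = 4 * (\<Sum>l\<in>{?d..2 * ?d}. 4 ^ l * D ^ (l - 1))"
  have "(\<integral>x. (real (num_facets (hull_of m x)))\<^sup>2 \<partial>(random_points m :: (nat \<Rightarrow> real ^ 'd) measure))
    \<le> (real (m choose ?d) * facet_moment TYPE('d) (m - 2 * ?d))\<^sup>2 + K * real m" if m: "4 * ?d \<le> m" for m
  proof -
    let ?R = "random_points m :: (nat \<Rightarrow> real ^ 'd) measure"
    interpret prob_space ?R by (rule prob_space_random_points)
    have dm: "?d < m" and mpos: "m > 0" using m dim by auto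
    let ?X = "?T m \<times> {1, - 1 :: real}"
    let ?F = "\<lambda>p x. facet_ind m (fst p) (snd p) (x :: nat \<Rightarrow> real ^ 'd)"
    define s where "s \<epsilon> = (\<integral>p. side_mass undefined \<epsilon> p ^ (m - 2 * ?d) \<partial>(dtuple :: ('d \<Rightarrow> real ^ 'd) measure))" for \<epsilon>
    have int: "integrable ?R (\<lambda>x. ?F p x * ?F p' x)" if "p \<in> ?X" "p' \<in> ?X" for p p'
      by (rule integrable_const_bound[where B=1])
        (use that in \<open>auto simp: facet_ind_bounds mult_le_one intro!: borel_measurable_times measurable_facet_ind\<close>)
    have "(\<integral>x. (real (num_facets (hull_of m x)))\<^sup>2 \<partial>?R) = (\<integral>x. (\<Sum>p\<in>?X. \<Sum>p'\<in>?X. ?F p x * ?F p' x) \<partial>?R)"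
    proof (rule Bochner_Integration.integral_cong_AE)
      show "(\<lambda>x. (real (num_facets (hull_of m x)))\<^sup>2) \<in> borel_measurable ?R" by measurable
      show "(\<lambda>x. \<Sum>p\<in>?X. \<Sum>p'\<in>?X. ?F p x * ?F p' x) \<in> borel_measurable ?R"
        by (intro borel_measurable_sum borel_measurable_integrable int)
      show "AE x in ?R. (real (num_facets (hull_of m x)))\<^sup>2 = (\<Sum>p\<in>?X. \<Sum>p'\<in>?X. ?F p x * ?F p' x)"
        using AE_points_generic[OF dim, of m]
      proof eventually_elim
        fix x :: "nat \<Rightarrow> real ^ 'd" assume "points_generic m x"
        then have "real (num_facets (hull_of m x)) = (\<Sum>I\<in>?T m. \<Sum>\<epsilon>\<in>{1, - 1}. facet_ind m I \<epsilon> x)"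
          by (rule num_facets_eq_sum[OF _ dm])
        also have "\<dots> = (\<Sum>p\<in>?X. ?F p x)" by (subst sum.cartesian_product) (simp add: split_beta)
        finally show "(real (num_facets (hull_of m x)))\<^sup>2 = (\<Sum>p\<in>?X. \<Sum>p'\<in>?X. ?F p x * ?F p' x)"
          by (simp only: power2_eq_square sum_product)
      qed
    qed
    also have "\<dots> = (\<Sum>p\<in>?X. \<Sum>p'\<in>?X. \<integral>x. ?F p x * ?F p' x \<partial>?R)"
    proof -
      have "(\<integral>x. (\<Sum>p\<in>?X. \<Sum>p'\<in>?X. ?F p x * ?F p' x) \<partial>?R) = (\<Sum>p\<in>?X. \<integral>x. (\<Sum>p'\<in>?X. ?F p x * ?F p' x) \<partial>?R)"
        by (intro Bochner_Integration.integral_sum Bochner_Integration.integrable_sum int)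
      also have "\<dots> = (\<Sum>p\<in>?X. \<Sum>p'\<in>?X. \<integral>x. ?F p x * ?F p' x \<partial>?R)"
        by (intro sum.cong refl Bochner_Integration.integral_sum int)
      finally show ?thesis .
    qed
    also have "\<dots> \<le> (\<Sum>p\<in>?X. \<Sum>p'\<in>?X. s (snd p) * s (snd p') + (D / real m) ^ (card (fst p \<union> fst p') - 1))"
      unfolding s_def by (intro sum_mono joint m) auto
    also have "\<dots> = (\<Sum>p\<in>?X. s (snd p))\<^sup>2 + (\<Sum>p\<in>?X. \<Sum>p'\<in>?X. (D / real m) ^ (card (fst p \<union> fst p') - 1))"
      by (simp only: sum.distrib power2_eq_square sum_product)
    also have "(\<Sum>p\<in>?X. s (snd p)) = real (m choose ?d) * facet_moment TYPE('d) (m - 2 * ?d)"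
    proof -
      have "(\<Sum>p\<in>?X. s (snd p)) = (\<Sum>I\<in>?T m. \<Sum>\<epsilon>\<in>{1, - 1}. s \<epsilon>)"
        by (subst sum.cartesian_product) (simp add: split_beta)
      also have "\<dots> = (\<Sum>I\<in>?T m. facet_moment TYPE('d) (m - 2 * ?d))" by (simp only: facet_moment_def s_def)
      finally show ?thesis by (simp add: card_tuples)
    qed
    also have "(\<Sum>p\<in>?X. \<Sum>p'\<in>?X. (D / real m) ^ (card (fst p \<union> fst p') - 1)) \<le> K * real m"
    proof -
      define g where "g l = (D / real m) ^ (l - 1)" for l
      have g0: "0 \<le> g l" for l using D by (simp add: g_def)
      have pairs: "(\<Sum>p\<in>?X. h (fst p)) = 2 * (\<Sum>I\<in>?T m. h I)" for h :: "nat set \<Rightarrow> real"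
      proof -
        have "(\<Sum>p\<in>?X. h (fst p)) = (\<Sum>I\<in>?T m. \<Sum>\<epsilon>\<in>{1, - 1 :: real}. h I)"
          by (subst sum.cartesian_product) (simp add: split_beta)
        then show ?thesis by (simp add: sum_distrib_left)
      qed
      have "(\<Sum>p\<in>?X. \<Sum>p'\<in>?X. (D / real m) ^ (card (fst p \<union> fst p') - 1)) = (\<Sum>p\<in>?X. 2 * (\<Sum>J\<in>?T m. g (card (fst p \<union> J))))"
        unfolding g_def by (intro sum.cong refl pairs)
      also have "\<dots> = 2 * (\<Sum>I\<in>?T m. 2 * (\<Sum>J\<in>?T m. g (card (I \<union> J))))" by (rule pairs)
      also have "\<dots> = 4 * (\<Sum>I\<in>?T m. \<Sum>J\<in>?T m. g (card (I \<union> J)))" by (simp add: sum_distrib_left)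
      also have "\<dots> \<le> 4 * (\<Sum>l\<in>{?d..2 * ?d}. real (m choose l) * 4 ^ l * g l)"
        by (intro mult_left_mono sum_pairs_by_union g0) simp
      also have "\<dots> \<le> 4 * (\<Sum>l\<in>{?d..2 * ?d}. 4 ^ l * D ^ (l - 1) * real m)"
      proof (intro mult_left_mono sum_mono)
        fix l assume l: "l \<in> {?d..2 * ?d}"
        then have l0: "l > 0" "l \<le> m" using m dim by auto
        have "real (m choose l) \<le> real m ^ l" using binomial_le_pow[OF l0(2)] by (metis of_nat_le_iff of_nat_power)
        also have "\<dots> = real m * real m ^ (l - 1)" using l0(1) by (cases l) auto
        finally have "real (m choose l) * g l \<le> (real m * real m ^ (l - 1)) * g l" using g0 by (intro mult_right_mono)
        also have "\<dots> = real m * D ^ (l - 1)" using mpos by (simp add: g_def power_divide)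
        finally have "4 ^ l * (real (m choose l) * g l) \<le> 4 ^ l * (real m * D ^ (l - 1))" by (intro mult_left_mono) auto
        then show "real (m choose l) * 4 ^ l * g l \<le> 4 ^ l * D ^ (l - 1) * real m" by (simp only: mult_ac)
      qed simp
      also have "\<dots> = K * real m" by (simp add: K_def sum_distrib_right mult.assoc)
      finally show ?thesis .
    qed
    finally show ?thesis by simp
  qed
  then show ?thesis by blast
qed

section \<open>Convexity of the moment sequence\<close>

lemma facet_moment_nonneg: "0 \<le> facet_moment TYPE('d::finite) k"
  unfolding facet_moment_def by (intro sum_nonneg Bochner_Integration.integral_nonneg) (simp add: side_mass_nonneg)

lemma facet_moment_diff:
  "facet_moment TYPE('d::finite) k - facet_moment TYPE('d) (Suc k)
    = (\<Sum>\<epsilon>\<in>{1, - 1}. \<integral>p. side_mass undefined \<epsilon> p ^ k * (1 - side_mass undefined \<epsilon> p) \<partial>(dtuple :: ('d \<Rightarrow> real ^ 'd) measure))"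
  unfolding facet_moment_def sum_subtractf[symmetric]
proof (rule sum.cong[OF refl])
  fix \<epsilon> :: real
  show "(\<integral>p. side_mass undefined \<epsilon> p ^ k \<partial>(dtuple :: ('d \<Rightarrow> real ^ 'd) measure)) - (\<integral>p. side_mass undefined \<epsilon> p ^ Suc k \<partial>(dtuple :: ('d \<Rightarrow> real ^ 'd) measure))
    = (\<integral>p. side_mass undefined \<epsilon> p ^ k * (1 - side_mass undefined \<epsilon> p) \<partial>(dtuple :: ('d \<Rightarrow> real ^ 'd) measure))"
    by (subst Bochner_Integration.integral_diff[symmetric, OF integrable_side_mass_power integrable_side_mass_power])
       (simp add: algebra_simps)
qed

text \<open>The moments are a mixture of geometric sequences \<open>s ^ k\<close> with
  \<open>0 \<le> s \<le> 1\<close>, hence convex in \<open>k\<close>: the factor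
  \<open>s ^ k\<close> in \<open>s ^ k * (1 - s)\<close> decreases.\<close>

lemma facet_moment_diff_antimono:
  assumes "j \<le> k"
  shows "facet_moment TYPE('d::finite) k - facet_moment TYPE('d) (Suc k) \<le> facet_moment TYPE('d) j - facet_moment TYPE('d) (Suc j)"
  unfolding facet_moment_diff
proof (rule sum_mono, rule integral_mono)
  interpret prob_space "dtuple :: ('d \<Rightarrow> real ^ 'd) measure" by (rule prob_space_PiM_uniform_sphere)
  fix \<epsilon> :: real and p :: "'d \<Rightarrow> real ^ 'd"
  have int: "integrable (dtuple :: ('d \<Rightarrow> real ^ 'd) measure) (\<lambda>p. side_mass undefined \<epsilon> p ^ l * (1 - side_mass undefined \<epsilon> p))" for l
    by (rule integrable_const_bound[where B=1])
      (auto simp: side_mass_nonneg side_mass_le_1 abs_mult intro!: mult_le_one power_le_one)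
  show "integrable (dtuple :: ('d \<Rightarrow> real ^ 'd) measure) (\<lambda>p. side_mass undefined \<epsilon> p ^ k * (1 - side_mass undefined \<epsilon> p))"
    "integrable (dtuple :: ('d \<Rightarrow> real ^ 'd) measure) (\<lambda>p. side_mass undefined \<epsilon> p ^ j * (1 - side_mass undefined \<epsilon> p))"
    by (rule int)+
  show "side_mass undefined \<epsilon> p ^ k * (1 - side_mass undefined \<epsilon> p) \<le> side_mass undefined \<epsilon> p ^ j * (1 - side_mass undefined \<epsilon> p)"
    using assms by (intro mult_right_mono power_decreasing) (simp_all add: side_mass_nonneg side_mass_le_1)
qed

lemma facet_moment_Suc_le: "facet_moment TYPE('d::finite) (Suc k) \<le> facet_moment TYPE('d) k"
proof -
  have "0 \<le> facet_moment TYPE('d) k - facet_moment TYPE('d) (Suc k)"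
    unfolding facet_moment_diff
    by (intro sum_nonneg Bochner_Integration.integral_nonneg) (simp add: side_mass_nonneg side_mass_le_1)
  then show ?thesis by simp
qed

lemma facet_moment_decseq: "j \<le> k \<Longrightarrow> facet_moment TYPE('d::finite) k \<le> facet_moment TYPE('d) j"
  by (rule lift_Suc_antimono_le[of "facet_moment TYPE('d)", OF facet_moment_Suc_le])

text \<open>The second bound gains an order that the asymptotics of the moments alone would not
  give. By convexity, the differences on the window from \<open>k div 2\<close> to \<open>k\<close>
  are all at least the one at \<open>k\<close>, and they telescope to at most the moment at
  \<open>k div 2\<close>.\<close>

lemma facet_moment_bounds:
  assumes dim: "CARD('d::finite) \<ge> 2"
  defines "n \<equiv> CARD('d) - 1"
  shows "\<exists>A\<ge>0. \<forall>k\<ge>2. facet_moment TYPE('d) k \<le> A / real k ^ n \<and>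
    facet_moment TYPE('d) k - facet_moment TYPE('d) (Suc k) \<le> A / real k ^ (n + 1)"
proof -
  let ?\<pi> = "facet_moment TYPE('d)"
  obtain F where "(\<lambda>k. real k ^ n * ?\<pi> k) \<longlonglongrightarrow> F" using facet_moment_asymptotics[OF dim] unfolding n_def by blast
  then have "Bseq (\<lambda>k. real k ^ n * ?\<pi> k)" by (rule convergent_imp_Bseq[OF convergentI])
  then obtain B where B: "B > 0" "\<And>k. norm (real k ^ n * ?\<pi> k) \<le> B" by (rule BseqE) blast
  have up: "?\<pi> k \<le> B / real k ^ n" if "k > 0" for k
    using B(2)[of k] that facet_moment_nonneg[of k, where 'd='d] by (simp add: pos_le_divide_eq abs_mult mult.commute)
  define A where "A = 2 * 4 ^ n * B"
  have "?\<pi> k - ?\<pi> (Suc k) \<le> A / real k ^ (n + 1)" if k: "k \<ge> 2" for k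
  proof -
    \<comment> \<open>For \<open>k \<ge> 2\<close> this gives \<open>h \<ge> k / 4\<close> and a
      window of length \<open>k - h \<ge> k / 2\<close>, the origins of \<open>4 ^ n\<close> and 2
      in \<open>A\<close>.\<close>
    define h where "h = k div 2"
    have h: "h > 0" "h \<le> k" "real k \<le> 4 * real h" "real k \<le> 2 * real (k - h)" using k by (auto simp: h_def)
    have "real (k - h) * (?\<pi> k - ?\<pi> (Suc k)) = (\<Sum>j\<in>{h..<k}. ?\<pi> k - ?\<pi> (Suc k))" by simp
    also have "\<dots> \<le> (\<Sum>j\<in>{h..<k}. ?\<pi> j - ?\<pi> (Suc j))"
      by (intro sum_mono facet_moment_diff_antimono) auto
    also have "\<dots> = ?\<pi> h - ?\<pi> k" using sum_Suc_diff'[OF h(2), of "\<lambda>j. - ?\<pi> j"] by simp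
    also have "\<dots> \<le> ?\<pi> h" using facet_moment_nonneg[of k, where 'd='d] by simp
    also have "\<dots> \<le> B / real h ^ n" by (rule up[OF h(1)])
    also have "\<dots> \<le> B / (real k / 4) ^ n"
      using h k B(1) by (intro divide_left_mono power_mono mult_pos_pos zero_less_power) auto
    also have "\<dots> = 4 ^ n * B / real k ^ n" by (simp add: power_divide)
    finally have 1: "real (k - h) * (?\<pi> k - ?\<pi> (Suc k)) \<le> 4 ^ n * B / real k ^ n" .
    have "real k * (?\<pi> k - ?\<pi> (Suc k)) \<le> 2 * real (k - h) * (?\<pi> k - ?\<pi> (Suc k))"
      using h(4) facet_moment_Suc_le[of k, where 'd='d] by (intro mult_right_mono) auto
    also have "\<dots> \<le> A / real k ^ n" using 1 by (simp add: A_def)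
    finally show ?thesis using k by (simp add: pos_le_divide_eq field_simps)
  qed
  moreover have "?\<pi> k \<le> A / real k ^ n" if k: "k \<ge> 2" for k
  proof -
    have "(1 :: real) \<le> 4 ^ n" by simp
    then have "1 * B \<le> (2 * 4 ^ n) * B" using B(1) by (intro mult_right_mono) linarith+
    then have "B / real k ^ n \<le> A / real k ^ n" by (intro divide_right_mono) (simp_all add: A_def)
    then show ?thesis using up[of k] k by linarith
  qed
  moreover have "A \<ge> 0" using B(1) by (simp add: A_def)
  ultimately show ?thesis by blast
qed

text \<open>The leading term of the second moment has the exponent \<open>m - 2 * CARD('d)\<close>,
  the squared expectation \<open>m - CARD('d)\<close>. With \<open>n = CARD('d) - 1\<close>,
  shifting the exponent by \<open>CARD('d)\<close> changes the moment by
  \<open>O(m ^ - (n + 1))\<close> and its square by \<open>O(m ^ - (2 * n + 1))\<close>; the squared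
  binomial coefficient is at most \<open>m ^ (2 * n + 2)\<close>, so \<open>O(m)\<close>
  remains.\<close>

lemma variance_facets_bound:
  assumes dim: "CARD('d::finite) \<ge> 2"
  shows "\<exists>K. \<forall>m\<ge>4 * CARD('d). (\<integral>x. (real (num_facets (hull_of m x)))\<^sup>2 \<partial>(random_points m :: (nat \<Rightarrow> real ^ 'd) measure))
    - (expected_facets TYPE(real ^ 'd) m)\<^sup>2 \<le> K * real m"
proof -
  let ?d = "CARD('d)" and ?\<pi> = "facet_moment TYPE('d)"
  define n where "n = ?d - 1"
  have dn: "?d = n + 1" using dim by (simp add: n_def)
  obtain K where K: "\<And>m. m \<ge> 4 * ?d \<Longrightarrow> (\<integral>x. (real (num_facets (hull_of m x)))\<^sup>2 \<partial>(random_points m :: (nat \<Rightarrow> real ^ 'd) measure))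
    \<le> (real (m choose ?d) * ?\<pi> (m - 2 * ?d))\<^sup>2 + K * real m"
    using second_moment_bound[OF dim] by blast
  obtain A where A: "A \<ge> 0" and up: "\<And>k. k \<ge> 2 \<Longrightarrow> ?\<pi> k \<le> A / real k ^ n"
    and diff: "\<And>k. k \<ge> 2 \<Longrightarrow> ?\<pi> k - ?\<pi> (Suc k) \<le> A / real k ^ (n + 1)"
    using facet_moment_bounds[OF dim] unfolding n_def by blast
  define K' where "K' = (real ?d * (2 ^ (n + 1) * A)) * (2 * (2 ^ n * A))"
  have "(\<integral>x. (real (num_facets (hull_of m x)))\<^sup>2 \<partial>(random_points m :: (nat \<Rightarrow> real ^ 'd) measure))
    - (expected_facets TYPE(real ^ 'd) m)\<^sup>2 \<le> (K + K') * real m" if m: "4 * ?d \<le> m" for m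
  proof -
    define q where "q = m - 2 * ?d"
    have q: "q \<ge> 2" "real m / 2 \<le> real q" and m0: "m > 0" and dm: "?d < m" and mq: "m - ?d = q + ?d"
      using m dim by (auto simp: q_def)
    have half: "A / real q ^ l \<le> 2 ^ l * A / real m ^ l" for l
    proof -
      have "A / real q ^ l \<le> A / (real m / 2) ^ l"
        using q m0 A by (intro divide_left_mono power_mono mult_pos_pos zero_less_power) auto
      then show ?thesis by (simp add: power_divide mult.commute)
    qed
    have up': "?\<pi> q \<le> 2 ^ n * A / real m ^ n" using up[OF q(1)] half[of n] by linarith
    have le: "?\<pi> (q + ?d) \<le> ?\<pi> q" by (rule facet_moment_decseq) simp
    have "?\<pi> q - ?\<pi> (q + ?d) = (\<Sum>j\<in>{q..<q + ?d}. ?\<pi> j - ?\<pi> (Suc j))"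
      using sum_Suc_diff'[of q "q + ?d" "\<lambda>j. - ?\<pi> j"] by simp
    also have "\<dots> \<le> (\<Sum>j\<in>{q..<q + ?d}. ?\<pi> q - ?\<pi> (Suc q))"
      by (intro sum_mono facet_moment_diff_antimono) auto
    also have "\<dots> = real ?d * (?\<pi> q - ?\<pi> (Suc q))" by simp
    also have "\<dots> \<le> real ?d * (2 ^ (n + 1) * A / real m ^ (n + 1))"
      using diff[OF q(1)] half[of "n + 1"] by (intro mult_left_mono) linarith+
    finally have d1: "?\<pi> q - ?\<pi> (q + ?d) \<le> real ?d * (2 ^ (n + 1) * A / real m ^ (n + 1))" .
    have "(?\<pi> q)\<^sup>2 - (?\<pi> (q + ?d))\<^sup>2 = (?\<pi> q - ?\<pi> (q + ?d)) * (?\<pi> q + ?\<pi> (q + ?d))"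
      by (simp add: power2_eq_square algebra_simps)
    also have "\<dots> \<le> (real ?d * (2 ^ (n + 1) * A / real m ^ (n + 1))) * (2 * (2 ^ n * A / real m ^ n))"
      using d1 le up' facet_moment_nonneg[of "q + ?d", where 'd='d] facet_moment_nonneg[of q, where 'd='d] A by (intro mult_mono) auto
    also have "\<dots> = K' / (real m ^ (n + 1) * real m ^ n)" by (simp add: K'_def)
    finally have d2: "(?\<pi> q)\<^sup>2 - (?\<pi> (q + ?d))\<^sup>2 \<le> K' / (real m ^ (n + 1) * real m ^ n)" .
    have "real (m choose ?d) \<le> real m ^ ?d" using binomial_le_pow[of ?d m] dm by (metis less_imp_le of_nat_le_iff of_nat_power)
    then have "(real (m choose ?d))\<^sup>2 \<le> (real m ^ (n + 1))\<^sup>2" unfolding dn by (intro power_mono) auto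
    moreover have "0 \<le> K' / (real m ^ (n + 1) * real m ^ n)" using A by (simp add: K'_def)
    ultimately have "(real (m choose ?d))\<^sup>2 * ((?\<pi> q)\<^sup>2 - (?\<pi> (q + ?d))\<^sup>2) \<le> (real m ^ (n + 1))\<^sup>2 * (K' / (real m ^ (n + 1) * real m ^ n))"
      using d2 by (meson mult_left_mono mult_right_mono order_trans zero_le_power2)
    also have "\<dots> = K' * real m" using m0 by (simp add: power2_eq_square)
    finally have "(real (m choose ?d) * ?\<pi> q)\<^sup>2 - (real (m choose ?d) * ?\<pi> (q + ?d))\<^sup>2 \<le> K' * real m"
      by (simp add: power_mult_distrib right_diff_distrib)
    then show ?thesis
      using K[OF m] unfolding expected_facets_eq[OF dim dm] mq q_def[symmetric] by (simp add: distrib_right)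
  qed
  then show ?thesis by blast
qed

text \<open>The number of tuples grows like \<open>m ^ CARD('d) / fact CARD('d)\<close>, one power
  of \<open>m\<close> more than the moment decays, so the limit is \<open>L / fact CARD('d)\<close>.
  The sequence is shifted by \<open>CARD('d)\<close> to make the exponent of the moment the
  index.\<close>

lemma expected_facets_asymptotics:
  assumes dim: "CARD('d::finite) \<ge> 2"
  shows "\<exists>F>0. (\<lambda>m. expected_facets TYPE(real ^ 'd) m / real m) \<longlonglongrightarrow> F"
proof -
  let ?d = "CARD('d)" and ?\<pi> = "facet_moment TYPE('d)"
  define n where "n = ?d - 1"
  have dn: "?d = Suc n" using dim by (simp add: n_def)
  obtain L where L: "L > 0" "(\<lambda>k. real k ^ n * ?\<pi> k) \<longlonglongrightarrow> L"
    using facet_moment_asymptotics[OF dim] unfolding n_def by blast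
  let ?r = "\<lambda>k. real k ^ ?d * (fact k / fact (?d + k))"
  have r: "?r \<longlonglongrightarrow> 1" by (rule tendsto_power_fact_ratio)
  have one: "(\<lambda>k. real k / real (k + ?d)) \<longlonglongrightarrow> 1"
  proof -
    have "(\<lambda>k. 1 - real ?d * inverse (real (Suc (k + n)))) \<longlonglongrightarrow> 1 - real ?d * 0"
      by (intro tendsto_intros LIMSEQ_ignore_initial_segment[OF LIMSEQ_inverse_real_of_nat, of n])
    moreover have "1 - real ?d * inverse (real (Suc (k + n))) = real k / real (k + ?d)" for k
      unfolding dn by (simp add: field_simps)
    ultimately show ?thesis by simp
  qed
  have "(\<lambda>k. (1 / (fact ?d * ?r k)) * (real k ^ n * ?\<pi> k) * (real k / real (k + ?d))) \<longlonglongrightarrow> (1 / (fact ?d * 1)) * L * 1"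
    by (intro tendsto_intros r L(2) one) simp
  moreover have "\<forall>\<^sub>F k in sequentially. (1 / (fact ?d * ?r k)) * (real k ^ n * ?\<pi> k) * (real k / real (k + ?d))
      = expected_facets TYPE(real ^ 'd) (k + ?d) / real (k + ?d)"
    using eventually_gt_at_top[of 0]
  proof eventually_elim
    fix k :: nat assume k: "0 < k"
    have "real ((k + ?d) choose ?d) = fact (k + ?d) / (fact ?d * fact k)" by (subst binomial_fact) simp_all
    moreover have "expected_facets TYPE(real ^ 'd) (k + ?d) = real ((k + ?d) choose ?d) * ?\<pi> k"
      using expected_facets_eq[OF dim, of "k + ?d"] k by simp
    moreover have "(1 / (a * (x ^ Suc n * (b / c)))) * (x ^ n * p) * (x / y) = c / (a * b) * p / y" if "x > 0" for a b c p x y :: real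
      using that by (simp add: field_simps)
    note this[of "real k" "fact ?d" "fact k" "fact (?d + k)" "?\<pi> k" "real (k + ?d)"]
    ultimately show "(1 / (fact ?d * ?r k)) * (real k ^ n * ?\<pi> k) * (real k / real (k + ?d))
      = expected_facets TYPE(real ^ 'd) (k + ?d) / real (k + ?d)"
      using k unfolding dn by (simp add: add.commute)
  qed
  ultimately have "(\<lambda>k. expected_facets TYPE(real ^ 'd) (k + ?d) / real (k + ?d)) \<longlonglongrightarrow> (1 / (fact ?d * 1)) * L * 1"
    by (rule Lim_transform_eventually)
  then have "(\<lambda>m. expected_facets TYPE(real ^ 'd) m / real m) \<longlonglongrightarrow> (1 / (fact ?d * 1)) * L * 1"
    by (rule LIMSEQ_offset)
  moreover have "(1 / (fact ?d * 1)) * L * 1 > 0" using L(1) by simp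
  ultimately show ?thesis by blast
qed

theorem theorem9:
  fixes \<epsilon> :: real
  assumes "CARD('d::finite) \<ge> 2" and "\<epsilon> > 0"
  shows "(\<lambda>m. measure (random_points m :: (nat \<Rightarrow> real ^ 'd) measure)
            {x \<in> space (random_points m).
               \<bar>real (num_facets (hull_of m x)) - facet_rate TYPE(real ^ 'd) * real m\<bar>
                 \<ge> \<epsilon> * facet_rate TYPE(real ^ 'd) * real m})
         \<in> O(\<lambda>m. 1 / real m)"
proof -
  let ?f = "\<lambda>m x. real (num_facets (hull_of m (x :: nat \<Rightarrow> real ^ 'd)))"
  let ?E = "expected_facets TYPE(real ^ 'd)"
  define F where "F = facet_rate TYPE(real ^ 'd)"
  obtain F' where F': "F' > 0" "(\<lambda>m. ?E m / real m) \<longlonglongrightarrow> F'"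
    using expected_facets_asymptotics[OF assms(1)] by blast
  have "F = F'" unfolding F_def facet_rate_def by (rule limI[OF F'(2)])
  then have F: "F > 0" and lim: "(\<lambda>m. ?E m / real m) \<longlonglongrightarrow> F" using F' by simp_all
  obtain K where K: "\<And>m. m \<ge> 4 * CARD('d) \<Longrightarrow> (\<integral>x. (?f m x)\<^sup>2 \<partial>random_points m) - (?E m)\<^sup>2 \<le> K * real m"
    using variance_facets_bound[OF assms(1)] by blast
  \<comment> \<open>Half of the tolerance absorbs the difference between the expectation and
    \<open>F * m\<close>, which is eventually below it; the other half is left for the deviation
    from the expectation.\<close>
  let ?a = "\<epsilon> * F / 2"
  have a: "?a > 0" using F assms(2) by simp
  have "\<forall>\<^sub>F m in sequentially. dist (?E m / real m) F < ?a" by (rule tendstoD[OF lim a])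
  then have "\<forall>\<^sub>F m in sequentially. norm (measure (random_points m :: (nat \<Rightarrow> real ^ 'd) measure)
      {x \<in> space (random_points m). \<bar>?f m x - F * real m\<bar> \<ge> \<epsilon> * F * real m}) \<le> (K / ?a\<^sup>2) * norm (1 / real m)"
    using eventually_ge_at_top[of "4 * CARD('d)"] eventually_gt_at_top[of 0]
  proof eventually_elim
    fix m :: nat
    assume d: "dist (?E m / real m) F < ?a" and m: "4 * CARD('d) \<le> m" and m0: "0 < m"
    let ?R = "random_points m :: (nat \<Rightarrow> real ^ 'd) measure"
    interpret prob_space ?R by (rule prob_space_random_points)
    have f: "random_variable borel (?f m)" by (rule measurable_num_facets)
    \<comment> \<open>A crude bound by the number of index sets, which serves only to make the
      moments finite for each fixed \<open>m\<close>.\<close>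
    have bdn: "num_facets (hull_of m x) \<le> 2 ^ m" for x :: "nat \<Rightarrow> real ^ 'd"
    proof -
      have "card {J \<in> Pow {..<m}. facet_pattern m x J} \<le> card (Pow {..<m})" by (intro card_mono) auto
      then show ?thesis by (simp add: num_facets_hull_of card_Pow)
    qed
    have int2: "integrable ?R (\<lambda>x. (?f m x)\<^sup>2)"
      by (rule integrable_const_bound[where B="(2 ^ m)\<^sup>2"]) (auto simp: bdn intro!: f)
    have int1: "integrable ?R (?f m)"
      by (rule integrable_const_bound[where B="2 ^ m"]) (auto simp: bdn intro: f)
    have E: "expectation (?f m) = ?E m" by (simp add: expected_facets_def)
    have dm: "\<bar>?E m - F * real m\<bar> < ?a * real m"
    proof -
      have "\<bar>?E m / real m - F\<bar> * real m < ?a * real m" using d m0 by (intro mult_strict_right_mono) (auto simp: dist_real_def)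
      moreover have "\<bar>?E m / real m - F\<bar> * real m = \<bar>(?E m / real m - F) * real m\<bar>" by (simp add: abs_mult)
      moreover have "(?E m / real m - F) * real m = ?E m - F * real m" using m0 by (simp add: left_diff_distrib)
      ultimately show ?thesis by simp
    qed
    have "{x \<in> space ?R. \<bar>?f m x - F * real m\<bar> \<ge> \<epsilon> * F * real m} \<subseteq> {x \<in> space ?R. ?a * real m \<le> \<bar>?f m x - expectation (?f m)\<bar>}"
    proof
      fix x assume x: "x \<in> {x \<in> space ?R. \<bar>?f m x - F * real m\<bar> \<ge> \<epsilon> * F * real m}"
      have "\<epsilon> * F * real m = ?a * real m + ?a * real m" by simp
      moreover have "\<epsilon> * F * real m \<le> \<bar>?f m x - F * real m\<bar>" using x by simp
      ultimately have "?a * real m \<le> \<bar>?f m x - ?E m\<bar>" using dm by linarith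
      then show "x \<in> {x \<in> space ?R. ?a * real m \<le> \<bar>?f m x - expectation (?f m)\<bar>}" using x unfolding E by simp
    qed
    then have "prob {x \<in> space ?R. \<bar>?f m x - F * real m\<bar> \<ge> \<epsilon> * F * real m} \<le> prob {x \<in> space ?R. ?a * real m \<le> \<bar>?f m x - expectation (?f m)\<bar>}"
      using f by (intro finite_measure_mono) measurable
    also have "\<dots> \<le> variance (?f m) / (?a * real m)\<^sup>2"
      using a m0 by (intro Chebyshev_inequality f int2) simp
    also have "variance (?f m) = (\<integral>x. (?f m x)\<^sup>2 \<partial>?R) - (?E m)\<^sup>2"
      using variance_eq[OF int1 int2] by (simp only: E)
    also have "\<dots> / (?a * real m)\<^sup>2 \<le> (K * real m) / (?a * real m)\<^sup>2"
      by (intro divide_right_mono K m) simp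
    also have "\<dots> = (K / ?a\<^sup>2) * norm (1 / real m)" using m0 by (simp add: power_mult_distrib power2_eq_square)
    finally show "norm (prob {x \<in> space ?R. \<bar>?f m x - F * real m\<bar> \<ge> \<epsilon> * F * real m}) \<le> (K / ?a\<^sup>2) * norm (1 / real m)"
      by simp
  qed
  then show ?thesis unfolding F_def by (rule bigoI)
qed

end
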